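(* There exists a (finite) access structure $\mathcal{A}$ which is almost ideal but whose dual access structure $\mathcal{A}^\perp$ is not almost ideal.
   Context: A polymatroid $(f,M)$ consists of a finite set $M$ and a function $f$ on subsets of $M$ with $f(\emptyset)=0$ that is non-negative, monotone and submodular. It is entropic if there are jointly distributed discrete random variables $\langle\xi_i:i\in M\rangle$ with $f(A)=\mathbf H(\xi_A)$ (Shannon entropy) for all $A\subseteq M$; it is almost entropic if, viewed as a vector in $\mathbb R^{2^{|M|}-1}$, it lies in the closure of the set of entropic polymatroids on $M$. An access structure on a finite participant set $P$ is a non-empty upward-closed family $\mathcal{A}\subseteq 2^P$ with $\emptyset\notin\mathcal{A}$; its members are called qualified. Its dual is $\mathcal{A}^\perp=\{A\subseteq P: P\setminus A\notin\mathcal{A}\}$. Let $s\notin P$ (the secret); juxtaposition denotes union, e.g. $sA=\{s\}\cup A$. A polymatroid $(f,sP)$ realizes $\mathcal{A}$ if for every $A\subseteq P$: $A\in\mathcal{A}$ iff $f(sA)=f(A)$, and $A\notin\mathcal{A}$ iff $f(sA)=f(A)+f(s)$. The complexity of such a polymatroid is $\sigma(\mathcal M)=\max_{i\in P} f(i)/f(s)$. $\mathcal{A}$ is almost ideal if it is realized by some almost entropic polymatroid of complexity $1$. *)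

theory Defs
  imports "HOL-Probability.Probability"
begin

definition polymatroid :: "('i set \<Rightarrow> real) \<Rightarrow> 'i set \<Rightarrow> bool" where
  "polymatroid f M \<longleftrightarrow> finite M \<and> f {} = 0 \<and>
     (\<forall>A. A \<subseteq> M \<longrightarrow> f A \<ge> 0) \<and>
     (\<forall>A B. A \<subseteq> B \<and> B \<subseteq> M \<longrightarrow> f A \<le> f B) \<and>
     (\<forall>A B. A \<subseteq> M \<and> B \<subseteq> M \<longrightarrow> f (A \<union> B) + f (A \<inter> B) \<le> f A + f B)"

text \<open>Jointly distributed discrete random variables indexed by 'i, with values
  coded in nat, given by a joint distribution p on outcomes 'i \<Rightarrow> nat.
  The marginal of the subfamily indexed by A is the image of p under restriction to A.\<close>
definition marginal :: "('i \<Rightarrow> nat) pmf \<Rightarrow> 'i set \<Rightarrow> ('i \<Rightarrow> nat) pmf" where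
  "marginal p A = map_pmf (\<lambda>\<omega>. restrict \<omega> A) p"

definition entropy_terms :: "('i \<Rightarrow> nat) pmf \<Rightarrow> 'i set \<Rightarrow> ('i \<Rightarrow> nat) \<Rightarrow> real" where
  "entropy_terms p A = (\<lambda>y. - pmf (marginal p A) y * log 2 (pmf (marginal p A) y))"

definition shannon_entropy :: "('i \<Rightarrow> nat) pmf \<Rightarrow> 'i set \<Rightarrow> real" where
  "shannon_entropy p A = infsum (entropy_terms p A) (set_pmf (marginal p A))"

definition entropic :: "('i set \<Rightarrow> real) \<Rightarrow> 'i set \<Rightarrow> bool" where
  "entropic f M \<longleftrightarrow> finite M \<and> (\<exists>p :: ('i \<Rightarrow> nat) pmf.
     \<forall>A. A \<subseteq> M \<longrightarrow>
       (entropy_terms p A) summable_on (set_pmf (marginal p A)) \<and>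
       f A = shannon_entropy p A)"

text \<open>Closure of the entropic vectors in the finite-dimensional space indexed by subsets of M.\<close>
definition almost_entropic :: "('i set \<Rightarrow> real) \<Rightarrow> 'i set \<Rightarrow> bool" where
  "almost_entropic f M \<longleftrightarrow> finite M \<and> (\<forall>e>0. \<exists>g. entropic g M \<and>
     (\<forall>A. A \<subseteq> M \<longrightarrow> \<bar>f A - g A\<bar> < e))"

definition access_structure :: "'i set \<Rightarrow> 'i set set \<Rightarrow> bool" where
  "access_structure P \<A> \<longleftrightarrow> \<A> \<subseteq> Pow P \<and> \<A> \<noteq> {} \<and> {} \<notin> \<A> \<and>
     (\<forall>A B. A \<in> \<A> \<and> A \<subseteq> B \<and> B \<subseteq> P \<longrightarrow> B \<in> \<A>)"

definition dual_access :: "'i set \<Rightarrow> 'i set set \<Rightarrow> 'i set set" where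
  "dual_access P \<A> = {A. A \<subseteq> P \<and> P - A \<notin> \<A>}"

definition realizes :: "('i set \<Rightarrow> real) \<Rightarrow> 'i \<Rightarrow> 'i set \<Rightarrow> 'i set set \<Rightarrow> bool" where
  "realizes f s P \<A> \<longleftrightarrow> polymatroid f (insert s P) \<and>
     (\<forall>A. A \<subseteq> P \<longrightarrow>
        (A \<in> \<A> \<longleftrightarrow> f (insert s A) = f A) \<and>
        (A \<notin> \<A> \<longleftrightarrow> f (insert s A) = f A + f {s}))"

definition complexity :: "('i set \<Rightarrow> real) \<Rightarrow> 'i \<Rightarrow> 'i set \<Rightarrow> real" where
  "complexity f s P = Max ((\<lambda>i. f {i} / f {s}) ` P)"

definition almost_ideal :: "'i set \<Rightarrow> 'i set set \<Rightarrow> bool" where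
  "almost_ideal P \<A> \<longleftrightarrow> (\<exists>s f. s \<notin> P \<and> realizes f s P \<A> \<and>
     almost_entropic f (insert s P) \<and> complexity f s P = 1)"

end

theory Submission
  imports Defs "HOL-Real_Asymp.Real_Asymp" "HOL-Combinatorics.Permutations"
begin

text \<open>
  An ideal scheme is a multiple of a matroid rank function, so the task is to find an almost entropic
  matroid whose dual is not almost entropic.

  The non-Shannon inequality \<open>I(A;B) \<le> I(A;B|C) + I(A;B|D) + I(C;D) + I(A;B|E) + I(A;E|B) + I(B;E|A)\<close>
  holds for almost entropic polymatroids, but its dual fails for an entropic one: let \<open>A\<close>, \<open>B\<close>, \<open>E\<close>
  be bits and let \<open>C\<close>, \<open>D\<close> be constant when \<open>E = A + B\<close>, while otherwise \<open>C\<close> (if \<open>A = 0\<close>) or \<open>D\<close>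
  (if \<open>A = 1\<close>) reveals everything. Arranging 60 such outcomes, five for each outcome with \<open>E = A + B\<close> and ten
  for each other one, in a uniformly random order gives random variables such that every subfamily is uniform
  on its range, and the dual inequality fails by \<open>5!^16 20!^7 < 10!^10 15!^8\<close>.

  Adding small independent noise to many independent copies makes the polymatroid integral. Replacing each
  element of rank \<open>k\<close> by \<open>k\<close> generic elements turns it into a matroid, which is almost entropic since
  the generic elements are realized by random functions: the expected collision probabilities show that the
  entropies are the matroid ranks up to a bounded error. A further generic element of the whole matroid serves
  as the secret; the qualified sets are then the spanning sets. An ideal scheme for the dual access structure
  has to agree with the dual matroid up to one unit, so it inherits the violation of the inequality.
\<close>

section \<open>Entropy on finite weighted sets\<close>

text \<open>Rounding to integers and passing to the dual access structure each cost only a bounded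
  additive error, while the violation grows with the number of copies; this is why many copies are
  taken. Quasi-uniformity is what hashing needs: it bounds the number of outcomes that agree with
  any given outcome, not merely an average, so that collisions can be counted pair by pair. The
  resulting error does not depend on the alphabet size \<open>2 ^ j\<close>, hence it disappears
  after division by \<open>j\<close>. The noise consists of uniform variables, each shared by a set
  \<open>J\<close> of elements. Their rank functions span all functions that vanish on the empty
  set, so rounding coefficients up needs noise of nonnegative amount only. The inequality is
  balanced: constants and modular terms cancel. In the dual rank
  \<open>card A + \<rho> (P - A) - \<rho> P\<close> only the middle term therefore matters, and the
  violation can be tested on \<open>h\<close> at complements.\<close>

definition class_mass :: "'a set \<Rightarrow> ('a \<Rightarrow> real) \<Rightarrow> ('a \<Rightarrow> 'b) \<Rightarrow> 'a \<Rightarrow> real" where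
  "class_mass \<Omega> w X \<omega> = (\<Sum>\<omega>' | \<omega>' \<in> \<Omega> \<and> X \<omega>' = X \<omega>. w \<omega>')"

text \<open>The expectation of minus the logarithm of the probability of the value taken. Only the
  partition into classes of equal value enters, so tuples of different shapes and types are compared
  by \<open>ent_cong\<close> alone.\<close>

definition ent :: "'a set \<Rightarrow> ('a \<Rightarrow> real) \<Rightarrow> ('a \<Rightarrow> 'b) \<Rightarrow> real" where
  "ent \<Omega> w X = (\<Sum>\<omega>\<in>\<Omega>. - w \<omega> * log 2 (class_mass \<Omega> w X \<omega>))"

lemma class_mass_alt:
  "finite \<Omega> \<Longrightarrow> class_mass \<Omega> w X \<omega> = (\<Sum>\<omega>'\<in>\<Omega>. if X \<omega>' = X \<omega> then w \<omega>' else 0)"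
  unfolding class_mass_def by (rule sum.inter_filter)

lemma class_mass_cong:
  assumes "\<And>\<omega>'. \<omega>' \<in> \<Omega> \<Longrightarrow> X \<omega>' = X \<omega> \<longleftrightarrow> Y \<omega>' = Y \<omega>"
  shows "class_mass \<Omega> w X \<omega> = class_mass \<Omega> w Y \<omega>"
  unfolding class_mass_def using assms by (intro sum.cong) auto

lemma ent_cong:
  assumes "\<And>\<omega> \<omega>'. \<omega> \<in> \<Omega> \<Longrightarrow> \<omega>' \<in> \<Omega> \<Longrightarrow> X \<omega>' = X \<omega> \<longleftrightarrow> Y \<omega>' = Y \<omega>"
  shows "ent \<Omega> w X = ent \<Omega> w Y"
  unfolding ent_def
proof (intro sum.cong refl)
  fix \<omega> assume "\<omega> \<in> \<Omega>"
  then have "class_mass \<Omega> w X \<omega> = class_mass \<Omega> w Y \<omega>"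
    by (intro class_mass_cong assms)
  then show "- w \<omega> * log 2 (class_mass \<Omega> w X \<omega>) = - w \<omega> * log 2 (class_mass \<Omega> w Y \<omega>)"
    by simp
qed

lemma class_mass_eq:
  assumes "X \<omega> = X \<omega>'"
  shows "class_mass \<Omega> w X \<omega> = class_mass \<Omega> w X \<omega>'"
  unfolding class_mass_def using assms by simp

text \<open>Expectations are transported along a map that pushes \<open>w'\<close> forward to
  \<open>w\<close>; both projections of the copy space are such maps.\<close>

lemma sum_marginal:
  fixes g :: "'b \<Rightarrow> real"
  assumes "finite \<Omega>'" "finite \<Omega>" "f ` \<Omega>' \<subseteq> \<Omega>"
    and "\<And>\<omega>. \<omega> \<in> \<Omega> \<Longrightarrow> (\<Sum>z | z \<in> \<Omega>' \<and> f z = \<omega>. w' z) = w \<omega>"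
  shows "(\<Sum>z\<in>\<Omega>'. w' z * g (f z)) = (\<Sum>\<omega>\<in>\<Omega>. w \<omega> * g \<omega>)"
proof -
  have "(\<Sum>\<omega>\<in>\<Omega>. w \<omega> * g \<omega>) = (\<Sum>\<omega>\<in>\<Omega>. \<Sum>z | z \<in> \<Omega>' \<and> f z = \<omega>. w' z * g (f z))"
  proof (rule sum.cong[OF refl])
    fix \<omega> assume "\<omega> \<in> \<Omega>"
    then have "w \<omega> * g \<omega> = (\<Sum>z | z \<in> \<Omega>' \<and> f z = \<omega>. w' z * g \<omega>)"
      by (simp add: assms(4)[symmetric] sum_distrib_right)
    then show "w \<omega> * g \<omega> = (\<Sum>z | z \<in> \<Omega>' \<and> f z = \<omega>. w' z * g (f z))"
      by simp
  qed
  also have "\<dots> = (\<Sum>z\<in>\<Omega>'. w' z * g (f z))"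
    using assms by (intro sum.group) auto
  finally show ?thesis by simp
qed

lemma class_mass_marginal:
  assumes "finite \<Omega>'" "finite \<Omega>" "f ` \<Omega>' \<subseteq> \<Omega>"
    and "\<And>\<omega>. \<omega> \<in> \<Omega> \<Longrightarrow> (\<Sum>z | z \<in> \<Omega>' \<and> f z = \<omega>. w' z) = w \<omega>"
  shows "class_mass \<Omega>' w' (\<lambda>z. X (f z)) z = class_mass \<Omega> w X (f z)"
  using sum_marginal[OF assms, where g = "\<lambda>x. if X x = X (f z) then 1 else 0"] assms(1,2)
  by (simp add: class_mass_alt if_distrib cong: if_cong)

lemma ent_marginal:
  assumes "finite \<Omega>'" "finite \<Omega>" "f ` \<Omega>' \<subseteq> \<Omega>"
    and "\<And>\<omega>. \<omega> \<in> \<Omega> \<Longrightarrow> (\<Sum>z | z \<in> \<Omega>' \<and> f z = \<omega>. w' z) = w \<omega>"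
  shows "ent \<Omega>' w' (\<lambda>z. X (f z)) = ent \<Omega> w X"
  using sum_marginal[OF assms, where g = "\<lambda>x. log 2 (class_mass \<Omega> w X x)"]
  by (simp add: ent_def class_mass_marginal[OF assms] sum_negf)

locale weighted_space =
  fixes \<Omega> :: "'a set" and w :: "'a \<Rightarrow> real"
  assumes finite_space: "finite \<Omega>"
    and weight_pos: "\<omega> \<in> \<Omega> \<Longrightarrow> w \<omega> > 0"
    and weight_sum: "sum w \<Omega> = 1"
begin

lemma class_mass_pos: "\<omega> \<in> \<Omega> \<Longrightarrow> class_mass \<Omega> w X \<omega> > 0"
  unfolding class_mass_def using finite_space weight_pos by (intro sum_pos2[of _ \<omega>]) (auto intro: less_imp_le)

lemma class_mass_mono:
  assumes "\<And>\<omega>'. \<omega>' \<in> \<Omega> \<Longrightarrow> X \<omega>' = X \<omega> \<Longrightarrow> Y \<omega>' = Y \<omega>"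
  shows "class_mass \<Omega> w X \<omega> \<le> class_mass \<Omega> w Y \<omega>"
  unfolding class_mass_def using finite_space weight_pos assms by (intro sum_mono2) (auto intro: less_imp_le)

lemma ent_mono:
  assumes "\<And>\<omega> \<omega>'. \<omega> \<in> \<Omega> \<Longrightarrow> \<omega>' \<in> \<Omega> \<Longrightarrow> X \<omega>' = X \<omega> \<Longrightarrow> Y \<omega>' = Y \<omega>"
  shows "ent \<Omega> w Y \<le> ent \<Omega> w X"
  unfolding ent_def
proof (intro sum_mono)
  fix \<omega> assume \<omega>: "\<omega> \<in> \<Omega>"
  have "class_mass \<Omega> w X \<omega> \<le> class_mass \<Omega> w Y \<omega>"
    by (rule class_mass_mono) (rule assms[OF \<omega>])
  then have "log 2 (class_mass \<Omega> w X \<omega>) \<le> log 2 (class_mass \<Omega> w Y \<omega>)"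
    using class_mass_pos[OF \<omega>, of X] by simp
  then show "- w \<omega> * log 2 (class_mass \<Omega> w Y \<omega>) \<le> - w \<omega> * log 2 (class_mass \<Omega> w X \<omega>)"
    using weight_pos[OF \<omega>] by simp
qed

text \<open>The ratio is the density of the coupling that makes \<open>X\<close> and
  \<open>Y\<close> independent given \<open>Z\<close>, relative to the true law. The sum is the mass
  of that coupling on triples of values that occur, which may be less than one.\<close>

lemma sum_weight_ratio_le_one:
  "(\<Sum>\<omega>\<in>\<Omega>. w \<omega> * (class_mass \<Omega> w (\<lambda>\<omega>. (X \<omega>, Z \<omega>)) \<omega> * class_mass \<Omega> w (\<lambda>\<omega>. (Y \<omega>, Z \<omega>)) \<omega>
      / (class_mass \<Omega> w (\<lambda>\<omega>. (X \<omega>, Y \<omega>, Z \<omega>)) \<omega> * class_mass \<Omega> w Z \<omega>))) \<le> 1"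
proof -
  define pz where "pz = class_mass \<Omega> w Z"
  define pv where "pv = class_mass \<Omega> w (\<lambda>\<omega>. (X \<omega>, Y \<omega>, Z \<omega>))"
  define k where "k = (\<lambda>\<omega>. w \<omega> / (pv \<omega> * pz \<omega>))"
  have pos: "pz \<omega> > 0" "pv \<omega> > 0" if "\<omega> \<in> \<Omega>" for \<omega>
    using that by (auto simp: pz_def pv_def class_mass_pos)
  have "(\<Sum>\<omega>\<in>\<Omega>. w \<omega> * (class_mass \<Omega> w (\<lambda>\<omega>. (X \<omega>, Z \<omega>)) \<omega> * class_mass \<Omega> w (\<lambda>\<omega>. (Y \<omega>, Z \<omega>)) \<omega>
      / (pv \<omega> * pz \<omega>)))
     = (\<Sum>\<omega>\<in>\<Omega>. \<Sum>x\<in>\<Omega>. \<Sum>y\<in>\<Omega>. (if X x = X \<omega> \<and> Z x = Z \<omega> \<and> Y y = Y \<omega> \<and> Z y = Z \<omega> then w x * w y * k \<omega> else 0))"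
  proof (intro sum.cong refl)
    fix \<omega>
    have "w \<omega> * (class_mass \<Omega> w (\<lambda>\<omega>. (X \<omega>, Z \<omega>)) \<omega> * class_mass \<Omega> w (\<lambda>\<omega>. (Y \<omega>, Z \<omega>)) \<omega>
      / (pv \<omega> * pz \<omega>)) = (\<Sum>x\<in>\<Omega>. if X x = X \<omega> \<and> Z x = Z \<omega> then w x else 0) *
         (\<Sum>y\<in>\<Omega>. if Y y = Y \<omega> \<and> Z y = Z \<omega> then w y else 0) * k \<omega>"
      by (simp add: class_mass_alt[OF finite_space] k_def)
    also have "\<dots> = (\<Sum>x\<in>\<Omega>. \<Sum>y\<in>\<Omega>. (if X x = X \<omega> \<and> Z x = Z \<omega> \<and> Y y = Y \<omega> \<and> Z y = Z \<omega> then w x * w y * k \<omega> else 0))"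
      unfolding sum_product unfolding sum_distrib_right by (intro sum.cong refl) auto
    finally show "w \<omega> * (class_mass \<Omega> w (\<lambda>\<omega>. (X \<omega>, Z \<omega>)) \<omega> * class_mass \<Omega> w (\<lambda>\<omega>. (Y \<omega>, Z \<omega>)) \<omega>
      / (pv \<omega> * pz \<omega>)) = (\<Sum>x\<in>\<Omega>. \<Sum>y\<in>\<Omega>. (if X x = X \<omega> \<and> Z x = Z \<omega> \<and> Y y = Y \<omega> \<and> Z y = Z \<omega> then w x * w y * k \<omega> else 0))" .
  qed
  also have "\<dots> = (\<Sum>x\<in>\<Omega>. \<Sum>y\<in>\<Omega>. \<Sum>\<omega>\<in>\<Omega>. (if X x = X \<omega> \<and> Z x = Z \<omega> \<and> Y y = Y \<omega> \<and> Z y = Z \<omega> then w x * w y * k \<omega> else 0))"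
    by (rule trans[OF sum.swap], rule sum.cong[OF refl], rule sum.swap)
  \<comment> \<open>For fixed \<open>x\<close> and \<open>y\<close> the contributing outcomes form
    one class of the triple, so the sum of \<open>k\<close> over them is \<open>1 / pz x\<close>. It
    is zero if no outcome combines the two values, and here equality may fail.\<close>
  also have "\<dots> \<le> (\<Sum>x\<in>\<Omega>. \<Sum>y\<in>\<Omega>. if Z y = Z x then w x * w y / pz x else 0)"
  proof (intro sum_mono)
    fix x y assume x: "x \<in> \<Omega>" and y: "y \<in> \<Omega>"
    define R where "R = {\<omega>\<in>\<Omega>. X x = X \<omega> \<and> Z x = Z \<omega> \<and> Y y = Y \<omega> \<and> Z y = Z \<omega>}"
    have eq: "(\<Sum>\<omega>\<in>\<Omega>. (if X x = X \<omega> \<and> Z x = Z \<omega> \<and> Y y = Y \<omega> \<and> Z y = Z \<omega> then w x * w y * k \<omega> else 0))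
      = w x * w y * (\<Sum>\<omega>\<in>R. k \<omega>)"
      unfolding R_def sum.inter_filter[OF finite_space] sum_distrib_left by (intro sum.cong) auto
    show "(\<Sum>\<omega>\<in>\<Omega>. (if X x = X \<omega> \<and> Z x = Z \<omega> \<and> Y y = Y \<omega> \<and> Z y = Z \<omega> then w x * w y * k \<omega> else 0))
      \<le> (if Z y = Z x then w x * w y / pz x else 0)"
    proof (cases "R = {}")
      case True
      have "w x * w y / pz x > 0" using x y weight_pos pos by simp
      then show ?thesis using eq True by simp
    next
      case False
      then obtain \<omega>0 where \<omega>0: "\<omega>0 \<in> R" by blast
      have zz: "Z y = Z x" using \<omega>0 by (auto simp: R_def)
      have "k \<omega> = w \<omega> / (pv \<omega>0 * pz x)" if "\<omega> \<in> R" for \<omega>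
      proof -
        have "pv \<omega> = pv \<omega>0" "pz \<omega> = pz x"
          using that \<omega>0 unfolding pv_def pz_def R_def by (auto intro!: class_mass_eq)
        then show ?thesis by (simp add: k_def)
      qed
      then have "(\<Sum>\<omega>\<in>R. k \<omega>) = (\<Sum>\<omega>\<in>R. w \<omega>) / (pv \<omega>0 * pz x)"
        by (simp add: sum_divide_distrib)
      also have "(\<Sum>\<omega>\<in>R. w \<omega>) = pv \<omega>0"
        unfolding pv_def class_mass_def using \<omega>0 by (intro sum.cong) (auto simp: R_def)
      finally have "(\<Sum>\<omega>\<in>R. k \<omega>) = 1 / pz x"
        using pos(2)[of \<omega>0] \<omega>0 by (simp add: R_def)
      then show ?thesis using eq zz by simp
    qed
  qed
  also have "\<dots> = (\<Sum>x\<in>\<Omega>. w x)"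
  proof (intro sum.cong refl)
    fix x assume "x \<in> \<Omega>"
    have "(\<Sum>y\<in>\<Omega>. if Z y = Z x then w x * w y / pz x else 0) = w x / pz x * (\<Sum>y | y \<in> \<Omega> \<and> Z y = Z x. w y)"
      unfolding sum.inter_filter[OF finite_space] sum_distrib_left by (intro sum.cong) auto
    also have "(\<Sum>y | y \<in> \<Omega> \<and> Z y = Z x. w y) = pz x" by (simp add: pz_def class_mass_def)
    finally show "(\<Sum>y\<in>\<Omega>. if Z y = Z x then w x * w y / pz x else 0) = w x"
      using pos[OF \<open>x \<in> \<Omega>\<close>] by simp
  qed
  finally show ?thesis using weight_sum by (simp add: pv_def pz_def)
qed

text \<open>Conditional mutual information is nonnegative: \<open>ln t \<le> t - 1\<close> is
  applied to the ratio of \<open>sum_weight_ratio_le_one\<close>.\<close>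

lemma ent_submodular:
  "ent \<Omega> w (\<lambda>\<omega>. (X \<omega>, Y \<omega>, Z \<omega>)) + ent \<Omega> w Z
    \<le> ent \<Omega> w (\<lambda>\<omega>. (X \<omega>, Z \<omega>)) + ent \<Omega> w (\<lambda>\<omega>. (Y \<omega>, Z \<omega>))"
proof -
  define px where "px = class_mass \<Omega> w (\<lambda>\<omega>. (X \<omega>, Z \<omega>))"
  define py where "py = class_mass \<Omega> w (\<lambda>\<omega>. (Y \<omega>, Z \<omega>))"
  define pz where "pz = class_mass \<Omega> w Z"
  define pv where "pv = class_mass \<Omega> w (\<lambda>\<omega>. (X \<omega>, Y \<omega>, Z \<omega>))"
  have "ent \<Omega> w (\<lambda>\<omega>. (X \<omega>, Y \<omega>, Z \<omega>)) + ent \<Omega> w Z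
    - (ent \<Omega> w (\<lambda>\<omega>. (X \<omega>, Z \<omega>)) + ent \<Omega> w (\<lambda>\<omega>. (Y \<omega>, Z \<omega>)))
    = (\<Sum>\<omega>\<in>\<Omega>. w \<omega> * (log 2 (px \<omega>) + log 2 (py \<omega>) - log 2 (pv \<omega>) - log 2 (pz \<omega>)))"
    by (simp add: ent_def px_def py_def pz_def pv_def sum.distrib sum_subtractf algebra_simps sum_negf)
  also have "\<dots> \<le> (\<Sum>\<omega>\<in>\<Omega>. (w \<omega> * (px \<omega> * py \<omega> / (pv \<omega> * pz \<omega>)) - w \<omega>) / ln 2)"
  proof (intro sum_mono)
    fix \<omega> assume \<omega>: "\<omega> \<in> \<Omega>"
    have pos: "px \<omega> > 0" "py \<omega> > 0" "pz \<omega> > 0" "pv \<omega> > 0"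
      using \<omega> by (auto simp: px_def py_def pz_def pv_def class_mass_pos)
    have "log 2 (px \<omega>) + log 2 (py \<omega>) - log 2 (pv \<omega>) - log 2 (pz \<omega>) = ln (px \<omega> * py \<omega> / (pv \<omega> * pz \<omega>)) / ln 2"
      using pos by (simp add: log_def ln_mult ln_div add_divide_distrib diff_divide_distrib)
    also have "\<dots> \<le> (px \<omega> * py \<omega> / (pv \<omega> * pz \<omega>) - 1) / ln 2"
      using pos by (intro divide_right_mono ln_le_minus_one) auto
    finally have "w \<omega> * (log 2 (px \<omega>) + log 2 (py \<omega>) - log 2 (pv \<omega>) - log 2 (pz \<omega>))
       \<le> w \<omega> * ((px \<omega> * py \<omega> / (pv \<omega> * pz \<omega>) - 1) / ln 2)"
      using weight_pos[OF \<omega>] by (intro mult_left_mono) auto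
    then show "w \<omega> * (log 2 (px \<omega>) + log 2 (py \<omega>) - log 2 (pv \<omega>) - log 2 (pz \<omega>))
       \<le> (w \<omega> * (px \<omega> * py \<omega> / (pv \<omega> * pz \<omega>)) - w \<omega>) / ln 2"
      by (simp add: right_diff_distrib)
  qed
  also have "\<dots> = ((\<Sum>\<omega>\<in>\<Omega>. w \<omega> * (px \<omega> * py \<omega> / (pv \<omega> * pz \<omega>))) - 1) / ln 2"
    by (simp add: sum_divide_distrib[symmetric] sum_subtractf weight_sum)
  also have "\<dots> \<le> 0"
    using sum_weight_ratio_le_one[of X Z Y] by (simp add: px_def py_def pz_def pv_def divide_le_0_iff)
  finally show ?thesis by simp
qed

end

section \<open>The copy lemma and a non-Shannon inequality\<close>

definition copy_space :: "'a set \<Rightarrow> ('a \<Rightarrow> 'b) \<Rightarrow> ('a \<times> 'a) set" where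
  "copy_space \<Omega> V = {(x, y). x \<in> \<Omega> \<and> y \<in> \<Omega> \<and> V x = V y}"

text \<open>The first component follows \<open>w\<close>, the second is drawn afresh from the class
  of \<open>V\<close> that contains the first. This is the conditionally independent coupling of two
  copies over \<open>V\<close>.\<close>

definition copy_weight :: "'a set \<Rightarrow> ('a \<Rightarrow> real) \<Rightarrow> ('a \<Rightarrow> 'b) \<Rightarrow> 'a \<times> 'a \<Rightarrow> real" where
  "copy_weight \<Omega> w V = (\<lambda>(x, y). w x * w y / class_mass \<Omega> w V x)"

context weighted_space
begin

lemma finite_copy_space: "finite (copy_space \<Omega> V)"
  by (rule finite_subset[of _ "\<Omega> \<times> \<Omega>"]) (auto simp: copy_space_def finite_space)

text \<open>\<open>R\<close> cuts out a rectangle above a single value \<open>v\<close> of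
  \<open>V\<close>; there the denominator is constant and the sum factors. All marginals and class
  masses of the copy space are instances.\<close>

lemma sum_copy_weight:
  assumes P: "\<And>x y. x \<in> \<Omega> \<Longrightarrow> y \<in> \<Omega> \<Longrightarrow> V x = V y \<Longrightarrow> R x y \<longleftrightarrow> P x \<and> Q y"
    and v: "\<And>x. x \<in> \<Omega> \<Longrightarrow> P x \<Longrightarrow> V x = v"
  shows "(\<Sum>z | z \<in> copy_space \<Omega> V \<and> R (fst z) (snd z). copy_weight \<Omega> w V z)
    = (\<Sum>x | x \<in> \<Omega> \<and> P x. w x) * (\<Sum>y | y \<in> \<Omega> \<and> Q y \<and> V y = v. w y) / (\<Sum>y | y \<in> \<Omega> \<and> V y = v. w y)"
proof -
  have set: "{z. z \<in> copy_space \<Omega> V \<and> R (fst z) (snd z)} = {x \<in> \<Omega>. P x} \<times> {y \<in> \<Omega>. Q y \<and> V y = v}"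
    using P v by (fastforce simp: copy_space_def)
  have "(\<Sum>z | z \<in> copy_space \<Omega> V \<and> R (fst z) (snd z). copy_weight \<Omega> w V z)
     = (\<Sum>x | x \<in> \<Omega> \<and> P x. \<Sum>y | y \<in> \<Omega> \<and> Q y \<and> V y = v. w x * w y / class_mass \<Omega> w V x)"
    unfolding set by (simp add: copy_weight_def sum.cartesian_product)
  also have "\<dots> = (\<Sum>x | x \<in> \<Omega> \<and> P x. \<Sum>y | y \<in> \<Omega> \<and> Q y \<and> V y = v. w x * w y / (\<Sum>y | y \<in> \<Omega> \<and> V y = v. w y))"
    using v by (intro sum.cong refl) (auto simp: class_mass_def)
  finally show ?thesis
    by (simp add: sum_product sum_divide_distrib)
qed

lemma weighted_copy: "weighted_space (copy_space \<Omega> V) (copy_weight \<Omega> w V)"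
  and copy_fst: "\<And>x. x \<in> \<Omega> \<Longrightarrow> (\<Sum>z | z \<in> copy_space \<Omega> V \<and> fst z = x. copy_weight \<Omega> w V z) = w x"
  and copy_snd: "\<And>y. y \<in> \<Omega> \<Longrightarrow> (\<Sum>z | z \<in> copy_space \<Omega> V \<and> snd z = y. copy_weight \<Omega> w V z) = w y"
proof -
  have single: "{x'. x' \<in> \<Omega> \<and> x' = x} = {x}" if "x \<in> \<Omega>" for x using that by auto
  show fst: "(\<Sum>z | z \<in> copy_space \<Omega> V \<and> fst z = x. copy_weight \<Omega> w V z) = w x" if "x \<in> \<Omega>" for x
  proof -
    have "(\<Sum>y | y \<in> \<Omega> \<and> V y = V x. w y) > 0"
      using class_mass_pos[OF that, of V] by (simp add: class_mass_def)
    then show ?thesis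
      using sum_copy_weight[where R = "\<lambda>x' y. x' = x" and P = "\<lambda>x'. x' = x" and Q = "\<lambda>_. True" and v = "V x" and V = V]
        single[OF that] by simp
  qed
  show "(\<Sum>z | z \<in> copy_space \<Omega> V \<and> snd z = y. copy_weight \<Omega> w V z) = w y" if "y \<in> \<Omega>" for y
  proof -
    have "(\<Sum>x | x \<in> \<Omega> \<and> V x = V y. w x) > 0"
      using class_mass_pos[OF that, of V] by (simp add: class_mass_def)
    moreover have "{x. x \<in> \<Omega> \<and> x = y \<and> V x = V y} = {y}" using that by auto
    ultimately show ?thesis
      using sum_copy_weight[where R = "\<lambda>x' y'. y' = y" and P = "\<lambda>x. V x = V y" and Q = "\<lambda>x. x = y" and v = "V y" and V = V]
      by auto
  qed
  have "(\<Sum>z\<in>copy_space \<Omega> V. copy_weight \<Omega> w V z) = (\<Sum>x\<in>\<Omega>. \<Sum>z | z \<in> copy_space \<Omega> V \<and> fst z = x. copy_weight \<Omega> w V z)"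
    using finite_copy_space finite_space by (intro sum.group[symmetric]) (auto simp: copy_space_def)
  also have "\<dots> = 1" using fst weight_sum by simp
  finally show "weighted_space (copy_space \<Omega> V) (copy_weight \<Omega> w V)"
    using finite_copy_space weight_pos class_mass_pos
    by unfold_locales (auto simp: copy_space_def copy_weight_def intro!: divide_pos_pos mult_pos_pos)
qed

lemma ent_copy_fst: "ent (copy_space \<Omega> V) (copy_weight \<Omega> w V) (\<lambda>z. X (fst z)) = ent \<Omega> w X"
  by (rule ent_marginal[OF finite_copy_space finite_space _ copy_fst]) (auto simp: copy_space_def)

lemma ent_copy_snd: "ent (copy_space \<Omega> V) (copy_weight \<Omega> w V) (\<lambda>z. X (snd z)) = ent \<Omega> w X"
  by (rule ent_marginal[OF finite_copy_space finite_space _ copy_snd]) (auto simp: copy_space_def)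

text \<open>In the copy space the second component is independent of the first one given \<^term>\<open>V\<close>.\<close>

lemma ent_copy_pair:
  fixes U :: "'a \<Rightarrow> 'c" and V :: "'a \<Rightarrow> 'b" and E :: "'a \<Rightarrow> 'd"
  assumes UV: "\<And>x y. x \<in> \<Omega> \<Longrightarrow> y \<in> \<Omega> \<Longrightarrow> U x = U y \<Longrightarrow> V x = V y"
  shows "ent (copy_space \<Omega> V) (copy_weight \<Omega> w V) (\<lambda>z. (U (fst z), E (snd z)))
    = ent \<Omega> w U + ent \<Omega> w (\<lambda>x. (V x, E x)) - ent \<Omega> w V"
proof -
  let ?S = "copy_space \<Omega> V" and ?w = "copy_weight \<Omega> w V"
  let ?m = "class_mass \<Omega> w"
  have mass: "class_mass ?S ?w (\<lambda>z. (U (fst z), E (snd z))) z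
      = ?m U (fst z) * ?m (\<lambda>x. (V x, E x)) (snd z) / ?m V (fst z)" if zS: "z \<in> ?S" for z
  proof -
    obtain a b where z: "z = (a, b)" "a \<in> \<Omega>" "b \<in> \<Omega>" "V a = V b" using zS by (auto simp: copy_space_def)
    show ?thesis
      using sum_copy_weight[where R = "\<lambda>x y. U x = U a \<and> E y = E b" and P = "\<lambda>x. U x = U a" and Q = "\<lambda>y. E y = E b" and v = "V a" and V = V]
        UV[of _ a] z by (simp add: class_mass_def conj_commute)
  qed
  have "ent ?S ?w (\<lambda>z. (U (fst z), E (snd z))) = (\<Sum>z\<in>?S. - ?w z * (log 2 (?m U (fst z)) + log 2 (?m (\<lambda>x. (V x, E x)) (snd z)) - log 2 (?m V (fst z))))"
    unfolding ent_def
  proof (intro sum.cong refl)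
    fix z assume z: "z \<in> ?S"
    then have "fst z \<in> \<Omega>" "snd z \<in> \<Omega>" by (auto simp: copy_space_def)
    then have pos: "?m U (fst z) > 0" "?m (\<lambda>x. (V x, E x)) (snd z) > 0" "?m V (fst z) > 0"
      by (auto simp: class_mass_pos)
    show "- ?w z * log 2 (class_mass ?S ?w (\<lambda>z. (U (fst z), E (snd z))) z)
      = - ?w z * (log 2 (?m U (fst z)) + log 2 (?m (\<lambda>x. (V x, E x)) (snd z)) - log 2 (?m V (fst z)))"
      unfolding mass[OF z] using pos by (simp add: log_mult log_divide)
  qed
  also have "\<dots> = (\<Sum>z\<in>?S. - ?w z * log 2 (?m U (fst z))) + (\<Sum>z\<in>?S. - ?w z * log 2 (?m (\<lambda>x. (V x, E x)) (snd z)))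
      - (\<Sum>z\<in>?S. - ?w z * log 2 (?m V (fst z)))"
    by (simp add: sum.distrib sum_subtractf algebra_simps sum_negf)
  also have "(\<Sum>z\<in>?S. - ?w z * log 2 (?m U (fst z))) = ent \<Omega> w U"
    using sum_marginal[OF finite_copy_space finite_space _ copy_fst, where g = "\<lambda>x. log 2 (?m U x)"]
    by (force simp: ent_def sum_negf copy_space_def)
  also have "(\<Sum>z\<in>?S. - ?w z * log 2 (?m V (fst z))) = ent \<Omega> w V"
    using sum_marginal[OF finite_copy_space finite_space _ copy_fst, where g = "\<lambda>x. log 2 (?m V x)"]
    by (force simp: ent_def sum_negf copy_space_def)
  also have "(\<Sum>z\<in>?S. - ?w z * log 2 (?m (\<lambda>x. (V x, E x)) (snd z))) = ent \<Omega> w (\<lambda>x. (V x, E x))"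
    using sum_marginal[OF finite_copy_space finite_space _ copy_snd, where g = "\<lambda>x. log 2 (?m (\<lambda>x. (V x, E x)) x)"]
    by (force simp: ent_def sum_negf copy_space_def)
  finally show ?thesis .
qed

text \<open>The non-Shannon inequality
  \<open>I(A;B) \<le> I(A;B|C) + I(A;B|D) + I(C;D) + I(A;B|E) + I(A;E|B) + I(B;E|A)\<close>
  of Makarychev, Makarychev, Romashchenko and Vereshchagin. It constrains \<^term>\<open>E\<close> only jointly with
  \<^term>\<open>A\<close> and \<^term>\<open>B\<close>, so \<^term>\<open>E\<close> may be replaced by a copy that is independent of
  \<^term>\<open>C\<close> and \<^term>\<open>D\<close> given \<^term>\<open>A\<close> and \<^term>\<open>B\<close>; it then is a sum of Shannon inequalities.\<close>

lemma ent_mmrv: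
  fixes A B C D E :: "'a \<Rightarrow> 'b"
  defines "H \<equiv> (\<lambda>X :: 'a \<Rightarrow> 'b \<times> 'b. ent \<Omega> w X)"
    and "H1 \<equiv> (\<lambda>X :: 'a \<Rightarrow> 'b. ent \<Omega> w X)"
    and "H3 \<equiv> (\<lambda>X :: 'a \<Rightarrow> 'b \<times> 'b \<times> 'b. ent \<Omega> w X)"
  shows "2 * H1 A + 2 * H1 B + H3 (\<lambda>x. (A x, B x, C x)) + H3 (\<lambda>x. (A x, B x, D x))
      + H (\<lambda>x. (C x, D x)) + 3 * H3 (\<lambda>x. (A x, B x, E x)) + H1 E
    \<le> H (\<lambda>x. (A x, C x)) + H (\<lambda>x. (B x, C x)) + H (\<lambda>x. (A x, D x)) + H (\<lambda>x. (B x, D x))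
      + 2 * H (\<lambda>x. (A x, E x)) + 2 * H (\<lambda>x. (B x, E x)) + 3 * H (\<lambda>x. (A x, B x))"
proof -
  define V where "V = (\<lambda>x. (A x, B x))"
  define S where "S = copy_space \<Omega> V"
  define u where "u = copy_weight \<Omega> w V"
  interpret copy: weighted_space S u
    unfolding S_def u_def by (rule weighted_copy)
  define a where "a = (\<lambda>z :: 'a \<times> 'a. A (fst z))"
  define b where "b = (\<lambda>z :: 'a \<times> 'a. B (fst z))"
  define c where "c = (\<lambda>z :: 'a \<times> 'a. C (fst z))"
  define d where "d = (\<lambda>z :: 'a \<times> 'a. D (fst z))"
  define e where "e = (\<lambda>z :: 'a \<times> 'a. E (snd z))"
  have ab: "a z = A (snd z)" "b z = B (snd z)" if "z \<in> S" for z
    using that by (auto simp: S_def copy_space_def V_def a_def b_def)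
  note fst = ent_copy_fst[of V, folded S_def u_def]
  note snd = ent_copy_snd[of V, folded S_def u_def]
  note pair = ent_copy_pair[of _ V, folded S_def u_def]
  \<comment> \<open>The Shannon inequalities used state that I(C;D|E), I(E;AB|CD), I(A;B|CE),
    I(A;B|DE), I(E;C|A), I(E;D|A), I(E;C|B) and I(E;D|B) are nonnegative in the copy space.\<close>
  have 1: "ent S u (\<lambda>z. (c z, d z, e z)) + ent S u e \<le> ent S u (\<lambda>z. (c z, e z)) + ent S u (\<lambda>z. (d z, e z))"
    by (rule copy.ent_submodular)
  have "ent S u (\<lambda>z. (e z, (a z, b z), (c z, d z))) + ent S u (\<lambda>z. (c z, d z))
      \<le> ent S u (\<lambda>z. (e z, (c z, d z))) + ent S u (\<lambda>z. ((a z, b z), (c z, d z)))"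
    by (rule copy.ent_submodular)
  moreover have "ent S u (\<lambda>z. (e z, (a z, b z), (c z, d z))) = ent S u (\<lambda>z. ((a z, b z, c z, d z), e z))"
    "ent S u (\<lambda>z. (e z, (c z, d z))) = ent S u (\<lambda>z. (c z, d z, e z))"
    "ent S u (\<lambda>z. ((a z, b z), (c z, d z))) = ent S u (\<lambda>z. (a z, b z, c z, d z))"
    by (rule ent_cong; auto)+
  ultimately have 2: "ent S u (\<lambda>z. ((a z, b z, c z, d z), e z)) + ent S u (\<lambda>z. (c z, d z))
      \<le> ent S u (\<lambda>z. (c z, d z, e z)) + ent S u (\<lambda>z. (a z, b z, c z, d z))" by simp
  have ABX: "ent S u (\<lambda>z. ((a z, b z, x z), e z)) + ent S u (\<lambda>z. (x z, e z))
      \<le> ent S u (\<lambda>z. (a z, x z, e z)) + ent S u (\<lambda>z. (b z, x z, e z))" for x :: "'a \<times> 'a \<Rightarrow> 'b"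
  proof -
    have "ent S u (\<lambda>z. (a z, b z, (x z, e z))) = ent S u (\<lambda>z. ((a z, b z, x z), e z))"
      by (rule ent_cong) auto
    then show ?thesis using copy.ent_submodular[of a b "\<lambda>z. (x z, e z)"] by simp
  qed
  have EXY: "ent S u (\<lambda>z. (y z, x z, e z)) + ent S u y
      \<le> ent S u (\<lambda>z. (y z, e z)) + ent S u (\<lambda>z. (y z, x z))" for x y :: "'a \<times> 'a \<Rightarrow> 'b"
  proof -
    have "ent S u (\<lambda>z. (e z, x z, y z)) = ent S u (\<lambda>z. (y z, x z, e z))"
      "ent S u (\<lambda>z. (e z, y z)) = ent S u (\<lambda>z. (y z, e z))"
      "ent S u (\<lambda>z. (x z, y z)) = ent S u (\<lambda>z. (y z, x z))"
      by (rule ent_cong; auto)+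
    then show ?thesis using copy.ent_submodular[of e x y] by simp
  qed
  have VE: "ent \<Omega> w (\<lambda>x. (V x, E x)) = H3 (\<lambda>x. (A x, B x, E x))"
    unfolding H3_def V_def by (rule ent_cong) auto
  \<comment> \<open>Conditional independence over \<open>V\<close> removes the copied
    \<open>e\<close> from the large joint entropies. The joint entropy of \<open>a\<close>,
    \<open>b\<close>, \<open>c\<close>, \<open>d\<close> that arises here cancels against the one in
    \<open>2\<close>.\<close>
  have abcde: "ent S u (\<lambda>z. ((a z, b z, c z, d z), e z))
      = ent S u (\<lambda>z. (a z, b z, c z, d z)) + H3 (\<lambda>x. (A x, B x, E x)) - H (\<lambda>x. (A x, B x))"
    using pair[of "\<lambda>x. (A x, B x, C x, D x)" E] fst[of "\<lambda>x. (A x, B x, C x, D x)"] VE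
    by (simp add: V_def H_def a_def b_def c_def d_def e_def)
  have abce: "ent S u (\<lambda>z. ((a z, b z, c z), e z))
      = H3 (\<lambda>x. (A x, B x, C x)) + H3 (\<lambda>x. (A x, B x, E x)) - H (\<lambda>x. (A x, B x))"
    using pair[of "\<lambda>x. (A x, B x, C x)" E] VE
    by (simp add: V_def H_def H3_def a_def b_def c_def d_def e_def)
  have abde: "ent S u (\<lambda>z. ((a z, b z, d z), e z))
      = H3 (\<lambda>x. (A x, B x, D x)) + H3 (\<lambda>x. (A x, B x, E x)) - H (\<lambda>x. (A x, B x))"
    using pair[of "\<lambda>x. (A x, B x, D x)" E] VE
    by (simp add: V_def H_def H3_def a_def b_def c_def d_def e_def)
  \<comment> \<open>On \<open>S\<close> the values of \<open>a\<close> and \<open>b\<close> can be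
    read off either component, so their pairs with \<open>e\<close> keep their original
    laws.\<close>
  have ae: "ent S u (\<lambda>z. (a z, e z)) = H (\<lambda>x. (A x, E x))"
  proof -
    have "ent S u (\<lambda>z. (a z, e z)) = ent S u (\<lambda>z. (A (snd z), E (snd z)))"
      by (rule ent_cong) (simp add: ab e_def)
    then show ?thesis using snd[of "\<lambda>x. (A x, E x)"] by (simp add: H_def)
  qed
  have be: "ent S u (\<lambda>z. (b z, e z)) = H (\<lambda>x. (B x, E x))"
  proof -
    have "ent S u (\<lambda>z. (b z, e z)) = ent S u (\<lambda>z. (B (snd z), E (snd z)))"
      by (rule ent_cong) (simp add: ab e_def)
    then show ?thesis using snd[of "\<lambda>x. (B x, E x)"] by (simp add: H_def)
  qed
  have marg: "ent S u a = H1 A" "ent S u b = H1 B" "ent S u e = H1 E"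
    "ent S u (\<lambda>z. (a z, c z)) = H (\<lambda>x. (A x, C x))" "ent S u (\<lambda>z. (b z, c z)) = H (\<lambda>x. (B x, C x))"
    "ent S u (\<lambda>z. (a z, d z)) = H (\<lambda>x. (A x, D x))" "ent S u (\<lambda>z. (b z, d z)) = H (\<lambda>x. (B x, D x))"
    "ent S u (\<lambda>z. (c z, d z)) = H (\<lambda>x. (C x, D x))"
    using fst[of A] fst[of B] snd[of E] fst[of "\<lambda>x. (A x, C x)"] fst[of "\<lambda>x. (B x, C x)"]
      fst[of "\<lambda>x. (A x, D x)"] fst[of "\<lambda>x. (B x, D x)"] fst[of "\<lambda>x. (C x, D x)"]
    by (simp_all add: H_def H1_def a_def b_def c_def d_def e_def)
  show ?thesis
    using 1 2 ABX[of c] ABX[of d] EXY[of a c] EXY[of a d] EXY[of b c] EXY[of b d]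
    unfolding abcde abce abde ae be marg by linarith
qed

end

section \<open>Almost entropic functions\<close>

lemma weighted_space_pmf:
  assumes "finite (set_pmf p)"
  shows "weighted_space (set_pmf p) (pmf p)"
  using assms by unfold_locales (auto simp: pmf_positive sum_pmf_eq_1)

lemma
  fixes Y :: "'a \<Rightarrow> 'i \<Rightarrow> nat"
  assumes fin: "finite (set_pmf p)"
  shows shannon_entropy_map_pmf:
      "shannon_entropy (map_pmf Y p) A = ent (set_pmf p) (pmf p) (\<lambda>\<omega>. restrict (Y \<omega>) A)"
    and summable_entropy_terms:
      "entropy_terms (map_pmf Y p) A summable_on set_pmf (marginal (map_pmf Y p) A)"
proof -
  define Z where "Z = (\<lambda>\<omega>. restrict (Y \<omega>) A)"
  define q where "q = map_pmf Z p"
  have marg: "marginal (map_pmf Y p) A = q"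
    by (simp add: marginal_def q_def Z_def pmf.map_comp o_def)
  have set: "set_pmf q = Z ` set_pmf p" by (simp add: q_def)
  have pmf_q: "(\<Sum>z | z \<in> set_pmf p \<and> Z z = y. pmf p z) = pmf q y" for y
  proof -
    have "pmf q y = measure p (Z -` {y} \<inter> set_pmf p)"
      by (simp add: q_def pmf_map measure_Int_set_pmf)
    also have "\<dots> = sum (pmf p) (Z -` {y} \<inter> set_pmf p)"
      using fin by (simp add: measure_measure_pmf_finite)
    finally show ?thesis by (simp add: vimage_def Int_def conj_commute)
  qed
  have finq: "finite (set_pmf q)" using fin set by simp
  show "entropy_terms (map_pmf Y p) A summable_on set_pmf (marginal (map_pmf Y p) A)"
    using finq by (simp add: marg)
  have "shannon_entropy (map_pmf Y p) A = - (\<Sum>y\<in>set_pmf q. pmf q y * log 2 (pmf q y))"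
    using finq by (simp add: shannon_entropy_def entropy_terms_def marg sum_negf)
  also have "(\<Sum>y\<in>set_pmf q. pmf q y * log 2 (pmf q y)) = (\<Sum>\<omega>\<in>set_pmf p. pmf p \<omega> * log 2 (pmf q (Z \<omega>)))"
    using sum_marginal[OF fin finq, of Z "pmf p" "pmf q" "\<lambda>y. log 2 (pmf q y)"] pmf_q set by simp
  also have "- \<dots> = ent (set_pmf p) (pmf p) Z"
    unfolding ent_def class_mass_def by (simp add: pmf_q sum_negf)
  finally show "shannon_entropy (map_pmf Y p) A = ent (set_pmf p) (pmf p) (\<lambda>\<omega>. restrict (Y \<omega>) A)"
    by (simp add: Z_def)
qed

text \<open>A value has at least the mass of each of its preimages, so passing to the image lowers
  the series term by term. The source may have infinite support, which calls for comparing summable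
  series.\<close>

lemma sum_entropy_map_le:
  fixes q :: "'a pmf" and \<phi> :: "'a \<Rightarrow> 'b"
  defines "r \<equiv> map_pmf \<phi> q"
  assumes sum: "(\<lambda>y. - pmf q y * log 2 (pmf q y)) summable_on set_pmf q" and fin: "finite (set_pmf r)"
  shows "(\<Sum>z\<in>set_pmf r. - pmf r z * log 2 (pmf r z)) \<le> infsum (\<lambda>y. - pmf q y * log 2 (pmf q y)) (set_pmf q)"
proof -
  let ?f = "\<lambda>y. pmf q y * - log 2 (pmf r (\<phi> y))" and ?g = "\<lambda>y. - pmf q y * log 2 (pmf q y)"
  have bounds: "0 \<le> ?f y \<and> ?f y \<le> ?g y" if "y \<in> set_pmf q" for y
  proof -
    have pos: "pmf q y > 0" using that by (simp add: pmf_positive)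
    have "pmf q y = measure q {y}" by (simp add: measure_pmf_single)
    also have "\<dots> \<le> measure q (\<phi> -` {\<phi> y})" by (intro measure_pmf.finite_measure_mono) auto
    finally have le: "pmf q y \<le> pmf r (\<phi> y)" by (simp add: r_def pmf_map)
    then have "log 2 (pmf q y) \<le> log 2 (pmf r (\<phi> y))" using pos by simp
    moreover have "log 2 (pmf r (\<phi> y)) \<le> 0"
      using pos le pmf_le_1[of r "\<phi> y"] by simp
    ultimately show ?thesis using pos by (simp add: mult_nonneg_nonpos)
  qed
  have sf: "?f summable_on set_pmf q"
    by (rule summable_on_comparison_test[OF sum]) (use bounds in auto)
  then have "(\<lambda>y. norm (?f y)) summable_on set_pmf q"
    using bounds by (subst summable_on_cong[where g = ?f]) auto
  then have abs: "Infinite_Set_Sum.abs_summable_on ?f (set_pmf q)"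
    by (subst abs_summable_equivalent[symmetric])
  have "(\<Sum>z\<in>set_pmf r. - pmf r z * log 2 (pmf r z)) = measure_pmf.expectation r (\<lambda>z. - log 2 (pmf r z))"
    using fin by (subst integral_measure_pmf_real[of "set_pmf r"]) (auto simp: mult.commute)
  also have "\<dots> = measure_pmf.expectation q (\<lambda>y. - log 2 (pmf r (\<phi> y)))"
    by (subst (1) r_def) simp
  also have "\<dots> = infsetsum ?f UNIV" by (rule pmf_expectation_eq_infsetsum)
  also have "\<dots> = infsetsum ?f (set_pmf q)"
    by (rule infsetsum_cong_neutral) (auto simp: set_pmf_iff)
  also have "\<dots> = infsum ?f (set_pmf q)" by (rule infsetsum_infsum[OF abs])
  also have "\<dots> \<le> infsum ?g (set_pmf q)"
    using infsum_mono[OF sf sum] bounds by blast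
  finally show ?thesis .
qed

definition truncate :: "nat \<Rightarrow> 'i set \<Rightarrow> ('i \<Rightarrow> nat) \<Rightarrow> 'i \<Rightarrow> nat" where
  "truncate k M \<omega> = restrict (\<lambda>i. min (\<omega> i) k) M"

lemma finite_truncate_pmf:
  assumes "finite M"
  shows "finite (set_pmf (map_pmf (truncate k M) p))"
proof -
  have "set_pmf (map_pmf (truncate k M) p) \<subseteq> PiE M (\<lambda>_. {..k})"
    by (auto simp: truncate_def PiE_def Pi_def)
  then show ?thesis using assms by (meson finite_PiE finite_atMost finite_subset)
qed

text \<open>By \<open>sum_entropy_map_le\<close> truncated entropies never exceed the limit. From
  below, a finite partial sum of the series is already within \<open>e\<close>, and its terms
  survive truncation at any large level.\<close>

lemma shannon_entropy_truncate:
  fixes p :: "('i \<Rightarrow> nat) pmf"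
  assumes M: "finite M" and A: "A \<subseteq> M"
    and sum: "entropy_terms p A summable_on set_pmf (marginal p A)"
  shows "(\<lambda>k. shannon_entropy (map_pmf (truncate k M) p) A) \<longlonglongrightarrow> shannon_entropy p A"
proof -
  define q where "q = marginal p A"
  define r where "r = (\<lambda>k. map_pmf (truncate k A) q)"
  have r: "marginal (map_pmf (truncate k M) p) A = r k" for k
    unfolding marginal_def r_def q_def pmf.map_comp using A
    by (intro pmf.map_cong refl) (auto simp: truncate_def fun_eq_iff restrict_def)
  have finA: "finite A" using M A finite_subset by blast
  have finr: "finite (set_pmf (r k))" for k
    unfolding r_def by (rule finite_truncate_pmf[OF finA])
  let ?g = "\<lambda>y. - pmf q y * log 2 (pmf q y)"
  have sumg: "?g summable_on set_pmf q" and hq: "shannon_entropy p A = infsum ?g (set_pmf q)"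
    using sum by (simp_all add: entropy_terms_def[abs_def] q_def shannon_entropy_def)
  have hr: "shannon_entropy (map_pmf (truncate k M) p) A = (\<Sum>z\<in>set_pmf (r k). - pmf (r k) z * log 2 (pmf (r k) z))" for k
    by (simp add: shannon_entropy_def entropy_terms_def r finr)
  have upper: "shannon_entropy (map_pmf (truncate k M) p) A \<le> shannon_entropy p A" for k
    unfolding hr hq r_def by (rule sum_entropy_map_le[OF sumg finr[of k, unfolded r_def]])
  have lower: "eventually (\<lambda>k. shannon_entropy p A - e < shannon_entropy (map_pmf (truncate k M) p) A) sequentially"
    if "e > 0" for e
  proof -
    have "(?g has_sum shannon_entropy p A) (set_pmf q)"
      using sumg hq by simp
    then have "eventually (\<lambda>F. shannon_entropy p A - e < sum ?g F) (finite_subsets_at_top (set_pmf q))"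
      using \<open>e > 0\<close> unfolding has_sum_def by (intro order_tendstoD) auto
    then obtain F where F: "finite F" "F \<subseteq> set_pmf q" "shannon_entropy p A - e < sum ?g F"
      unfolding eventually_finite_subsets_at_top by blast
    \<comment> \<open>\<open>b\<close> exceeds every coordinate of the points of \<open>F\<close>.
      For \<open>k \<ge> b\<close> no other point of the support is merged with one of them, so
      their masses do not change.\<close>
    define b where "b = Suc (\<Sum>y\<in>F. \<Sum>i\<in>A. y i)"
    have less: "y i < b" if "y \<in> F" "i \<in> A" for y i
    proof -
      have "y i \<le> (\<Sum>i\<in>A. y i)" using finA that by (intro member_le_sum) auto
      also have "\<dots> \<le> (\<Sum>y\<in>F. \<Sum>i\<in>A. y i)" using F(1) that by (intro member_le_sum) auto
      finally show ?thesis by (simp add: b_def)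
    qed
    have "shannon_entropy p A - e < shannon_entropy (map_pmf (truncate k M) p) A" if "k \<ge> b" for k
    proof -
      have ext: "y \<in> extensional A" if "y \<in> set_pmf q" for y
        using that by (auto simp: q_def marginal_def)
      have pm: "pmf (r k) y = pmf q y" if y: "y \<in> F" for y
      proof -
        have iff: "truncate k A y' = y \<longleftrightarrow> y' = y" if y': "y' \<in> set_pmf q" for y'
        proof
          assume eq: "truncate k A y' = y"
          show "y' = y"
          proof (rule extensionalityI[of _ A])
            show "y' \<in> extensional A" "y \<in> extensional A" using ext y' y F by auto
            fix i assume i: "i \<in> A"
            have "min (y' i) k = y i" using fun_cong[OF eq, of i] i by (simp add: truncate_def)
            then show "y' i = y i" using less[OF y i] \<open>k \<ge> b\<close> by (simp add: min_def split: if_splits)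
          qed
        next
          assume eq: "y' = y"
          show "truncate k A y' = y"
          proof (rule extensionalityI[of _ A])
            show "truncate k A y' \<in> extensional A" "y \<in> extensional A" using ext y F by (auto simp: truncate_def)
            fix i assume i: "i \<in> A"
            then show "truncate k A y' i = y i" using less[OF y i] \<open>k \<ge> b\<close> eq by (simp add: truncate_def)
          qed
        qed
        have "pmf (r k) y = measure q (truncate k A -` {y} \<inter> set_pmf q)"
          by (simp add: r_def pmf_map measure_Int_set_pmf)
        also have "truncate k A -` {y} \<inter> set_pmf q = {y}" using iff y F by auto
        finally show ?thesis by (simp add: measure_pmf_single)
      qed
      have "sum ?g F = (\<Sum>z\<in>F. - pmf (r k) z * log 2 (pmf (r k) z))"
        by (intro sum.cong) (auto simp: pm)
      also have "\<dots> \<le> (\<Sum>z\<in>set_pmf (r k). - pmf (r k) z * log 2 (pmf (r k) z))"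
      proof (rule sum_mono2[OF finr])
        show "F \<subseteq> set_pmf (r k)" using F pm by (auto simp: set_pmf_iff)
        show "0 \<le> - pmf (r k) z * log 2 (pmf (r k) z)" if "z \<in> set_pmf (r k) - F" for z
          using that pmf_positive[of z "r k"] pmf_le_1[of "r k" z] by (auto simp: mult_nonneg_nonpos)
      qed
      finally show ?thesis using F(3) unfolding hr by linarith
    qed
    then show ?thesis using eventually_ge_at_top[of b] by (rule eventually_mono[rotated])
  qed
  show ?thesis
  proof (rule order_tendstoI)
    fix c assume "c < shannon_entropy p A"
    then show "eventually (\<lambda>k. c < shannon_entropy (map_pmf (truncate k M) p) A) sequentially"
      using lower[of "shannon_entropy p A - c"] by simp
  next
    fix c assume "shannon_entropy p A < c"
    then show "eventually (\<lambda>k. shannon_entropy (map_pmf (truncate k M) p) A < c) sequentially"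
      using upper by (intro always_eventually) (meson le_less_trans)
  qed
qed

text \<open>The copy construction lives on finite spaces, whereas entropic functions may come from
  variables with infinitely many values; truncation bridges the two.\<close>

lemma almost_entropic_approx:
  fixes f :: "'i set \<Rightarrow> real"
  assumes f: "almost_entropic f M" and e: "e > 0"
  obtains \<Omega> :: "('i \<Rightarrow> nat) set" and w where "weighted_space \<Omega> w"
    "\<And>A. A \<subseteq> M \<Longrightarrow> \<bar>f A - ent \<Omega> w (\<lambda>\<omega>. restrict \<omega> A)\<bar> < e"
proof -
  have M: "finite M" using f by (simp add: almost_entropic_def)
  obtain g where g: "entropic g M" "\<And>A. A \<subseteq> M \<Longrightarrow> \<bar>f A - g A\<bar> < e / 2"
    using f e unfolding almost_entropic_def by (meson half_gt_zero)
  then obtain p :: "('i \<Rightarrow> nat) pmf" where p: "\<And>A. A \<subseteq> M \<Longrightarrow> entropy_terms p A summable_on set_pmf (marginal p A)"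
    "\<And>A. A \<subseteq> M \<Longrightarrow> g A = shannon_entropy p A"
    unfolding entropic_def by blast
  have "eventually (\<lambda>k. \<forall>A\<in>Pow M. \<bar>shannon_entropy (map_pmf (truncate k M) p) A - shannon_entropy p A\<bar> < e / 2) sequentially"
  proof (rule eventually_ball_finite)
    show "finite (Pow M)" using M by simp
    show "\<forall>A\<in>Pow M. eventually (\<lambda>k. \<bar>shannon_entropy (map_pmf (truncate k M) p) A - shannon_entropy p A\<bar> < e / 2) sequentially"
    proof
      fix A assume "A \<in> Pow M"
      then have "(\<lambda>k. shannon_entropy (map_pmf (truncate k M) p) A) \<longlonglongrightarrow> shannon_entropy p A"
        using shannon_entropy_truncate[OF M] p by auto
      then show "eventually (\<lambda>k. \<bar>shannon_entropy (map_pmf (truncate k M) p) A - shannon_entropy p A\<bar> < e / 2) sequentially"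
        using e unfolding tendsto_iff dist_real_def by (meson half_gt_zero)
    qed
  qed
  then obtain k where k: "\<And>A. A \<subseteq> M \<Longrightarrow> \<bar>shannon_entropy (map_pmf (truncate k M) p) A - shannon_entropy p A\<bar> < e / 2"
    by (auto simp: eventually_sequentially)
  define q where "q = map_pmf (truncate k M) p"
  have fin: "finite (set_pmf q)" unfolding q_def by (rule finite_truncate_pmf[OF M])
  show ?thesis
  proof (rule that)
    show "weighted_space (set_pmf q) (pmf q)" by (rule weighted_space_pmf[OF fin])
    fix A assume A: "A \<subseteq> M"
    have "shannon_entropy q A = ent (set_pmf q) (pmf q) (\<lambda>\<omega>. restrict \<omega> A)"
      using shannon_entropy_map_pmf[OF fin, of "\<lambda>\<omega>. \<omega>" A] by simp
    then show "\<bar>f A - ent (set_pmf q) (pmf q) (\<lambda>\<omega>. restrict \<omega> A)\<bar> < e"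
      using g(2)[OF A] k[OF A, folded q_def] p(2)[OF A] by linarith
  qed
qed

text \<open>Right side minus left side of \<open>ent_mmrv\<close>. The positive and the negative
  coefficients both add up to 11, and on pairwise disjoint sets all constants and modular functions
  cancel.\<close>

definition mmrv_gap :: "('i set \<Rightarrow> real) \<Rightarrow> 'i set \<Rightarrow> 'i set \<Rightarrow> 'i set \<Rightarrow> 'i set \<Rightarrow> 'i set \<Rightarrow> real" where
  "mmrv_gap f A B C D E = f (A \<union> C) + f (B \<union> C) + f (A \<union> D) + f (B \<union> D)
     + 2 * f (A \<union> E) + 2 * f (B \<union> E) + 3 * f (A \<union> B)
     - 2 * f A - 2 * f B - f (A \<union> B \<union> C) - f (A \<union> B \<union> D) - f (C \<union> D) - 3 * f (A \<union> B \<union> E) - f E"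

lemma restrict_Un_eq_iff:
  "restrict x (A \<union> B) = restrict y (A \<union> B) \<longleftrightarrow> restrict x A = restrict y A \<and> restrict x B = restrict y B"
  by (auto simp: restrict_def fun_eq_iff)

text \<open>A linear inequality that is not strict survives limits of entropy vectors.\<close>

lemma almost_entropic_mmrv:
  assumes f: "almost_entropic f M" and sub: "A \<subseteq> M" "B \<subseteq> M" "C \<subseteq> M" "D \<subseteq> M" "E \<subseteq> M"
  shows "mmrv_gap f A B C D E \<ge> 0"
proof (rule field_le_epsilon)
  fix e :: real assume "e > 0"
  \<comment> \<open>22 is the sum of the absolute values of the coefficients of
    \<open>mmrv_gap\<close>.\<close>
  define \<delta> where "\<delta> = e / 22"
  have \<delta>: "\<delta> > 0" "e = 22 * \<delta>" using \<open>e > 0\<close> by (simp_all add: \<delta>_def)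
  from \<delta>(1) obtain \<Omega> :: "('a \<Rightarrow> nat) set" and w where "weighted_space \<Omega> w"
    and close: "\<And>A. A \<subseteq> M \<Longrightarrow> \<bar>f A - ent \<Omega> w (\<lambda>\<omega>. restrict \<omega> A)\<bar> < \<delta>"
    by (rule almost_entropic_approx[OF f]) blast
  interpret weighted_space \<Omega> w by fact
  let ?h = "\<lambda>A. ent \<Omega> w (\<lambda>\<omega>. restrict \<omega> A)"
  have 2: "ent \<Omega> w (\<lambda>\<omega>. (restrict \<omega> X, restrict \<omega> Y)) = ?h (X \<union> Y)" for X Y
    by (rule ent_cong) (auto simp: restrict_Un_eq_iff)
  have 3: "ent \<Omega> w (\<lambda>\<omega>. (restrict \<omega> X, restrict \<omega> Y, restrict \<omega> Z)) = ?h (X \<union> Y \<union> Z)" for X Y Z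
    by (rule ent_cong) (auto simp: restrict_Un_eq_iff)
  have gap: "mmrv_gap ?h A B C D E \<ge> 0"
    using ent_mmrv[of "\<lambda>\<omega>. restrict \<omega> A" "\<lambda>\<omega>. restrict \<omega> B" "\<lambda>\<omega>. restrict \<omega> C" "\<lambda>\<omega>. restrict \<omega> D" "\<lambda>\<omega>. restrict \<omega> E"]
    unfolding 2 3 by (simp add: mmrv_gap_def)
  have near: "f X < ?h X + \<delta> \<and> ?h X < f X + \<delta>" if "X \<subseteq> M" for X
    using close[OF that] by linarith
  show "0 \<le> mmrv_gap f A B C D E + e"
    using gap near[OF sub(1)] near[OF sub(2)] near[OF sub(5)] near[of "A \<union> C"] near[of "B \<union> C"] near[of "A \<union> D"]
      near[of "B \<union> D"] near[of "A \<union> E"] near[of "B \<union> E"] near[of "A \<union> B"] near[of "A \<union> B \<union> C"]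
      near[of "A \<union> B \<union> D"] near[of "C \<union> D"] near[of "A \<union> B \<union> E"] sub
    unfolding mmrv_gap_def \<delta>(2) by simp
qed

section \<open>Random hashing\<close>

definition fibre :: "'a set \<Rightarrow> ('a \<Rightarrow> 'b) \<Rightarrow> 'a \<Rightarrow> 'a set" where
  "fibre \<Omega> X \<omega> = {\<omega>' \<in> \<Omega>. X \<omega>' = X \<omega>}"

definition uniform_ent :: "'a set \<Rightarrow> ('a \<Rightarrow> 'b) \<Rightarrow> real" where
  "uniform_ent \<Omega> X = (\<Sum>\<omega>\<in>\<Omega>. log 2 (card \<Omega> / card (fibre \<Omega> X \<omega>))) / card \<Omega>"

lemma card_fibre_pos: "finite \<Omega> \<Longrightarrow> \<omega> \<in> \<Omega> \<Longrightarrow> card (fibre \<Omega> X \<omega>) > 0"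
  by (subst card_gt_0_iff) (auto simp: fibre_def)

lemma weighted_space_uniform:
  assumes "finite \<Omega>" "\<Omega> \<noteq> {}"
  shows "weighted_space \<Omega> (\<lambda>_. 1 / card \<Omega>)"
  using assms by unfold_locales (auto simp: card_gt_0_iff)

lemma ent_uniform:
  assumes "finite \<Omega>"
  shows "ent \<Omega> (\<lambda>_. 1 / card \<Omega>) X = uniform_ent \<Omega> X"
proof -
  have "- (1 / card \<Omega>) * log 2 (class_mass \<Omega> (\<lambda>_. 1 / card \<Omega>) X \<omega>) = log 2 (card \<Omega> / card (fibre \<Omega> X \<omega>)) / card \<Omega>"
    if \<omega>: "\<omega> \<in> \<Omega>" for \<omega>
  proof -
    have c: "card (fibre \<Omega> X \<omega>) > 0" "card \<Omega> > 0"
      using card_fibre_pos[OF assms \<omega>] \<omega> assms by (auto simp: card_gt_0_iff)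
    have "class_mass \<Omega> (\<lambda>_. 1 / card \<Omega>) X \<omega> = card (fibre \<Omega> X \<omega>) / card \<Omega>"
      by (simp add: class_mass_def fibre_def)
    then show ?thesis using c by (simp add: log_divide diff_divide_distrib)
  qed
  then show ?thesis unfolding ent_def uniform_ent_def sum_divide_distrib by (intro sum.cong) auto
qed

text \<open>Jensen's inequality for the logarithm, from \<open>ln t \<le> t - 1\<close> at the
  quotients of the values by their mean.\<close>

lemma average_log_le:
  fixes x :: "'a \<Rightarrow> real"
  assumes fin: "finite \<Omega>" "\<Omega> \<noteq> {}" and pos: "\<And>\<omega>. \<omega> \<in> \<Omega> \<Longrightarrow> x \<omega> > 0"
  shows "(\<Sum>\<omega>\<in>\<Omega>. log 2 (x \<omega>)) / card \<Omega> \<le> log 2 ((\<Sum>\<omega>\<in>\<Omega>. x \<omega>) / card \<Omega>)"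
proof -
  define n where "n = real (card \<Omega>)"
  define m where "m = (\<Sum>\<omega>\<in>\<Omega>. x \<omega>) / n"
  have n: "n > 0" using fin by (simp add: n_def card_gt_0_iff)
  have m: "m > 0" unfolding m_def using fin pos n by (intro divide_pos_pos sum_pos) auto
  have "(\<Sum>\<omega>\<in>\<Omega>. ln (x \<omega>) - ln m) \<le> (\<Sum>\<omega>\<in>\<Omega>. x \<omega> / m - 1)"
  proof (rule sum_mono)
    fix \<omega> assume "\<omega> \<in> \<Omega>"
    then have "x \<omega> > 0" by (rule pos)
    then show "ln (x \<omega>) - ln m \<le> x \<omega> / m - 1"
      using ln_le_minus_one[of "x \<omega> / m"] m by (simp add: ln_div)
  qed
  also have "\<dots> = (\<Sum>\<omega>\<in>\<Omega>. x \<omega>) / m - n" by (simp add: sum_subtractf sum_divide_distrib n_def)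
  also have "(\<Sum>\<omega>\<in>\<Omega>. x \<omega>) = m * n" using n by (simp add: m_def)
  finally have "(\<Sum>\<omega>\<in>\<Omega>. ln (x \<omega>)) \<le> n * ln m" using m by (simp add: sum_subtractf n_def)
  then have "(\<Sum>\<omega>\<in>\<Omega>. ln (x \<omega>)) / n \<le> ln m" using n by (simp add: field_simps)
  then have "(\<Sum>\<omega>\<in>\<Omega>. ln (x \<omega>)) / n / ln 2 \<le> ln m / ln 2" by (intro divide_right_mono) auto
  then show ?thesis by (simp add: log_def m_def n_def sum_divide_distrib mult.commute)
qed

lemma sum_inverse_card_fibre:
  assumes "finite \<Omega>"
  shows "(\<Sum>\<omega>\<in>\<Omega>. 1 / real (card (fibre \<Omega> X \<omega>))) = card (X ` \<Omega>)"
proof -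
  have "(\<Sum>\<omega>\<in>\<Omega>. 1 / real (card (fibre \<Omega> X \<omega>))) = (\<Sum>y\<in>X ` \<Omega>. \<Sum>\<omega> | \<omega> \<in> \<Omega> \<and> X \<omega> = y. 1 / real (card (fibre \<Omega> X \<omega>)))"
    using assms by (intro sum.group[symmetric]) auto
  also have "\<dots> = (\<Sum>y\<in>X ` \<Omega>. 1)"
  proof (rule sum.cong[OF refl])
    fix y assume "y \<in> X ` \<Omega>"
    then obtain \<omega> where \<omega>: "\<omega> \<in> \<Omega>" "y = X \<omega>" by blast
    have "(\<Sum>\<omega>' | \<omega>' \<in> \<Omega> \<and> X \<omega>' = y. 1 / real (card (fibre \<Omega> X \<omega>'))) = (\<Sum>\<omega>'\<in>fibre \<Omega> X \<omega>. 1 / real (card (fibre \<Omega> X \<omega>)))"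
      unfolding \<omega>(2) by (intro sum.cong) (auto simp: fibre_def)
    also have "\<dots> = 1" using card_fibre_pos[OF assms \<omega>(1), of X] by simp
    finally show "(\<Sum>\<omega>' | \<omega>' \<in> \<Omega> \<and> X \<omega>' = y. 1 / real (card (fibre \<Omega> X \<omega>'))) = 1" .
  qed
  finally show ?thesis by simp
qed

lemma uniform_ent_le_log_card_image:
  assumes fin: "finite \<Omega>" "\<Omega> \<noteq> {}"
  shows "uniform_ent \<Omega> X \<le> log 2 (card (X ` \<Omega>))"
proof -
  have c: "card \<Omega> > 0" using fin by (simp add: card_gt_0_iff)
  have "uniform_ent \<Omega> X \<le> log 2 ((\<Sum>\<omega>\<in>\<Omega>. card \<Omega> / card (fibre \<Omega> X \<omega>)) / card \<Omega>)"
    unfolding uniform_ent_def using fin card_fibre_pos[OF fin(1), of _ X] c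
    by (intro average_log_le divide_pos_pos) simp_all
  also have "(\<Sum>\<omega>\<in>\<Omega>. card \<Omega> / card (fibre \<Omega> X \<omega>)) / card \<Omega> = (\<Sum>\<omega>\<in>\<Omega>. 1 / real (card (fibre \<Omega> X \<omega>)))"
    using c by (simp add: sum_divide_distrib)
  finally show ?thesis by (simp add: sum_inverse_card_fibre[OF fin(1)])
qed

text \<open>Shannon entropy is at least collision entropy, by Jensen. The sum of fibre sizes divided
  by the square of \<open>card \<Omega>\<close> is the collision probability; \<open>m\<close> is
  the intended number of values and \<open>c\<close> the tolerated loss.\<close>

lemma uniform_ent_ge_collision:
  fixes m c :: real
  assumes fin: "finite \<Omega>" "\<Omega> \<noteq> {}"
    and coll: "(\<Sum>\<omega>\<in>\<Omega>. real (card (fibre \<Omega> X \<omega>))) * m \<le> c * (real (card \<Omega>))\<^sup>2"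
    and pos: "m > 0" "c > 0"
  shows "log 2 m - log 2 c \<le> uniform_ent \<Omega> X"
proof -
  have n: "real (card \<Omega>) > 0" using fin by (simp add: card_gt_0_iff)
  have "(\<Sum>\<omega>\<in>\<Omega>. log 2 (card (fibre \<Omega> X \<omega>) / card \<Omega>)) / card \<Omega>
      \<le> log 2 ((\<Sum>\<omega>\<in>\<Omega>. card (fibre \<Omega> X \<omega>) / card \<Omega>) / card \<Omega>)"
    using fin card_fibre_pos[OF fin(1), of _ X] n by (intro average_log_le divide_pos_pos) simp_all
  also have "\<dots> \<le> log 2 (c / m)"
  proof -
    have "(\<Sum>\<omega>\<in>\<Omega>. real (card (fibre \<Omega> X \<omega>))) > 0"
      using fin card_fibre_pos[OF fin(1), of _ X] by (intro sum_pos) simp_all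
    moreover have "(\<Sum>\<omega>\<in>\<Omega>. real (card (fibre \<Omega> X \<omega>)) / card \<Omega>) / card \<Omega> = (\<Sum>\<omega>\<in>\<Omega>. real (card (fibre \<Omega> X \<omega>))) / (card \<Omega>)\<^sup>2"
      by (simp add: sum_divide_distrib power2_eq_square)
    moreover have "(\<Sum>\<omega>\<in>\<Omega>. real (card (fibre \<Omega> X \<omega>))) / (card \<Omega>)\<^sup>2 \<le> c / m"
      using coll pos n by (simp add: field_simps)
    moreover have "(\<Sum>\<omega>\<in>\<Omega>. real (card (fibre \<Omega> X \<omega>))) / (card \<Omega>)\<^sup>2 > 0"
      using calculation(1) n by (intro divide_pos_pos) auto
    ultimately show ?thesis by (metis log_le_cancel_iff one_less_numeral_iff order_less_le_trans semiring_norm(76))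
  qed
  also have "\<dots> = log 2 c - log 2 m" using pos by (simp add: log_divide)
  also have "(\<Sum>\<omega>\<in>\<Omega>. log 2 (card (fibre \<Omega> X \<omega>) / card \<Omega>)) / card \<Omega> = - uniform_ent \<Omega> X"
  proof -
    have "log 2 (card (fibre \<Omega> X \<omega>) / card \<Omega>) = - log 2 (card \<Omega> / card (fibre \<Omega> X \<omega>))" if "\<omega> \<in> \<Omega>" for \<omega>
      using card_fibre_pos[OF fin(1) that, of X] n by (simp add: log_divide)
    then show ?thesis by (simp add: uniform_ent_def sum_negf)
  qed
  finally show ?thesis by simp
qed

lemma card_image_factor_le:
  assumes "finite \<Omega>" and "\<And>\<omega> \<omega>'. \<omega> \<in> \<Omega> \<Longrightarrow> \<omega>' \<in> \<Omega> \<Longrightarrow> Z \<omega> = Z \<omega>' \<Longrightarrow> Y \<omega> = Y \<omega>'"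
  shows "card (Y ` \<Omega>) \<le> card (Z ` \<Omega>)"
proof -
  have "Y ` \<Omega> = (\<lambda>z. Y (inv_into \<Omega> Z z)) ` (Z ` \<Omega>)"
  proof -
    have "Y (inv_into \<Omega> Z (Z \<omega>)) = Y \<omega>" if "\<omega> \<in> \<Omega>" for \<omega>
      using assms(2)[of "inv_into \<Omega> Z (Z \<omega>)" \<omega>] that by (auto simp: inv_into_into f_inv_into_f)
    then show ?thesis by (force simp: image_image)
  qed
  then show ?thesis using assms(1) by (metis card_image_le finite_imageI)
qed

section \<open>Random hash tables\<close>

text \<open>A table \<open>h\<close> has one free entry for each pair of element and value. A
  collision at an \<open>e\<close> with \<open>x e \<noteq> y e\<close> determines the entry at
  \<open>(e, x e)\<close> from the one at \<open>(e, y e)\<close>, so each such \<open>e\<close>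
  costs a factor \<open>q\<close>.\<close>

lemma card_colliding_hashes:
  fixes x y :: "'e \<Rightarrow> 'v"
  assumes fin: "finite E" "finite V" and T: "T \<subseteq> E" and xy: "\<And>e. e \<in> E \<Longrightarrow> x e \<in> V \<and> y e \<in> V"
  shows "card {h \<in> PiE (E \<times> V) (\<lambda>_. {..<q :: nat}). \<forall>e\<in>T. h (e, x e) = h (e, y e)} * q ^ card {e \<in> T. x e \<noteq> y e}
    \<le> card (PiE (E \<times> V) (\<lambda>_. {..<q}))"
proof -
  define I where "I = E \<times> V"
  define W where "W = (\<lambda>e. (e, x e)) ` {e \<in> T. x e \<noteq> y e}"
  define R where "R = {h \<in> PiE I (\<lambda>_. {..<q}). \<forall>e\<in>T. h (e, x e) = h (e, y e)}"
  have finI: "finite I" using fin by (simp add: I_def)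
  have WI: "W \<subseteq> I" using T xy by (auto simp: W_def I_def)
  have cardW: "card W = card {e \<in> T. x e \<noteq> y e}"
    unfolding W_def by (rule card_image) (auto simp: inj_on_def)
  have "inj_on (\<lambda>h. restrict h (I - W)) R"
  proof (rule inj_onI)
    fix h k assume h: "h \<in> R" and k: "k \<in> R" and eq: "restrict h (I - W) = restrict k (I - W)"
    have off: "h z = k z" if "z \<in> I - W" for z using fun_cong[OF eq, of z] that by simp
    show "h = k"
    proof (rule PiE_ext[of h I "\<lambda>_. {..<q}" k])
      show "h \<in> PiE I (\<lambda>_. {..<q})" "k \<in> PiE I (\<lambda>_. {..<q})" using h k by (auto simp: R_def)
      fix z assume z: "z \<in> I"
      show "h z = k z"
      proof (cases "z \<in> W")
        case True
        then obtain e where e: "z = (e, x e)" "e \<in> T" "x e \<noteq> y e" by (auto simp: W_def)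
        have "(e, y e) \<in> I - W" using e T xy by (auto simp: W_def I_def)
        then show ?thesis using off[of "(e, y e)"] h k e by (auto simp: R_def)
      next
        case False
        then show ?thesis using off z by auto
      qed
    qed
  qed
  then have "card R = card ((\<lambda>h. restrict h (I - W)) ` R)" by (simp add: card_image)
  also have "\<dots> \<le> card (PiE (I - W) (\<lambda>_. {..<q}))"
    using finI by (intro card_mono finite_PiE) (auto simp: R_def PiE_def Pi_def)
  also have "\<dots> = q ^ (card I - card W)"
    using finI WI by (simp add: card_PiE card_Diff_subset finite_subset)
  finally have "card R * q ^ card W \<le> q ^ (card I - card W) * q ^ card W" by simp
  also have "\<dots> = q ^ card I"
    using card_mono[OF finI WI] by (simp flip: power_add)
  also have "\<dots> = card (PiE I (\<lambda>_. {..<q}))" using finI by (simp add: card_PiE)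
  finally show ?thesis by (simp add: R_def I_def cardW)
qed

definition agree :: "'a set \<Rightarrow> ('i \<Rightarrow> 'a \<Rightarrow> 'b) \<Rightarrow> 'i set \<Rightarrow> 'a \<Rightarrow> 'a set" where
  "agree \<Omega> X S \<omega> = {\<omega>' \<in> \<Omega>. \<forall>i\<in>S. X i \<omega>' = X i \<omega>}"

text \<open>Averaging over all tables: a pair of outcomes that agree exactly on \<open>S\<close>
  collides on \<open>T\<close> with probability at most \<open>q\<close> to the minus number of
  elements of \<open>T\<close> outside \<open>S\<close>, while such pairs make up at most a fraction
  \<open>1 / q ^ F S\<close> of all pairs. The hypothesis on \<open>\<rho>\<close> balances the two
  effects.\<close>

lemma exists_hash:
  fixes \<Omega> :: "'a set" and X :: "'i \<Rightarrow> 'a \<Rightarrow> 'v" and F :: "'i set \<Rightarrow> nat" and \<rho> :: "'e set \<Rightarrow> nat"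
  assumes fin: "finite \<Omega>" "\<Omega> \<noteq> {}" "finite N" "finite E" and \<phi>: "\<phi> ` E \<subseteq> N" and q: "q \<ge> (1::nat)"
    and fib: "\<And>S \<omega>. S \<subseteq> N \<Longrightarrow> \<omega> \<in> \<Omega> \<Longrightarrow> card (agree \<Omega> X S \<omega>) * q ^ F S \<le> card \<Omega>"
    and \<rho>: "\<And>T S. T \<subseteq> E \<Longrightarrow> S \<subseteq> N \<Longrightarrow> \<rho> T \<le> F S + card {e \<in> T. \<phi> e \<notin> S}"
  obtains Y :: "'e \<Rightarrow> 'a \<Rightarrow> nat" where
    "\<And>e \<omega>. e \<in> E \<Longrightarrow> \<omega> \<in> \<Omega> \<Longrightarrow> Y e \<omega> < q"
    "\<And>e \<omega> \<omega>'. X (\<phi> e) \<omega> = X (\<phi> e) \<omega>' \<Longrightarrow> Y e \<omega> = Y e \<omega>'"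
    "\<And>T. T \<subseteq> E \<Longrightarrow> (\<Sum>\<omega>\<in>\<Omega>. card (agree \<Omega> Y T \<omega>)) * q ^ \<rho> T \<le> 2 ^ (card E + card N) * (card \<Omega>)\<^sup>2"
proof -
  define V where "V = (\<Union>i\<in>N. X i ` \<Omega>)"
  define HH where "HH = PiE (E \<times> V) (\<lambda>_. {..<q})"
  define Y where "Y = (\<lambda>h e \<omega>. h (e, X (\<phi> e) \<omega>) :: nat)"
  define G where "G = (\<lambda>h T. (\<Sum>\<omega>\<in>\<Omega>. card (agree \<Omega> (Y h) T \<omega>)) * q ^ \<rho> T)"
  have finV: "finite V" using fin by (simp add: V_def)
  have finH: "finite HH" unfolding HH_def using fin finV by (intro finite_PiE) auto
  have "HH \<noteq> {}" unfolding HH_def using q by (auto simp: PiE_eq_empty_iff lessThan_empty_iff)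
  have XV: "X (\<phi> e) \<omega> \<in> V" if "e \<in> E" "\<omega> \<in> \<Omega>" for e \<omega>
    using that \<phi> by (auto simp: V_def)
  have GT: "(\<Sum>h\<in>HH. G h T) \<le> card HH * (2 ^ card N * (card \<Omega>)\<^sup>2)" if T: "T \<subseteq> E" for T
  proof -
    define common where "common = (\<lambda>\<omega> \<omega>'. {i \<in> N. X i \<omega>' = X i \<omega>})"
    have card_agree: "card (agree \<Omega> Z S \<omega>) = (\<Sum>\<omega>'\<in>\<Omega>. if \<forall>i\<in>S. Z i \<omega>' = Z i \<omega> then 1 else 0)"
      for Z :: "'c \<Rightarrow> 'a \<Rightarrow> 'd" and S \<omega>
      using fin(1) by (simp add: agree_def sum.If_cases Int_def)
    have pair: "(\<Sum>h\<in>HH. (if \<forall>e\<in>T. Y h e \<omega>' = Y h e \<omega> then 1 else 0)) * q ^ \<rho> T \<le> card HH * q ^ F (common \<omega> \<omega>')"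
      if \<omega>: "\<omega> \<in> \<Omega>" "\<omega>' \<in> \<Omega>" for \<omega> \<omega>'
    proof -
      define c where "c = (\<Sum>h\<in>HH. (if \<forall>e\<in>T. Y h e \<omega>' = Y h e \<omega> then 1 else (0::nat)))"
      define d where "d = card {e \<in> T. X (\<phi> e) \<omega>' \<noteq> X (\<phi> e) \<omega>}"
      have "{e \<in> T. \<phi> e \<notin> common \<omega> \<omega>'} = {e \<in> T. X (\<phi> e) \<omega>' \<noteq> X (\<phi> e) \<omega>}"
        using T \<phi> by (auto simp: common_def)
      then have "\<rho> T \<le> F (common \<omega> \<omega>') + d"
        using \<rho>[OF T, of "common \<omega> \<omega>'"] by (auto simp: d_def common_def)
      then have le: "q ^ \<rho> T \<le> q ^ F (common \<omega> \<omega>') * q ^ d"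
        using q by (simp flip: power_add add: power_increasing)
      have "(\<Sum>h\<in>HH. (if \<forall>e\<in>T. Y h e \<omega>' = Y h e \<omega> then 1 else 0)) = card {h \<in> HH. \<forall>e\<in>T. Y h e \<omega>' = Y h e \<omega>}"
        using finH by (simp add: sum.If_cases Int_def)
      moreover have "card {h \<in> HH. \<forall>e\<in>T. Y h e \<omega>' = Y h e \<omega>} * q ^ d \<le> card HH"
        unfolding HH_def Y_def d_def using XV \<omega> by (intro card_colliding_hashes fin finV T) auto
      ultimately have c: "c * q ^ d \<le> card HH" by (simp add: c_def)
      have "c * q ^ \<rho> T \<le> c * (q ^ F (common \<omega> \<omega>') * q ^ d)"
        using le by (rule mult_left_mono) simp
      also have "\<dots> = c * q ^ d * q ^ F (common \<omega> \<omega>')" by simp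
      also have "\<dots> \<le> card HH * q ^ F (common \<omega> \<omega>')"
        using c by (rule mult_right_mono) simp
      finally show ?thesis by (simp only: c_def)
    qed
    have "(\<Sum>h\<in>HH. G h T) = (\<Sum>h\<in>HH. \<Sum>\<omega>\<in>\<Omega>. \<Sum>\<omega>'\<in>\<Omega>. (if \<forall>e\<in>T. Y h e \<omega>' = Y h e \<omega> then 1 else 0) * q ^ \<rho> T)"
      unfolding G_def card_agree sum_distrib_right ..
    also have "\<dots> = (\<Sum>\<omega>\<in>\<Omega>. \<Sum>\<omega>'\<in>\<Omega>. \<Sum>h\<in>HH. (if \<forall>e\<in>T. Y h e \<omega>' = Y h e \<omega> then 1 else 0) * q ^ \<rho> T)"
      by (rule trans[OF sum.swap], rule sum.cong[OF refl], rule sum.swap)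
    also have "\<dots> \<le> (\<Sum>\<omega>\<in>\<Omega>. \<Sum>\<omega>'\<in>\<Omega>. card HH * q ^ F (common \<omega> \<omega>'))"
      using pair unfolding sum_distrib_right by (intro sum_mono) auto
    \<comment> \<open>The agreement set of each pair is replaced by the sum over all
      \<open>S\<close> on which the pair agrees; this is the origin of the factor
      \<open>2 ^ card N\<close>.\<close>
    also have "\<dots> \<le> (\<Sum>\<omega>\<in>\<Omega>. \<Sum>\<omega>'\<in>\<Omega>. \<Sum>S\<in>Pow N. card HH * ((if \<forall>i\<in>S. X i \<omega>' = X i \<omega> then 1 else 0) * q ^ F S))"
    proof (intro sum_mono)
      fix \<omega> \<omega>'
      have "card HH * q ^ F (common \<omega> \<omega>') = card HH * ((if \<forall>i\<in>common \<omega> \<omega>'. X i \<omega>' = X i \<omega> then 1 else 0) * q ^ F (common \<omega> \<omega>'))"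
        by (simp add: common_def)
      also have "\<dots> \<le> (\<Sum>S\<in>Pow N. card HH * ((if \<forall>i\<in>S. X i \<omega>' = X i \<omega> then 1 else 0) * q ^ F S))"
        using fin(3) by (intro member_le_sum) (auto simp: common_def)
      finally show "card HH * q ^ F (common \<omega> \<omega>') \<le> (\<Sum>S\<in>Pow N. card HH * ((if \<forall>i\<in>S. X i \<omega>' = X i \<omega> then 1 else 0) * q ^ F S))" .
    qed
    also have "\<dots> = (\<Sum>\<omega>\<in>\<Omega>. \<Sum>S\<in>Pow N. card HH * (card (agree \<Omega> X S \<omega>) * q ^ F S))"
    proof (rule sum.cong[OF refl])
      fix \<omega>
      have "(\<Sum>\<omega>'\<in>\<Omega>. \<Sum>S\<in>Pow N. card HH * ((if \<forall>i\<in>S. X i \<omega>' = X i \<omega> then 1 else 0) * q ^ F S))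
         = (\<Sum>S\<in>Pow N. \<Sum>\<omega>'\<in>\<Omega>. card HH * ((if \<forall>i\<in>S. X i \<omega>' = X i \<omega> then 1 else 0) * q ^ F S))"
        by (rule sum.swap)
      then show "(\<Sum>\<omega>'\<in>\<Omega>. \<Sum>S\<in>Pow N. card HH * ((if \<forall>i\<in>S. X i \<omega>' = X i \<omega> then 1 else 0) * q ^ F S))
         = (\<Sum>S\<in>Pow N. card HH * (card (agree \<Omega> X S \<omega>) * q ^ F S))"
        by (simp only: card_agree sum_distrib_right sum_distrib_left)
    qed
    also have "\<dots> \<le> (\<Sum>\<omega>\<in>\<Omega>. \<Sum>S\<in>Pow N. card HH * card \<Omega>)"
      using fib by (intro sum_mono mult_left_mono) auto
    also have "\<dots> = card HH * (2 ^ card N * (card \<Omega>)\<^sup>2)"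
      using fin(3) by (simp add: card_Pow power2_eq_square)
    finally show ?thesis .
  qed
  \<comment> \<open>One table must serve every \<open>T\<close> at once; summing over the subsets of
    \<open>E\<close> costs the factor \<open>2 ^ card E\<close>.\<close>
  have "\<exists>h\<in>HH. (\<Sum>T\<in>Pow E. G h T) \<le> 2 ^ (card E + card N) * (card \<Omega>)\<^sup>2"
  proof (rule ccontr)
    assume "\<not> ?thesis"
    then have "(\<Sum>h\<in>HH. 2 ^ (card E + card N) * (card \<Omega>)\<^sup>2) < (\<Sum>h\<in>HH. \<Sum>T\<in>Pow E. G h T)"
      using finH \<open>HH \<noteq> {}\<close> by (intro sum_strict_mono) auto
    also have "\<dots> = (\<Sum>T\<in>Pow E. \<Sum>h\<in>HH. G h T)" by (rule sum.swap)
    also have "\<dots> \<le> (\<Sum>T\<in>Pow E. card HH * (2 ^ card N * (card \<Omega>)\<^sup>2))"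
      using GT by (intro sum_mono) auto
    also have "\<dots> = (\<Sum>h\<in>HH. 2 ^ (card E + card N) * (card \<Omega>)\<^sup>2)"
      using fin(4) by (simp add: card_Pow power_add)
    finally show False by simp
  qed
  then obtain h where h: "h \<in> HH" "(\<Sum>T\<in>Pow E. G h T) \<le> 2 ^ (card E + card N) * (card \<Omega>)\<^sup>2" by blast
  show ?thesis
  proof (rule that[of "Y h"])
    show "Y h e \<omega> < q" if "e \<in> E" "\<omega> \<in> \<Omega>" for e \<omega>
      using h(1) XV[OF that] that by (auto simp: HH_def Y_def PiE_def Pi_def)
    show "Y h e \<omega> = Y h e \<omega>'" if "X (\<phi> e) \<omega> = X (\<phi> e) \<omega>'" for e \<omega> \<omega>'
      using that by (simp add: Y_def)
    show "(\<Sum>\<omega>\<in>\<Omega>. card (agree \<Omega> (Y h) T \<omega>)) * q ^ \<rho> T \<le> 2 ^ (card E + card N) * (card \<Omega>)\<^sup>2" if "T \<subseteq> E" for T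
    proof -
      have "G h T \<le> (\<Sum>T\<in>Pow E. G h T)" using fin(4) that by (intro member_le_sum) auto
      then show ?thesis using h(2) by (simp add: G_def)
    qed
  qed
qed

text \<open>\<^term>\<open>h S\<close> is the number of values taken by the subfamily indexed by \<^term>\<open>S\<close>.\<close>

definition quasi_uniform :: "'i set \<Rightarrow> ('i set \<Rightarrow> nat) \<Rightarrow> bool" where
  "quasi_uniform N h \<longleftrightarrow> (\<exists>(\<Omega> :: nat set) (X :: 'i \<Rightarrow> nat \<Rightarrow> nat). finite \<Omega> \<and> \<Omega> \<noteq> {} \<and>
     (\<forall>S\<subseteq>N. \<forall>\<omega>\<in>\<Omega>. card (agree \<Omega> X S \<omega>) * h S = card \<Omega>))"

lemma fibre_restrict: "fibre \<Omega> (\<lambda>\<omega>. restrict (\<lambda>i. X i \<omega>) S) \<omega> = agree \<Omega> X S \<omega>"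
  by (auto simp: fibre_def agree_def restrict_def fun_eq_iff)

lemma card_agree_pos: "finite \<Omega> \<Longrightarrow> \<omega> \<in> \<Omega> \<Longrightarrow> card (agree \<Omega> X S \<omega>) > 0"
  using card_fibre_pos[of \<Omega> \<omega> "\<lambda>\<omega>. restrict (\<lambda>i. X i \<omega>) S"] by (simp add: fibre_restrict)

lemma card_image_quasi_uniform:
  assumes fin: "finite \<Omega>" "\<Omega> \<noteq> {}" and h: "\<And>\<omega>. \<omega> \<in> \<Omega> \<Longrightarrow> card (agree \<Omega> X S \<omega>) * h = card \<Omega>"
  shows "card ((\<lambda>\<omega>. restrict (\<lambda>i. X i \<omega>) S) ` \<Omega>) = h"
proof -
  have n: "card \<Omega> > 0" using fin by (simp add: card_gt_0_iff)
  have "real (card ((\<lambda>\<omega>. restrict (\<lambda>i. X i \<omega>) S) ` \<Omega>)) = (\<Sum>\<omega>\<in>\<Omega>. 1 / real (card (agree \<Omega> X S \<omega>)))"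
    using sum_inverse_card_fibre[OF fin(1), of "\<lambda>\<omega>. restrict (\<lambda>i. X i \<omega>) S"] by (simp add: fibre_restrict)
  also have "\<dots> = (\<Sum>\<omega>\<in>\<Omega>. real h / card \<Omega>)"
  proof (rule sum.cong[OF refl])
    fix \<omega> assume "\<omega> \<in> \<Omega>"
    then have "real (card (agree \<Omega> X S \<omega>)) * real h = card \<Omega>" "card (agree \<Omega> X S \<omega>) > 0"
      using h fin by (simp_all flip: of_nat_mult add: card_agree_pos)
    then show "1 / real (card (agree \<Omega> X S \<omega>)) = real h / card \<Omega>"
      using n by (simp add: field_simps)
  qed
  also have "\<dots> = h" using n by simp
  finally show ?thesis by simp
qed

text \<open>The lower bound on entropy is the collision bound. For the upper bound take the
  \<open>S\<close> that attains \<open>\<rho> T\<close>: the values of \<open>X\<close> on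
  \<open>S\<close> and the hashes of the elements outside \<open>S\<close> determine everything,
  which leaves at most \<open>h S * q ^ card {e \<in> T. \<phi> e \<notin> S}\<close>
  values.\<close>

lemma hashed_entropy:
  fixes F :: "'i set \<Rightarrow> nat" and \<rho> :: "'e set \<Rightarrow> nat"
  assumes qu: "quasi_uniform N h" and fin: "finite N" "finite E" and \<phi>: "\<phi> ` E \<subseteq> N" and q: "q \<ge> (1::nat)" and K: "K \<ge> 1"
    and h: "\<And>S. S \<subseteq> N \<Longrightarrow> q ^ F S \<le> h S" "\<And>S. S \<subseteq> N \<Longrightarrow> real (h S) \<le> K * q ^ F S"
    and \<rho>: "\<And>T S. T \<subseteq> E \<Longrightarrow> S \<subseteq> N \<Longrightarrow> \<rho> T \<le> F S + card {e \<in> T. \<phi> e \<notin> S}"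
    and \<rho>_attained: "\<And>T. T \<subseteq> E \<Longrightarrow> \<exists>S\<subseteq>N. \<rho> T = F S + card {e \<in> T. \<phi> e \<notin> S}"
  obtains \<Omega> :: "nat set" and Y :: "'e \<Rightarrow> nat \<Rightarrow> nat" where "finite \<Omega>" "\<Omega> \<noteq> {}"
    "\<And>T. T \<subseteq> E \<Longrightarrow> \<bar>uniform_ent \<Omega> (\<lambda>\<omega>. restrict (\<lambda>e. Y e \<omega>) T) - \<rho> T * log 2 q\<bar> \<le> log 2 K + card E + card N"
proof -
  obtain \<Omega> :: "nat set" and X :: "'i \<Rightarrow> nat \<Rightarrow> nat" where \<Omega>: "finite \<Omega>" "\<Omega> \<noteq> {}"
    and X: "\<And>S \<omega>. S \<subseteq> N \<Longrightarrow> \<omega> \<in> \<Omega> \<Longrightarrow> card (agree \<Omega> X S \<omega>) * h S = card \<Omega>"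
    using qu unfolding quasi_uniform_def by blast
  have fib: "card (agree \<Omega> X S \<omega>) * q ^ F S \<le> card \<Omega>" if "S \<subseteq> N" "\<omega> \<in> \<Omega>" for S \<omega>
  proof -
    have "card (agree \<Omega> X S \<omega>) * q ^ F S \<le> card (agree \<Omega> X S \<omega>) * h S"
      using h(1)[OF that(1)] by (rule mult_left_mono) simp
    then show ?thesis using X[OF that] by simp
  qed
  obtain Y :: "'e \<Rightarrow> nat \<Rightarrow> nat" where Yq: "\<And>e \<omega>. e \<in> E \<Longrightarrow> \<omega> \<in> \<Omega> \<Longrightarrow> Y e \<omega> < q"
    and YX: "\<And>e \<omega> \<omega>'. X (\<phi> e) \<omega> = X (\<phi> e) \<omega>' \<Longrightarrow> Y e \<omega> = Y e \<omega>'"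
    and coll: "\<And>T. T \<subseteq> E \<Longrightarrow> (\<Sum>\<omega>\<in>\<Omega>. card (agree \<Omega> Y T \<omega>)) * q ^ \<rho> T \<le> 2 ^ (card E + card N) * (card \<Omega>)\<^sup>2"
    using exists_hash[OF \<Omega> fin \<phi> q fib \<rho>] by metis
  show ?thesis
  proof (rule that[OF \<Omega>])
    fix T assume T: "T \<subseteq> E"
    let ?YT = "\<lambda>\<omega>. restrict (\<lambda>e. Y e \<omega>) T"
    have finT: "finite T" using T fin finite_subset by blast
    have logK: "log 2 K \<ge> 0" using K by simp
    have "log 2 (real (q ^ \<rho> T)) - log 2 (2 ^ (card E + card N)) \<le> uniform_ent \<Omega> ?YT"
    proof (rule uniform_ent_ge_collision[OF \<Omega>])
      have "real ((\<Sum>\<omega>\<in>\<Omega>. card (agree \<Omega> Y T \<omega>)) * q ^ \<rho> T) \<le> real (2 ^ (card E + card N) * (card \<Omega>)\<^sup>2)"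
        using coll[OF T] by (rule of_nat_mono)
      then show "(\<Sum>\<omega>\<in>\<Omega>. real (card (fibre \<Omega> ?YT \<omega>))) * real (q ^ \<rho> T) \<le> 2 ^ (card E + card N) * (real (card \<Omega>))\<^sup>2"
        by (simp add: fibre_restrict)
    qed (use q in auto)
    then have lower: "\<rho> T * log 2 q - (card E + card N) \<le> uniform_ent \<Omega> ?YT"
      using q by (simp add: log_nat_power del: of_nat_add)
    obtain S where S: "S \<subseteq> N" "\<rho> T = F S + card {e \<in> T. \<phi> e \<notin> S}"
      using \<rho>_attained[OF T] by blast
    let ?R = "{e \<in> T. \<phi> e \<notin> S}"
    let ?XS = "\<lambda>\<omega>. restrict (\<lambda>i. X i \<omega>) S" and ?YR = "\<lambda>\<omega>. restrict (\<lambda>e. Y e \<omega>) ?R"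
    have "card (?YT ` \<Omega>) \<le> card ((\<lambda>\<omega>. (?XS \<omega>, ?YR \<omega>)) ` \<Omega>)"
    proof (rule card_image_factor_le[OF \<Omega>(1)])
      fix \<omega> \<omega>' assume "\<omega> \<in> \<Omega>" "\<omega>' \<in> \<Omega>" and eq: "(?XS \<omega>, ?YR \<omega>) = (?XS \<omega>', ?YR \<omega>')"
      have "Y e \<omega> = Y e \<omega>'" if e: "e \<in> T" for e
      proof (cases "\<phi> e \<in> S")
        case True
        then have "X (\<phi> e) \<omega> = X (\<phi> e) \<omega>'" using eq by (metis (no_types, lifting) Pair_inject restrict_apply')
        then show ?thesis by (rule YX)
      next
        case False
        then have "e \<in> ?R" using e by simp
        then show ?thesis using eq by (metis (no_types, lifting) Pair_inject restrict_apply')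
      qed
      then show "?YT \<omega> = ?YT \<omega>'" by (auto simp: restrict_def fun_eq_iff)
    qed
    also have "\<dots> \<le> card ((?XS ` \<Omega>) \<times> PiE ?R (\<lambda>_. {..<q}))"
    proof (rule card_mono)
      show "finite ((?XS ` \<Omega>) \<times> PiE ?R (\<lambda>_. {..<q}))" using \<Omega> finT by (intro finite_cartesian_product finite_PiE) auto
      show "(\<lambda>\<omega>. (?XS \<omega>, ?YR \<omega>)) ` \<Omega> \<subseteq> (?XS ` \<Omega>) \<times> PiE ?R (\<lambda>_. {..<q})"
      proof
        fix z assume "z \<in> (\<lambda>\<omega>. (?XS \<omega>, ?YR \<omega>)) ` \<Omega>"
        then obtain \<omega> where \<omega>: "\<omega> \<in> \<Omega>" "z = (?XS \<omega>, ?YR \<omega>)" by blast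
        have "?YR \<omega> \<in> PiE ?R (\<lambda>_. {..<q})"
          using Yq[OF _ \<omega>(1)] T by (intro restrict_PiE_iff[THEN iffD2] ballI) auto
        then show "z \<in> (?XS ` \<Omega>) \<times> PiE ?R (\<lambda>_. {..<q})" using \<omega> by blast
      qed
    qed
    also have "\<dots> = h S * q ^ card ?R"
      using card_image_quasi_uniform[OF \<Omega> X[OF S(1)]] finT by (simp add: card_cartesian_product card_PiE)
    finally have "real (card (?YT ` \<Omega>)) \<le> real (h S) * q ^ card ?R"
      by (simp flip: of_nat_mult of_nat_power)
    also have "\<dots> \<le> K * q ^ F S * q ^ card ?R"
      using h(2)[OF S(1)] by (intro mult_right_mono) auto
    also have "\<dots> = K * q ^ \<rho> T" by (simp add: S(2) power_add)
    finally have "log 2 (card (?YT ` \<Omega>)) \<le> log 2 (K * q ^ \<rho> T)"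
      using \<Omega> K q by (subst log_le_cancel_iff) (auto simp: card_gt_0_iff)
    also have "\<dots> = log 2 K + \<rho> T * log 2 q"
      using K q by (simp add: log_mult log_nat_power)
    finally have "uniform_ent \<Omega> ?YT \<le> log 2 K + \<rho> T * log 2 q"
      using uniform_ent_le_log_card_image[OF \<Omega>, of ?YT] by linarith
    with lower logK show "\<bar>uniform_ent \<Omega> ?YT - \<rho> T * log 2 q\<bar> \<le> log 2 K + card E + card N"
      by (simp add: abs_le_iff)
  qed
qed

section \<open>Scaling down into the closure of the entropic functions\<close>

text \<open>Mixing with a constant outcome of probability \<open>1 - 1/j\<close> scales entropies down by the factor \<open>1/j\<close>.\<close>

lemma entropic_scale_down:
  fixes Y :: "'e \<Rightarrow> nat \<Rightarrow> nat" and j :: nat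
  assumes fin: "finite E" and \<Omega>: "finite \<Omega>" "\<Omega> \<noteq> {}" and j: "j \<ge> 2"
  obtains g where "entropic g E" "g {} = 0"
    "\<And>T. T \<subseteq> E \<Longrightarrow> T \<noteq> {} \<Longrightarrow> g T = (uniform_ent \<Omega> (\<lambda>\<omega>. restrict (\<lambda>e. Y e \<omega>) T) + log 2 j) / j
       + (1 - 1 / real j) * log 2 (real j / (real j - 1))"
proof -
  define n where "n = card \<Omega>"
  have n: "n > 0" using \<Omega> by (simp add: n_def card_gt_0_iff)
  define \<Omega>' where "\<Omega>' = (Inl ` \<Omega> \<union> Inr ` {..<(j - 1) * n} :: (nat + nat) set)"
  \<comment> \<open>\<open>Suc\<close> reserves 0 for the constant outcome, so each single variable
    already reveals whether that outcome occurred.\<close>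
  define Z where "Z = (\<lambda>z e. case z of Inl \<omega> \<Rightarrow> Suc (Y e \<omega>) | Inr (k :: nat) \<Rightarrow> 0)"
  define p where "p = map_pmf Z (pmf_of_set \<Omega>')"
  have fin': "finite \<Omega>'" "\<Omega>' \<noteq> {}" using \<Omega> by (auto simp: \<Omega>'_def)
  have card': "card \<Omega>' = j * n"
  proof -
    have "card \<Omega>' = card (Inl ` \<Omega> :: (nat + nat) set) + card (Inr ` {..<(j - 1) * n} :: (nat + nat) set)"
      unfolding \<Omega>'_def using \<Omega> by (intro card_Un_disjoint) auto
    also have "\<dots> = n + (j - 1) * n" by (simp add: card_image n_def)
    also have "\<dots> = j * n" using j by (cases j) auto
    finally show ?thesis .
  qed
  have set: "set_pmf (pmf_of_set \<Omega>') = \<Omega>'" using fin' by simp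
  have finp: "finite (set_pmf (pmf_of_set \<Omega>'))" using fin' by simp
  have ent_eq: "shannon_entropy p T = uniform_ent \<Omega>' (\<lambda>z. restrict (Z z) T)" for T
  proof -
    have "shannon_entropy p T = ent \<Omega>' (pmf (pmf_of_set \<Omega>')) (\<lambda>z. restrict (Z z) T)"
      unfolding p_def using shannon_entropy_map_pmf[OF finp, of Z T] set by simp
    also have "\<dots> = ent \<Omega>' (\<lambda>_. 1 / card \<Omega>') (\<lambda>z. restrict (Z z) T)"
      unfolding ent_def class_mass_def using fin' by (intro sum.cong refl) (simp add: indicator_def)
    finally show ?thesis by (simp add: ent_uniform[OF fin'(1)])
  qed
  show ?thesis
  proof (rule that[of "shannon_entropy p"])
    show "entropic (shannon_entropy p) E"
      unfolding entropic_def using fin summable_entropy_terms[OF finp, of Z] by (auto simp: p_def)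
    show "shannon_entropy p {} = 0"
      using fin' unfolding ent_eq uniform_ent_def by (simp add: fibre_def card_gt_0_iff restrict_def)
    fix T assume T: "T \<subseteq> E" "T \<noteq> {}"
    let ?f = "\<lambda>z. log 2 (card \<Omega>' / card (fibre \<Omega>' (\<lambda>z. restrict (Z z) T) z))"
    let ?YT = "\<lambda>\<omega>. restrict (\<lambda>e. Y e \<omega>) T"
    obtain t where t: "t \<in> T" using T by blast
    have inl: "?f (Inl \<omega>) = log 2 j + log 2 (card \<Omega> / card (fibre \<Omega> ?YT \<omega>))" if \<omega>: "\<omega> \<in> \<Omega>" for \<omega>
    proof -
      have "fibre \<Omega>' (\<lambda>z. restrict (Z z) T) (Inl \<omega>) = Inl ` fibre \<Omega> ?YT \<omega>"
        using t by (auto simp: fibre_def \<Omega>'_def Z_def restrict_def fun_eq_iff)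
      then have "card (fibre \<Omega>' (\<lambda>z. restrict (Z z) T) (Inl \<omega>)) = card (fibre \<Omega> ?YT \<omega>)"
        by (simp add: card_image)
      then show ?thesis
        using card_fibre_pos[OF \<Omega>(1) \<omega>, of ?YT] n j by (simp add: card' log_mult log_divide n_def)
    qed
    have inr: "?f (Inr k) = log 2 (real j / (real j - 1))" if k: "k < (j - 1) * n" for k
    proof -
      have "fibre \<Omega>' (\<lambda>z. restrict (Z z) T) (Inr k) = Inr ` {..<(j - 1) * n}"
        using t by (auto simp: fibre_def \<Omega>'_def Z_def restrict_def fun_eq_iff)
      then have "card (fibre \<Omega>' (\<lambda>z. restrict (Z z) T) (Inr k)) = (j - 1) * n"
        by (simp add: card_image)
      then show ?thesis using n j by (simp add: card' of_nat_diff)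
    qed
    have "sum ?f \<Omega>' = sum ?f (Inl ` \<Omega>) + sum ?f (Inr ` {..<(j - 1) * n})"
      unfolding \<Omega>'_def using \<Omega> by (intro sum.union_disjoint) auto
    also have "sum ?f (Inl ` \<Omega>) = (\<Sum>\<omega>\<in>\<Omega>. ?f (Inl \<omega>))" by (simp add: sum.reindex)
    also have "\<dots> = n * log 2 j + n * uniform_ent \<Omega> ?YT"
      using n by (simp add: inl sum.distrib uniform_ent_def n_def cong: sum.cong)
    also have "sum ?f (Inr ` {..<(j - 1) * n}) = (\<Sum>k<(j - 1) * n. ?f (Inr k))" by (simp add: sum.reindex)
    also have "\<dots> = (\<Sum>k<(j - 1) * n. log 2 (real j / (real j - 1)))" by (intro sum.cong refl inr) simp
    also have "\<dots> = real ((j - 1) * n) * log 2 (real j / (real j - 1))" by simp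
    finally have total: "sum ?f \<Omega>' = n * log 2 j + n * uniform_ent \<Omega> ?YT + real ((j - 1) * n) * log 2 (real j / (real j - 1))" .
    have "shannon_entropy p T = sum ?f \<Omega>' / card \<Omega>'" by (simp only: ent_eq uniform_ent_def)
    also have "\<dots> = (n * log 2 j + n * uniform_ent \<Omega> ?YT + real ((j - 1) * n) * log 2 (real j / (real j - 1))) / (j * n)"
      unfolding total by (simp only: card')
    also have "\<dots> = (uniform_ent \<Omega> ?YT + log 2 j) / j + (1 - 1 / real j) * log 2 (real j / (real j - 1))"
      using n j by (simp add: field_simps of_nat_diff)
    finally show "shannon_entropy p T = (uniform_ent \<Omega> ?YT + log 2 j) / j + (1 - 1 / real j) * log 2 (real j / (real j - 1))" .
  qed
qed

text \<open>The error \<open>C\<close> must not depend on \<open>j\<close>: after scaling by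
  \<open>1 / j\<close> it vanishes, and so does the entropy of the mixing.\<close>

lemma almost_entropicI:
  fixes \<rho> :: "'e set \<Rightarrow> nat"
  assumes fin: "finite E" and \<rho>: "\<rho> {} = 0"
    and approx: "\<And>j. j \<ge> 1 \<Longrightarrow> \<exists>(\<Omega> :: nat set) Y :: 'e \<Rightarrow> nat \<Rightarrow> nat. finite \<Omega> \<and> \<Omega> \<noteq> {} \<and>
      (\<forall>T\<subseteq>E. \<bar>uniform_ent \<Omega> (\<lambda>\<omega>. restrict (\<lambda>e. Y e \<omega>) T) - real (\<rho> T) * real j\<bar> \<le> C)"
  shows "almost_entropic (\<lambda>T. real (\<rho> T)) E"
  unfolding almost_entropic_def
proof (intro conjI allI impI fin)
  fix e :: real assume e: "e > 0"
  have "(\<lambda>j::nat. (C + log 2 (real j)) / real j + \<bar>(1 - 1 / real j) * log 2 (real j / (real j - 1))\<bar>) \<longlonglongrightarrow> 0"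
    by real_asymp
  then have "eventually (\<lambda>j::nat. (C + log 2 (real j)) / real j + \<bar>(1 - 1 / real j) * log 2 (real j / (real j - 1))\<bar> < e) sequentially"
    using e by (rule order_tendstoD)
  moreover have "eventually (\<lambda>j::nat. j \<ge> 2) sequentially" by (rule eventually_ge_at_top)
  ultimately obtain j :: nat where j: "j \<ge> 2"
    "(C + log 2 (real j)) / real j + \<bar>(1 - 1 / real j) * log 2 (real j / (real j - 1))\<bar> < e"
    using eventually_happens'[OF sequentially_bot eventually_conj] by blast
  obtain \<Omega> :: "nat set" and Y :: "'e \<Rightarrow> nat \<Rightarrow> nat" where \<Omega>: "finite \<Omega>" "\<Omega> \<noteq> {}"
    and Y: "\<And>T. T \<subseteq> E \<Longrightarrow> \<bar>uniform_ent \<Omega> (\<lambda>\<omega>. restrict (\<lambda>e. Y e \<omega>) T) - real (\<rho> T) * real j\<bar> \<le> C"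
    using approx[of j] j(1) by auto
  obtain g where g: "entropic g E" "g {} = 0"
    "\<And>T. T \<subseteq> E \<Longrightarrow> T \<noteq> {} \<Longrightarrow> g T = (uniform_ent \<Omega> (\<lambda>\<omega>. restrict (\<lambda>e. Y e \<omega>) T) + log 2 j) / j
       + (1 - 1 / real j) * log 2 (real j / (real j - 1))"
    using entropic_scale_down[OF fin \<Omega> j(1)] by metis
  have "\<bar>real (\<rho> T) - g T\<bar> < e" if T: "T \<subseteq> E" for T
  proof (cases "T = {}")
    case True
    then show ?thesis using \<rho> g e by simp
  next
    case False
    define u where "u = uniform_ent \<Omega> (\<lambda>\<omega>. restrict (\<lambda>e. Y e \<omega>) T)"
    define b where "b = (1 - 1 / real j) * log 2 (real j / (real j - 1))"
    have "g T - real (\<rho> T) = ((u - real (\<rho> T) * real j) + log 2 j) / j + b"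
      using g(3)[OF T False] j(1) by (simp add: u_def b_def field_simps)
    moreover have "\<bar>((u - real (\<rho> T) * real j) + log 2 j) / j\<bar> \<le> (C + log 2 j) / j"
    proof -
      have "\<bar>(u - real (\<rho> T) * real j) + log 2 j\<bar> \<le> C + log 2 j"
        using Y[OF T] j(1) unfolding u_def by (intro order_trans[OF abs_triangle_ineq] add_mono) auto
      then show ?thesis by (simp add: divide_right_mono)
    qed
    ultimately show ?thesis using j(2) unfolding b_def by linarith
  qed
  then show "\<exists>g. entropic g E \<and> (\<forall>A\<subseteq>E. \<bar>real (\<rho> A) - g A\<bar> < e)" using g(1) by blast
qed

section \<open>Matroid ports and their duals\<close>

text \<open>Looplessness gives every participant the same weight as the secret, hence complexity 1,
  and lets every element be completed to a basis.\<close>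

locale matroid_rank =
  fixes P :: "'e set" and \<rho> :: "'e set \<Rightarrow> nat"
  assumes finite_ground: "finite P"
    and rank_le_card: "A \<subseteq> P \<Longrightarrow> \<rho> A \<le> card A"
    and rank_mono: "A \<subseteq> B \<Longrightarrow> B \<subseteq> P \<Longrightarrow> \<rho> A \<le> \<rho> B"
    and rank_submodular: "A \<subseteq> P \<Longrightarrow> B \<subseteq> P \<Longrightarrow> \<rho> (A \<union> B) + \<rho> (A \<inter> B) \<le> \<rho> A + \<rho> B"
    and no_loops: "x \<in> P \<Longrightarrow> \<rho> {x} = 1"
    and nonempty: "P \<noteq> {}"
begin

lemma rank_Un_le: "A \<subseteq> P \<Longrightarrow> K \<subseteq> P \<Longrightarrow> \<rho> (A \<union> K) \<le> \<rho> A + card K"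
  using rank_submodular[of A K] rank_le_card[of K] by linarith

lemma augment:
  assumes "T \<subseteq> U" "U \<subseteq> P"
  shows "\<exists>K \<subseteq> U - T. \<rho> (T \<union> K) = \<rho> U \<and> card K = \<rho> U - \<rho> T"
  using assms
proof (induction "\<rho> U - \<rho> T" arbitrary: T)
  case 0
  then have "\<rho> T = \<rho> U" using rank_mono[of T U] by simp
  then show ?case by (intro exI[of _ "{}"]) auto
next
  case (Suc n)
  have finU: "finite U" using Suc.prems finite_ground finite_subset by blast
  \<comment> \<open>If no single element raises the rank of \<open>T\<close>, then by submodularity
    no set of elements of \<open>U\<close> does.\<close>
  have "\<exists>x\<in>U. \<rho> (insert x T) > \<rho> T"
  proof (rule ccontr)
    assume "\<not> ?thesis"
    then have le: "\<rho> (insert x T) \<le> \<rho> T" if "x \<in> U" for x using that by (meson not_less)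
    have "W \<subseteq> U \<Longrightarrow> \<rho> (T \<union> W) \<le> \<rho> T" if "finite W" for W
      using that
    proof (induction W)
      case (insert x W)
      have "\<rho> (T \<union> W \<union> insert x T) + \<rho> ((T \<union> W) \<inter> insert x T) \<le> \<rho> (T \<union> W) + \<rho> (insert x T)"
        using insert.prems Suc.prems by (intro rank_submodular) auto
      moreover have "\<rho> T \<le> \<rho> ((T \<union> W) \<inter> insert x T)" using insert.prems Suc.prems by (intro rank_mono) auto
      moreover have "T \<union> W \<union> insert x T = T \<union> insert x W" by auto
      ultimately show ?case using insert le[of x] by auto
    qed simp
    from this[OF finU] have "\<rho> U \<le> \<rho> T" using Suc.prems by (simp add: Un_absorb1)
    then show False using Suc.hyps(2) by simp
  qed
  then obtain x where x: "x \<in> U" "\<rho> (insert x T) > \<rho> T" by blast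
  have "\<rho> (T \<union> {x}) \<le> \<rho> T + card {x}" using x Suc.prems by (intro rank_Un_le) auto
  then have step: "\<rho> (insert x T) = Suc (\<rho> T)" using x by simp
  then have "\<exists>K\<subseteq>U - insert x T. \<rho> (insert x T \<union> K) = \<rho> U \<and> card K = \<rho> U - \<rho> (insert x T)"
    using Suc x by (intro Suc.hyps(1)) auto
  then obtain K where K: "K \<subseteq> U - insert x T" "\<rho> (insert x T \<union> K) = \<rho> U" "card K = \<rho> U - \<rho> (insert x T)" by blast
  have "x \<notin> T" using x(2) by (auto simp: insert_absorb)
  show ?case
  proof (intro exI[of _ "insert x K"] conjI)
    show "insert x K \<subseteq> U - T" using K x \<open>x \<notin> T\<close> by auto
    show "\<rho> (T \<union> insert x K) = \<rho> U" using K(2) by simp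
    have "finite K" "x \<notin> K" using K finU finite_subset by (blast, blast)
    then show "card (insert x K) = \<rho> U - \<rho> T" using K(3) step Suc.hyps(2) by simp
  qed
qed

lemma rank_pos: "\<rho> P \<ge> 1"
proof -
  obtain x where "x \<in> P" using nonempty by blast
  then show ?thesis using rank_mono[of "{x}" P] no_loops[of x] by simp
qed

definition spanning :: "'e set set" where
  "spanning = {A. A \<subseteq> P \<and> \<rho> A = \<rho> P}"

lemma access_structure_spanning: "access_structure P spanning"
proof -
  have "\<rho> {} \<le> 0" using rank_le_card[of "{}"] by simp
  then have "{} \<notin> spanning" using rank_pos by (auto simp: spanning_def)
  moreover have "B \<in> spanning" if "A \<in> spanning" "A \<subseteq> B" "B \<subseteq> P" for A B
  proof -
    have "\<rho> P \<le> \<rho> B" using that(1) rank_mono[OF that(2,3)] by (simp add: spanning_def)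
    then show ?thesis using rank_mono[OF that(3)] that(3) by (simp add: spanning_def)
  qed
  moreover have "P \<in> spanning" by (simp add: spanning_def)
  moreover have "spanning \<subseteq> Pow P" by (auto simp: spanning_def)
  ultimately show ?thesis unfolding access_structure_def by blast
qed

lemma mem_dual_spanning: "A \<in> dual_access P spanning \<longleftrightarrow> A \<subseteq> P \<and> \<rho> (P - A) \<noteq> \<rho> P"
  by (auto simp: dual_access_def spanning_def)

text \<open>The qualified sets of the dual of \<^const>\<open>spanning\<close> are the dependent sets of the dual matroid.\<close>

lemma dual_rank_bounds:
  assumes s: "s \<notin> P" and g: "realizes g s P (dual_access P spanning)" and c: "complexity g s P = 1"
  shows "g {s} > 0"
    and "A \<subseteq> P \<Longrightarrow> g {s} * (real (card A) + real (\<rho> (P - A)) - real (\<rho> P)) \<le> g A"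
    and "A \<subseteq> P \<Longrightarrow> g A \<le> g {s} * (real (card A) + real (\<rho> (P - A)) - real (\<rho> P) + 1)"
proof -
  define \<sigma> where "\<sigma> = g {s}"
  let ?D = "dual_access P spanning"
  have pm: "polymatroid g (insert s P)" using g by (simp add: realizes_def)
  have g0: "g {} = 0" and g_mono: "\<And>A B. A \<subseteq> B \<Longrightarrow> B \<subseteq> insert s P \<Longrightarrow> g A \<le> g B"
    and g_sub: "\<And>A B. A \<subseteq> insert s P \<Longrightarrow> B \<subseteq> insert s P \<Longrightarrow> g (A \<union> B) + g (A \<inter> B) \<le> g A + g B"
    and g_nonneg: "\<And>A. A \<subseteq> insert s P \<Longrightarrow> g A \<ge> 0"
    using pm unfolding polymatroid_def by blast+
  have qual: "g (insert s A) = g A" if "A \<subseteq> P" "\<rho> (P - A) \<noteq> \<rho> P" for A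
  proof -
    have "A \<in> ?D" using that by (simp add: mem_dual_spanning)
    then show ?thesis using g that(1) unfolding realizes_def by blast
  qed
  have unqual: "g (insert s A) = g A + \<sigma>" if "A \<subseteq> P" "\<rho> (P - A) = \<rho> P" for A
  proof -
    have "A \<notin> ?D" using that by (simp add: mem_dual_spanning)
    then show ?thesis using g that(1) unfolding realizes_def \<sigma>_def by blast
  qed
  have "{} \<notin> ?D" by (simp add: mem_dual_spanning)
  then have "g {s} \<noteq> g {}" using g unfolding realizes_def by blast
  then have \<sigma>: "\<sigma> > 0" using g0 g_nonneg[of "{s}"] by (auto simp: \<sigma>_def)
  then show "g {s} > 0" by (simp add: \<sigma>_def)
  have single: "g {x} \<le> \<sigma>" if "x \<in> P" for x
  proof -
    have "g {x} / g {s} \<le> Max ((\<lambda>i. g {i} / g {s}) ` P)"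
      using that finite_ground by (intro Max_ge) auto
    then show ?thesis using c \<sigma> by (simp add: complexity_def \<sigma>_def)
  qed
  have sum_le: "g J \<le> \<sigma> * card J" if "finite J" "J \<subseteq> P" for J
    using that
  proof (induction J)
    case (insert x J)
    have "g (J \<union> {x}) + g (J \<inter> {x}) \<le> g J + g {x}" using insert.prems by (intro g_sub) auto
    moreover have "g (J \<inter> {x}) \<ge> 0" using insert.prems by (intro g_nonneg) auto
    ultimately show ?case using insert single[of x] by (simp add: algebra_simps)
  qed (simp add: g0)
  \<comment> \<open>The condition says that \<open>I\<close> is independent in the dual matroid. It
    suffices that each \<open>x\<close> in \<open>I\<close> adds at least \<open>\<sigma>\<close> to
    the rest of \<open>I\<close>.\<close>
  have indep: "g I \<ge> \<sigma> * card I" if I: "I \<subseteq> P" "\<rho> (P - I) = \<rho> P" for I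
  proof -
    have step: "g I - g (I - {x}) \<ge> \<sigma>" if x: "x \<in> I" for x
    proof -
      \<comment> \<open>A basis \<open>{x} \<union> K\<close> of the original matroid is chosen off
        \<open>I - {x}\<close>. Its complement \<open>B\<close> contains \<open>I - {x}\<close> and
        is unqualified, but becomes qualified once \<open>x\<close> is added. Hence \<open>x\<close>
        adds \<open>\<sigma>\<close> to \<open>B\<close>, and by submodularity at least that to
        \<open>I - {x}\<close>.\<close>
      define U where "U = P - (I - {x})"
      have xP: "x \<in> P" using x I by blast
      have "\<rho> (P - I) \<le> \<rho> U" "\<rho> U \<le> \<rho> P" unfolding U_def by (intro rank_mono; auto)+
      then have U: "\<rho> U = \<rho> P" using I by simp
      obtain K where K: "K \<subseteq> U - {x}" "\<rho> ({x} \<union> K) = \<rho> U" "card K = \<rho> U - \<rho> {x}"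
        using augment[of "{x}" U] xP x by (auto simp: U_def)
      define B where "B = P - ({x} \<union> K)"
      have KP: "K \<subseteq> P" using K by (auto simp: U_def)
      have "\<rho> K \<le> card K" using KP by (rule rank_le_card)
      then have K_small: "\<rho> K \<noteq> \<rho> P" using K(3) U no_loops[OF xP] rank_pos by linarith
      have PB: "P - B = {x} \<union> K" using KP xP by (auto simp: B_def)
      have PxB: "P - insert x B = K" using KP xP K(1) by (auto simp: B_def)
      have "g B + \<sigma> = g (insert s B)" using unqual[of B] PB K(2) U by (auto simp: B_def)
      also have "\<dots> \<le> g (insert s (insert x B))" using xP by (intro g_mono) (auto simp: B_def)
      also have "\<dots> = g (insert x B)" using qual[of "insert x B"] PxB K_small xP by (auto simp: B_def)
      finally have inc: "g B + \<sigma> \<le> g (insert x B)" .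
      have "g (I \<union> B) + g (I \<inter> B) \<le> g I + g B" using I by (intro g_sub) (auto simp: B_def)
      moreover have "I \<union> B = insert x B" "I \<inter> B = I - {x}" using K(1) x I by (auto simp: B_def U_def)
      ultimately show ?thesis using inc by simp
    qed
    have "J \<subseteq> I \<Longrightarrow> \<sigma> * card J \<le> g J" if "finite J" for J
      using that
    proof (induction J)
      case (insert x J)
      have "g (insert x J \<union> (I - {x})) + g (insert x J \<inter> (I - {x})) \<le> g (insert x J) + g (I - {x})"
        using insert.prems I by (intro g_sub) auto
      moreover have "insert x J \<union> (I - {x}) = I" "insert x J \<inter> (I - {x}) = J" using insert by auto
      ultimately show ?case using insert step[of x] by (simp add: algebra_simps)
    qed (simp add: g0)
    then show ?thesis using I finite_ground finite_subset by blast
  qed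
  assume A: "A \<subseteq> P"
  obtain K where K: "K \<subseteq> P - (P - A)" "\<rho> ((P - A) \<union> K) = \<rho> P" "card K = \<rho> P - \<rho> (P - A)"
    using augment[of "P - A" P] by auto
  \<comment> \<open>A basis of \<open>A\<close> in the dual matroid: its size is the dual rank of
    \<open>A\<close>.\<close>
  define I where "I = A - K"
  have KA: "K \<subseteq> A" using K(1) by auto
  have finA: "finite A" "finite K" using A KA finite_ground finite_subset by (blast, metis finite_subset)
  have rho_le: "\<rho> (P - A) \<le> \<rho> P" by (rule rank_mono) auto
  have card_I: "real (card I) = real (card A) + real (\<rho> (P - A)) - real (\<rho> P)"
    using K(3) KA rho_le finA card_mono[OF finA(1) KA] by (simp add: I_def card_Diff_subset)
  have I: "I \<subseteq> P" "P - I = (P - A) \<union> K" using A KA by (auto simp: I_def)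
  have gI: "\<sigma> * card I \<le> g I" using indep[OF I(1)] I(2) K(2) by simp
  also have "g I \<le> g A" using A by (intro g_mono) (auto simp: I_def)
  finally show "g {s} * (real (card A) + real (\<rho> (P - A)) - real (\<rho> P)) \<le> g A"
    by (simp add: card_I \<sigma>_def)
  have gI_le: "g I \<le> \<sigma> * card I" using sum_le[of I] I finite_ground finite_subset by blast
  have sI: "g (insert s I) = g I + \<sigma>" using unqual[OF I(1)] I(2) K(2) by simp
  \<comment> \<open>\<open>insert b I\<close> is dependent in the dual, hence qualified. Its value
    is at most \<open>\<sigma> * (card I + 1)\<close>, which \<open>insert s I\<close> already
    reaches, so \<open>b\<close> adds nothing once the secret is known.\<close>
  have one: "g (insert s (insert b I)) \<le> g (insert s I)" if b: "b \<in> K" for b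
  proof -
    have "b \<notin> I" using b by (simp add: I_def)
    have bP: "b \<in> P" using b KA A by blast
    have "P - insert b I = (P - A) \<union> (K - {b})" using I(2) b KA by auto
    moreover have "\<rho> ((P - A) \<union> (K - {b})) \<le> \<rho> (P - A) + card (K - {b})"
      using KA A by (intro rank_Un_le) auto
    moreover have "card (K - {b}) < card K" using b finA by (intro card_Diff1_less) auto
    ultimately have "\<rho> (P - insert b I) < \<rho> P" using K(3) rho_le by simp
    then have "\<rho> (P - insert b I) \<noteq> \<rho> P" by simp
    then have "g (insert s (insert b I)) = g (insert b I)" using qual[of "insert b I"] I bP by auto
    also have "\<dots> \<le> \<sigma> * card (insert b I)" using I bP finite_ground finite_subset by (intro sum_le) auto
    also have "\<dots> = \<sigma> * card I + \<sigma>" using \<open>b \<notin> I\<close> I(1) finite_ground finite_subset by (subst card_insert_disjoint) (auto simp: algebra_simps)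
    finally show ?thesis using gI sI by simp
  qed
  have "J \<subseteq> K \<Longrightarrow> g (insert s (I \<union> J)) \<le> g (insert s I)" if "finite J" for J
    using that
  proof (induction J)
    case (insert b J)
    have "g (insert s (I \<union> J) \<union> insert s (insert b I)) + g (insert s (I \<union> J) \<inter> insert s (insert b I))
        \<le> g (insert s (I \<union> J)) + g (insert s (insert b I))"
      using insert.prems I KA A by (intro g_sub) auto
    moreover have "insert s (I \<union> J) \<union> insert s (insert b I) = insert s (I \<union> insert b J)" by auto
    moreover have "g (insert s I) \<le> g (insert s (I \<union> J) \<inter> insert s (insert b I))"
      using insert.prems I KA A by (intro g_mono) auto
    ultimately show ?case using insert one[of b] by simp
  qed simp
  \<comment> \<open>The bound is on \<open>A\<close> together with the secret; passing to
    \<open>A\<close> alone leaves the slack of one unit.\<close>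
  from this[OF finA(2)] have "g (insert s A) \<le> g (insert s I)" using KA by (simp add: I_def Un_absorb2)
  moreover have "g A \<le> g (insert s A)" using A by (intro g_mono) auto
  ultimately have "g A \<le> \<sigma> * card I + \<sigma>" using sI gI_le by simp
  then show "g A \<le> g {s} * (real (card A) + real (\<rho> (P - A)) - real (\<rho> P) + 1)"
    by (simp add: card_I \<sigma>_def algebra_simps)
qed

text \<open>\<open>\<rho>'\<close> is the free extension by the secret: the secret adds nothing to a
  spanning set and a full unit to any other set, so no set knows the secret only in part.\<close>

lemma almost_ideal_spanning:
  assumes s: "s \<notin> P" and ae: "almost_entropic (\<lambda>A. real (\<rho>' A)) (insert s P)"
    and rank': "matroid_rank (insert s P) \<rho>'" "\<And>A. A \<subseteq> P \<Longrightarrow> \<rho>' A = \<rho> A"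
      "\<And>A. A \<subseteq> P \<Longrightarrow> \<rho>' (insert s A) = min (\<rho> P) (Suc (\<rho> A))"
  shows "almost_ideal P spanning"
proof -
  interpret ext: matroid_rank "insert s P" \<rho>' by fact
  let ?f = "\<lambda>A. real (\<rho>' A)"
  have f_s: "\<rho>' {s} = 1" by (rule ext.no_loops) simp
  have poly: "polymatroid ?f (insert s P)"
    unfolding polymatroid_def
  proof (intro conjI allI impI)
    show "finite (insert s P)" using finite_ground by simp
    show "real (\<rho>' {}) = 0" using ext.rank_le_card[of "{}"] by simp
    show "real (\<rho>' A) \<le> real (\<rho>' B)" if "A \<subseteq> B \<and> B \<subseteq> insert s P" for A B
      using that ext.rank_mono by simp
    show "real (\<rho>' (A \<union> B)) + real (\<rho>' (A \<inter> B)) \<le> real (\<rho>' A) + real (\<rho>' B)"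
      if "A \<subseteq> insert s P \<and> B \<subseteq> insert s P" for A B
      using that ext.rank_submodular[of A B] by (simp flip: of_nat_add)
  qed simp
  have "realizes ?f s P spanning"
    unfolding realizes_def
  proof (intro conjI allI impI poly)
    fix A assume A: "A \<subseteq> P"
    have le: "\<rho> A \<le> \<rho> P" using A by (rule rank_mono) simp
    have "A \<in> spanning \<longleftrightarrow> \<rho> A = \<rho> P" using A by (simp add: spanning_def)
    then show "(A \<in> spanning) = (real (\<rho>' (insert s A)) = real (\<rho>' A))"
      "(A \<notin> spanning) = (real (\<rho>' (insert s A)) = real (\<rho>' A) + real (\<rho>' {s}))"
      using le unfolding rank'(2)[OF A] rank'(3)[OF A] f_s by auto
  qed
  moreover have "complexity ?f s P = 1"
  proof -
    have "(\<lambda>i. ?f {i} / ?f {s}) ` P = {1}" using nonempty ext.no_loops f_s by (auto simp: image_iff)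
    then show ?thesis by (simp add: complexity_def)
  qed
  ultimately show ?thesis unfolding almost_ideal_def using s ae by blast
qed

end

section \<open>Free expansions of integer polymatroids\<close>

text \<open>The rank formula of the matroid induced by the integer polymatroid \<open>F\<close> when
  each \<open>e\<close> is placed freely on \<open>\<phi> e\<close>: the elements lying over
  \<open>S\<close> contribute at most \<open>F S\<close>, the others at most one each.\<close>

definition expansion :: "('i set \<Rightarrow> nat) \<Rightarrow> 'i set \<Rightarrow> ('e \<Rightarrow> 'i) \<Rightarrow> 'e set \<Rightarrow> nat" where
  "expansion F N \<phi> T = Min ((\<lambda>S. F S + card {e \<in> T. \<phi> e \<notin> S}) ` Pow N)"

lemma expansion_le: "finite N \<Longrightarrow> S \<subseteq> N \<Longrightarrow> expansion F N \<phi> T \<le> F S + card {e \<in> T. \<phi> e \<notin> S}"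
  unfolding expansion_def by (rule Min_le) auto

lemma expansion_attained: "finite N \<Longrightarrow> \<exists>S\<subseteq>N. expansion F N \<phi> T = F S + card {e \<in> T. \<phi> e \<notin> S}"
proof -
  assume "finite N"
  then have "expansion F N \<phi> T \<in> (\<lambda>S. F S + card {e \<in> T. \<phi> e \<notin> S}) ` Pow N"
    unfolding expansion_def by (intro Min_in) auto
  then show ?thesis by blast
qed

lemma expansion_greatest:
  assumes "finite N" "\<And>S. S \<subseteq> N \<Longrightarrow> k \<le> F S + card {e \<in> T. \<phi> e \<notin> S}"
  shows "k \<le> expansion F N \<phi> T"
  using expansion_attained[OF assms(1), of F \<phi> T] assms(2) by auto

text \<open>Submodularity is uncrossing: if \<open>S\<close> and \<open>R\<close> attain the minima
  for \<open>A\<close> and \<open>B\<close>, then \<open>S \<union> R\<close> and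
  \<open>S \<inter> R\<close> are candidates for \<open>A \<union> B\<close> and
  \<open>A \<inter> B\<close>.\<close>

lemma matroid_rank_expansion:
  fixes F :: "'i set \<Rightarrow> nat" and \<phi> :: "'e \<Rightarrow> 'i"
  assumes N: "finite N" and E: "finite E" "E \<noteq> {}" "\<phi> ` E \<subseteq> N"
    and F0: "F {} = 0" and F_mono: "\<And>A B. A \<subseteq> B \<Longrightarrow> B \<subseteq> N \<Longrightarrow> F A \<le> F B"
    and F_sub: "\<And>A B. A \<subseteq> N \<Longrightarrow> B \<subseteq> N \<Longrightarrow> F (A \<union> B) + F (A \<inter> B) \<le> F A + F B"
    and F1: "\<And>e. e \<in> E \<Longrightarrow> F {\<phi> e} \<ge> 1"
  shows "matroid_rank E (expansion F N \<phi>)"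
proof
  show "finite E" "E \<noteq> {}" by fact+
  have fin: "finite T" if "T \<subseteq> E" for T using that E(1) by (rule finite_subset)
  show le_card: "expansion F N \<phi> A \<le> card A" for A
    using expansion_le[OF N, of "{}" F \<phi> A] F0 by simp
  show "expansion F N \<phi> A \<le> expansion F N \<phi> B" if "A \<subseteq> B" "B \<subseteq> E" for A B
  proof (rule expansion_greatest[OF N])
    fix S assume "S \<subseteq> N"
    then have "expansion F N \<phi> A \<le> F S + card {e \<in> A. \<phi> e \<notin> S}" by (rule expansion_le[OF N])
    also have "card {e \<in> A. \<phi> e \<notin> S} \<le> card {e \<in> B. \<phi> e \<notin> S}"
      using that fin[of B] by (intro card_mono) auto
    finally show "expansion F N \<phi> A \<le> F S + card {e \<in> B. \<phi> e \<notin> S}" by simp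
  qed
  show "expansion F N \<phi> (A \<union> B) + expansion F N \<phi> (A \<inter> B) \<le> expansion F N \<phi> A + expansion F N \<phi> B"
    if AB: "A \<subseteq> E" "B \<subseteq> E" for A B
  proof -
    obtain S where S: "S \<subseteq> N" "expansion F N \<phi> A = F S + card {e \<in> A. \<phi> e \<notin> S}"
      using expansion_attained[OF N] by blast
    obtain R where R: "R \<subseteq> N" "expansion F N \<phi> B = F R + card {e \<in> B. \<phi> e \<notin> R}"
      using expansion_attained[OF N] by blast
    let ?U = "{e \<in> A \<union> B. \<phi> e \<notin> S \<union> R}" and ?I = "{e \<in> A \<inter> B. \<phi> e \<notin> S \<inter> R}"
    let ?a = "{e \<in> A. \<phi> e \<notin> S}" and ?b = "{e \<in> B. \<phi> e \<notin> R}"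
    have finab: "finite ?a" "finite ?b" "finite ?U" "finite ?I" using fin AB by auto
    have "card ?U + card ?I = card (?U \<union> ?I) + card (?U \<inter> ?I)" using finab by (intro card_Un_Int)
    also have "\<dots> \<le> card (?a \<union> ?b) + card (?a \<inter> ?b)"
      using finab by (intro add_mono card_mono) auto
    also have "\<dots> = card ?a + card ?b" using finab by (intro card_Un_Int[symmetric])
    finally have card: "card ?U + card ?I \<le> card ?a + card ?b" .
    have "expansion F N \<phi> (A \<union> B) \<le> F (S \<union> R) + card ?U"
      "expansion F N \<phi> (A \<inter> B) \<le> F (S \<inter> R) + card ?I"
      using S R by (intro expansion_le[OF N]; auto)+
    then show ?thesis using card F_sub[OF S(1) R(1)] S(2) R(2) by linarith
  qed
  show "expansion F N \<phi> {x} = 1" if x: "x \<in> E" for x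
  proof (rule antisym)
    show "expansion F N \<phi> {x} \<le> 1" using le_card[of "{x}"] by simp
    show "1 \<le> expansion F N \<phi> {x}"
    proof (rule expansion_greatest[OF N])
      fix S assume S: "S \<subseteq> N"
      show "1 \<le> F S + card {e \<in> {x}. \<phi> e \<notin> S}"
      proof (cases "\<phi> x \<in> S")
        case True
        then have "F {\<phi> x} \<le> F S" using S by (intro F_mono) auto
        then show ?thesis using F1[OF x] by simp
      next
        case False
        then have "{e \<in> {x}. \<phi> e \<notin> S} = {x}" by auto
        then show ?thesis by simp
      qed
    qed
  qed
qed

text \<open>\<open>F {i}\<close> free elements span position \<open>i\<close>, so the groups recover
  \<open>F\<close>. No candidate \<open>R\<close> does better, since \<open>F S\<close> is at most
  \<open>F R\<close> plus the ranks of the single positions outside \<open>R\<close>.\<close>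

lemma expansion_groups:
  fixes F :: "'i set \<Rightarrow> nat" and \<phi> :: "'e \<Rightarrow> 'i"
  assumes N: "finite N" and E: "finite E" and S: "S \<subseteq> N"
    and F0: "F {} = 0" and F_mono: "\<And>A B. A \<subseteq> B \<Longrightarrow> B \<subseteq> N \<Longrightarrow> F A \<le> F B"
    and F_sub: "\<And>A B. A \<subseteq> N \<Longrightarrow> B \<subseteq> N \<Longrightarrow> F (A \<union> B) + F (A \<inter> B) \<le> F A + F B"
    and size: "\<And>i. i \<in> S \<Longrightarrow> card {e \<in> E. \<phi> e = i} = F {i}"
  shows "expansion F N \<phi> {e \<in> E. \<phi> e \<in> S} = F S"
    and "card {e \<in> E. \<phi> e \<in> S} = (\<Sum>i\<in>S. F {i})"
proof -
  have card: "card {e \<in> E. \<phi> e \<in> W} = (\<Sum>i\<in>W. F {i})" if "W \<subseteq> S" for W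
  proof -
    have "finite W" using that S N by (meson finite_subset)
    have "{e \<in> E. \<phi> e \<in> W} = (\<Union>i\<in>W. {e \<in> E. \<phi> e = i})" by auto
    also have "card \<dots> = (\<Sum>i\<in>W. card {e \<in> E. \<phi> e = i})"
      using E \<open>finite W\<close> by (intro card_UN_disjoint) auto
    also have "\<dots> = (\<Sum>i\<in>W. F {i})" using size that by (intro sum.cong) auto
    finally show ?thesis .
  qed
  then show "card {e \<in> E. \<phi> e \<in> S} = (\<Sum>i\<in>S. F {i})" by blast
  have F_le_sum: "W \<subseteq> N \<Longrightarrow> F W \<le> (\<Sum>i\<in>W. F {i})" if "finite W" for W
    using that
  proof (induction W)
    case (insert i W)
    have "F (W \<union> {i}) + F (W \<inter> {i}) \<le> F W + F {i}" using insert.prems by (intro F_sub) auto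
    then show ?case using insert by simp
  qed (simp add: F0)
  show "expansion F N \<phi> {e \<in> E. \<phi> e \<in> S} = F S"
  proof (rule antisym)
    have "{e \<in> {e \<in> E. \<phi> e \<in> S}. \<phi> e \<notin> S} = {}" by auto
    then show "expansion F N \<phi> {e \<in> E. \<phi> e \<in> S} \<le> F S"
      using expansion_le[OF N S, of F \<phi> "{e \<in> E. \<phi> e \<in> S}"] by simp
    show "F S \<le> expansion F N \<phi> {e \<in> E. \<phi> e \<in> S}"
    proof (rule expansion_greatest[OF N])
      fix R assume R: "R \<subseteq> N"
      have fin: "finite (S - R)" using S N by (meson finite_Diff finite_subset)
      have "F S \<le> F (R \<union> (S - R))" using S R by (intro F_mono) auto
      also have "\<dots> \<le> F R + F (S - R)" using F_sub[of R "S - R"] S R by fastforce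
      also have "F (S - R) \<le> (\<Sum>i\<in>S - R. F {i})" using F_le_sum[OF fin] S by auto
      also have "\<dots> = card {e \<in> E. \<phi> e \<in> S - R}" by (rule card[symmetric]) auto
      also have "{e \<in> E. \<phi> e \<in> S - R} = {e \<in> {e \<in> E. \<phi> e \<in> S}. \<phi> e \<notin> R}" by auto
      finally show "F S \<le> F R + card {e \<in> {e \<in> E. \<phi> e \<in> S}. \<phi> e \<notin> R}" by simp
    qed
  qed
qed

text \<open>\<open>s\<close> lies on a position \<open>t\<close> of full rank. A candidate
  \<open>S\<close> containing \<open>t\<close> costs the full rank, and any other candidate counts
  \<open>s\<close> as one more element.\<close>

lemma expansion_insert_generic:
  fixes F :: "'i set \<Rightarrow> nat"
  assumes N: "finite N" and P: "finite P" "s \<notin> P" "A \<subseteq> P" and t: "t \<in> N" "\<phi> s = t"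
    and F_t: "\<And>S. S \<subseteq> N \<Longrightarrow> t \<in> S \<Longrightarrow> F S = F N" and \<phi>: "\<phi> ` P \<subseteq> N" and r: "expansion F N \<phi> P = F N"
  shows "expansion F N \<phi> (insert s A) = min (expansion F N \<phi> P) (Suc (expansion F N \<phi> A))"
proof (rule antisym)
  have finA: "finite A" using P finite_subset by blast
  have drop: "card {e \<in> insert s A. \<phi> e \<notin> S} = Suc (card {e \<in> A. \<phi> e \<notin> S})" if "t \<notin> S" for S
  proof -
    have "{e \<in> insert s A. \<phi> e \<notin> S} = insert s {e \<in> A. \<phi> e \<notin> S}" using t that by auto
    then show ?thesis using P finA by (auto simp: card_insert_if)
  qed
  obtain S where S: "S \<subseteq> N" "expansion F N \<phi> A = F S + card {e \<in> A. \<phi> e \<notin> S}"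
    using expansion_attained[OF N] by blast
  have "card {e \<in> insert s A. \<phi> e \<notin> S} \<le> card (insert s {e \<in> A. \<phi> e \<notin> S})"
    using finA by (intro card_mono) auto
  also have "\<dots> \<le> Suc (card {e \<in> A. \<phi> e \<notin> S})" by (rule card_insert_le_m1) auto
  finally have "expansion F N \<phi> (insert s A) \<le> Suc (expansion F N \<phi> A)"
    using expansion_le[OF N S(1), of F \<phi> "insert s A"] S(2) by simp
  moreover have "expansion F N \<phi> (insert s A) \<le> F N"
  proof -
    have "{e \<in> insert s A. \<phi> e \<notin> N} = {}" using t \<phi> P by auto
    then show ?thesis using expansion_le[OF N order_refl, of F \<phi> "insert s A"] by (metis add_0_right card.empty)
  qed
  ultimately show "expansion F N \<phi> (insert s A) \<le> min (expansion F N \<phi> P) (Suc (expansion F N \<phi> A))"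
    using r by simp
  show "min (expansion F N \<phi> P) (Suc (expansion F N \<phi> A)) \<le> expansion F N \<phi> (insert s A)"
  proof (rule expansion_greatest[OF N])
    fix S assume S: "S \<subseteq> N"
    show "min (expansion F N \<phi> P) (Suc (expansion F N \<phi> A)) \<le> F S + card {e \<in> insert s A. \<phi> e \<notin> S}"
    proof (cases "t \<in> S")
      case True
      then show ?thesis using F_t[OF S] r by simp
    next
      case False
      then show ?thesis using drop[OF False] expansion_le[OF N S, of F \<phi> A] by simp
    qed
  qed
qed

section \<open>Quasi-uniform families\<close>

text \<open>Outcomes and values of any types are coded as natural numbers, as
  \<open>quasi_uniform\<close> demands; the coding preserves agreement.\<close>

lemma quasi_uniformI:
  fixes \<Omega> :: "'a set" and X :: "'i \<Rightarrow> 'a \<Rightarrow> 'b"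
  assumes \<Omega>: "finite \<Omega>" "\<Omega> \<noteq> {}" and N: "finite N"
    and h: "\<And>S \<omega>. S \<subseteq> N \<Longrightarrow> \<omega> \<in> \<Omega> \<Longrightarrow> card (agree \<Omega> X S \<omega>) * h S = card \<Omega>"
  shows "quasi_uniform N h"
proof -
  define V where "V = (\<Union>i\<in>N. X i ` \<Omega>)"
  define t where "t = to_nat_on \<Omega>"
  define X' where "X' = (\<lambda>i n. to_nat_on V (X i (from_nat_into \<Omega> n)))"
  have "finite V" using \<Omega> N by (simp add: V_def)
  then have injV: "inj_on (to_nat_on V) V" by (intro inj_on_to_nat_on countable_finite)
  have inj: "inj_on t \<Omega>" unfolding t_def using \<Omega> by (intro inj_on_to_nat_on countable_finite)
  have inv: "from_nat_into \<Omega> (t \<omega>) = \<omega>" if "\<omega> \<in> \<Omega>" for \<omega>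
    using that \<Omega> by (simp add: t_def countable_finite)
  have "card (agree (t ` \<Omega>) X' S n) * h S = card (t ` \<Omega>)" if S: "S \<subseteq> N" and n: "n \<in> t ` \<Omega>" for S n
  proof -
    obtain \<omega> where \<omega>: "\<omega> \<in> \<Omega>" "n = t \<omega>" using n by blast
    have iff: "X' i (t \<omega>') = X' i (t \<omega>) \<longleftrightarrow> X i \<omega>' = X i \<omega>" if "i \<in> S" "\<omega>' \<in> \<Omega>" for i \<omega>'
    proof -
      have "X i \<omega>' \<in> V" "X i \<omega> \<in> V" using that S \<omega> by (auto simp: V_def)
      then show ?thesis using injV \<omega> that by (auto simp: X'_def inv inj_on_eq_iff)
    qed
    have "agree (t ` \<Omega>) X' S n = t ` agree \<Omega> X S \<omega>"
      using iff by (auto simp: agree_def \<omega>)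
    moreover have "inj_on t (agree \<Omega> X S \<omega>)" by (rule inj_on_subset[OF inj]) (auto simp: agree_def)
    ultimately show ?thesis using h[OF S \<omega>(1)] inj by (simp add: card_image)
  qed
  moreover have "finite (t ` \<Omega>)" "t ` \<Omega> \<noteq> {}" using \<Omega> by auto
  ultimately show ?thesis unfolding quasi_uniform_def by blast
qed

lemma quasi_uniform_mult:
  fixes h k :: "'i set \<Rightarrow> nat"
  assumes N: "finite N" and "quasi_uniform N h" "quasi_uniform N k"
  shows "quasi_uniform N (\<lambda>S. h S * k S)"
proof -
  obtain \<Omega> :: "nat set" and X :: "'i \<Rightarrow> nat \<Rightarrow> nat" where \<Omega>: "finite \<Omega>" "\<Omega> \<noteq> {}"
    and X: "\<And>S \<omega>. S \<subseteq> N \<Longrightarrow> \<omega> \<in> \<Omega> \<Longrightarrow> card (agree \<Omega> X S \<omega>) * h S = card \<Omega>"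
    using assms(2) unfolding quasi_uniform_def by blast
  obtain \<Psi> :: "nat set" and Y :: "'i \<Rightarrow> nat \<Rightarrow> nat" where \<Psi>: "finite \<Psi>" "\<Psi> \<noteq> {}"
    and Y: "\<And>S \<omega>. S \<subseteq> N \<Longrightarrow> \<omega> \<in> \<Psi> \<Longrightarrow> card (agree \<Psi> Y S \<omega>) * k S = card \<Psi>"
    using assms(3) unfolding quasi_uniform_def by blast
  define Z where "Z = (\<lambda>i (z :: nat \<times> nat). (X i (fst z), Y i (snd z)))"
  show ?thesis
  proof (rule quasi_uniformI[OF _ _ N])
    show "finite (\<Omega> \<times> \<Psi>)" "\<Omega> \<times> \<Psi> \<noteq> {}" using \<Omega> \<Psi> by auto
    fix S z assume S: "S \<subseteq> N" and z: "z \<in> \<Omega> \<times> \<Psi>"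
    have "agree (\<Omega> \<times> \<Psi>) Z S z = agree \<Omega> X S (fst z) \<times> agree \<Psi> Y S (snd z)"
      by (auto simp: agree_def Z_def)
    then have "card (agree (\<Omega> \<times> \<Psi>) Z S z) * (h S * k S)
       = (card (agree \<Omega> X S (fst z)) * h S) * (card (agree \<Psi> Y S (snd z)) * k S)"
      by (simp add: card_cartesian_product)
    also have "\<dots> = card (\<Omega> \<times> \<Psi>)" using X[OF S] Y[OF S] z by (auto simp: card_cartesian_product)
    finally show "card (agree (\<Omega> \<times> \<Psi>) Z S z) * (h S * k S) = card (\<Omega> \<times> \<Psi>)" .
  qed
qed

text \<open>One uniform variable with \<open>L\<close> values, known to exactly the members of
  \<open>J\<close>: the noise used for rounding.\<close>

lemma quasi_uniform_common:
  assumes N: "finite N" and L: "L \<ge> 1"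
  shows "quasi_uniform N (\<lambda>S. if J \<inter> S = {} then 1 else L)"
proof (rule quasi_uniformI[OF _ _ N])
  let ?X = "\<lambda>i z. if i \<in> J then z else (0 :: nat)"
  show "finite {..<L}" "{..<L} \<noteq> {}" using L by (auto simp: lessThan_empty_iff)
  fix S z assume "z \<in> {..<L}"
  then have "agree {..<L} ?X S z = (if J \<inter> S = {} then {..<L} else {z})"
    by (auto simp: agree_def)
  then show "card (agree {..<L} ?X S z) * (if J \<inter> S = {} then 1 else L) = card {..<L}" by simp
qed

lemma quasi_uniform_one: "finite N \<Longrightarrow> quasi_uniform N (\<lambda>_. 1)"
  using quasi_uniform_common[of N 1 "{}"] by simp

lemma quasi_uniform_power:
  assumes "finite N" "quasi_uniform N h"
  shows "quasi_uniform N (\<lambda>S. h S ^ n)"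
  by (induction n) (use assms in \<open>auto intro: quasi_uniform_mult quasi_uniform_one[simplified]\<close>)

lemma quasi_uniform_prod:
  assumes "finite N" "finite \<J>" "\<And>J. J \<in> \<J> \<Longrightarrow> quasi_uniform N (h J)"
  shows "quasi_uniform N (\<lambda>S. \<Prod>J\<in>\<J>. h J S)"
  using assms(2,3)
  by (induction \<J>) (use assms(1) in \<open>auto intro: quasi_uniform_mult quasi_uniform_one[simplified]\<close>)

text \<open>The entropy of a quasi-uniform subfamily is exactly \<open>log 2 (h S)\<close>, which
  therefore inherits monotonicity and submodularity.\<close>

lemma quasi_uniform_log:
  fixes h :: "'i set \<Rightarrow> nat"
  assumes "quasi_uniform N h"
  shows "h {} = 1" and "\<And>S. S \<subseteq> N \<Longrightarrow> h S > 0"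
    and "\<And>A B. A \<subseteq> B \<Longrightarrow> B \<subseteq> N \<Longrightarrow> log 2 (h A) \<le> log 2 (h B)"
    and "\<And>A B. A \<subseteq> N \<Longrightarrow> B \<subseteq> N \<Longrightarrow> log 2 (h (A \<union> B)) + log 2 (h (A \<inter> B)) \<le> log 2 (h A) + log 2 (h B)"
proof -
  obtain \<Omega> :: "nat set" and X :: "'i \<Rightarrow> nat \<Rightarrow> nat" where \<Omega>: "finite \<Omega>" "\<Omega> \<noteq> {}"
    and X: "\<And>S \<omega>. S \<subseteq> N \<Longrightarrow> \<omega> \<in> \<Omega> \<Longrightarrow> card (agree \<Omega> X S \<omega>) * h S = card \<Omega>"
    using assms unfolding quasi_uniform_def by blast
  have n: "card \<Omega> > 0" using \<Omega> by (simp add: card_gt_0_iff)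
  obtain \<omega>0 where \<omega>0: "\<omega>0 \<in> \<Omega>" using \<Omega> by blast
  show "h {} = 1" using X[OF _ \<omega>0, of "{}"] n by (simp add: agree_def)
  show pos: "h S > 0" if "S \<subseteq> N" for S using X[OF that \<omega>0] n by (metis mult_0_right neq0_conv)
  interpret weighted_space \<Omega> "\<lambda>_. 1 / card \<Omega>" by (rule weighted_space_uniform[OF \<Omega>])
  let ?X = "\<lambda>S \<omega>. restrict (\<lambda>i. X i \<omega>) S"
  have ent: "ent \<Omega> (\<lambda>_. 1 / card \<Omega>) (?X S) = log 2 (h S)" if S: "S \<subseteq> N" for S
  proof -
    have "real (card \<Omega>) / card (agree \<Omega> X S \<omega>) = h S" if "\<omega> \<in> \<Omega>" for \<omega>
    proof -
      have "real (card (agree \<Omega> X S \<omega>)) * real (h S) = real (card \<Omega>)"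
        using X[OF S that] by (simp flip: of_nat_mult)
      then show ?thesis using card_agree_pos[OF \<Omega>(1) that, of X S] by (simp add: field_simps)
    qed
    then show ?thesis using n by (simp add: ent_uniform[OF \<Omega>(1)] uniform_ent_def fibre_restrict)
  qed
  show "log 2 (h A) \<le> log 2 (h B)" if "A \<subseteq> B" "B \<subseteq> N" for A B
  proof -
    have "ent \<Omega> (\<lambda>_. 1 / card \<Omega>) (?X A) \<le> ent \<Omega> (\<lambda>_. 1 / card \<Omega>) (?X B)"
      using that by (intro ent_mono) (auto simp: restrict_def fun_eq_iff split: if_splits)
    then show ?thesis using ent that by (simp add: subset_trans)
  qed
  show "log 2 (h (A \<union> B)) + log 2 (h (A \<inter> B)) \<le> log 2 (h A) + log 2 (h B)" if AB: "A \<subseteq> N" "B \<subseteq> N" for A B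
  proof -
    let ?H = "\<lambda>Z. ent \<Omega> (\<lambda>_. 1 / card \<Omega>) Z"
    have r: "?X S \<omega>' = ?X S \<omega> \<longleftrightarrow> (\<forall>i\<in>S. X i \<omega>' = X i \<omega>)" for S \<omega> \<omega>'
      by (auto simp: restrict_def fun_eq_iff)
    have "?H (\<lambda>\<omega>. (?X A \<omega>, ?X B \<omega>, ?X (A \<inter> B) \<omega>)) = ?H (?X (A \<union> B))"
      "?H (\<lambda>\<omega>. (?X A \<omega>, ?X (A \<inter> B) \<omega>)) = ?H (?X A)"
      "?H (\<lambda>\<omega>. (?X B \<omega>, ?X (A \<inter> B) \<omega>)) = ?H (?X B)"
      by (rule ent_cong, simp only: prod.inject r, blast)+
    then show ?thesis
      using ent_submodular[of "?X A" "?X B" "?X (A \<inter> B)"] ent[of "A \<union> B"] ent[of "A \<inter> B"] ent[of A] ent[of B] AB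
      by (simp add: le_infI1)
  qed
qed

section \<open>Rounding to an integer polymatroid\<close>

text \<open>Moebius inversion on the subset lattice, by induction: the sets containing the new
  element \<open>a\<close> account for the increment of \<open>d\<close> caused by
  \<open>a\<close>.\<close>

lemma exists_subset_sum:
  fixes d :: "'i set \<Rightarrow> real"
  assumes "finite N"
  shows "\<exists>x. \<forall>S\<subseteq>N. (\<Sum>J\<in>Pow S. x J) = d S"
  using assms
proof (induction N arbitrary: d)
  case empty
  then show ?case by (intro exI[of _ d]) auto
next
  case (insert a N)
  obtain x where x: "\<And>S. S \<subseteq> N \<Longrightarrow> (\<Sum>J\<in>Pow S. x J) = d S" using insert.IH by blast
  obtain y where y: "\<And>S. S \<subseteq> N \<Longrightarrow> (\<Sum>J\<in>Pow S. y J) = d (insert a S) - d S"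
    using insert.IH[of "\<lambda>S. d (insert a S) - d S"] by blast
  define z where "z = (\<lambda>J. if a \<in> J then y (J - {a}) else x J)"
  have out: "(\<Sum>J\<in>Pow S. z J) = d S" if "S \<subseteq> N" for S
  proof -
    have "(\<Sum>J\<in>Pow S. z J) = (\<Sum>J\<in>Pow S. x J)"
      using that insert.hyps by (intro sum.cong) (auto simp: z_def)
    then show ?thesis using x[OF that] by simp
  qed
  have "(\<Sum>J\<in>Pow S. z J) = d S" if S: "S \<subseteq> insert a N" for S
  proof (cases "a \<in> S")
    case False
    then show ?thesis using S out by blast
  next
    case True
    define R where "R = S - {a}"
    have R: "S = insert a R" "a \<notin> R" "R \<subseteq> N" using True S by (auto simp: R_def)
    have finR: "finite R" using R insert.hyps finite_subset by blast
    have "(\<Sum>J\<in>Pow S. z J) = (\<Sum>J\<in>Pow R. z J) + (\<Sum>J\<in>insert a ` Pow R. z J)"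
      unfolding R(1) Pow_insert using R finR by (intro sum.union_disjoint) auto
    also have "(\<Sum>J\<in>insert a ` Pow R. z J) = (\<Sum>J\<in>Pow R. z (insert a J))"
      using R by (intro sum.reindex_cong[of "insert a"]) (auto simp: inj_on_def)
    also have "\<dots> = (\<Sum>J\<in>Pow R. y J)"
    proof (rule sum.cong[OF refl])
      fix J assume "J \<in> Pow R"
      then have "insert a J - {a} = J" using R by auto
      then show "z (insert a J) = y J" by (simp add: z_def)
    qed
    finally show ?thesis using out[OF R(3)] y[OF R(3)] R(1) by simp
  qed
  then show ?case by blast
qed

text \<open>The rank functions \<open>S \<mapsto> [J \<inter> S \<noteq> {}]\<close> with \<^term>\<open>J\<close> nonempty form a basis.\<close>

lemma exists_hitting_sum:
  fixes f :: "'i set \<Rightarrow> real"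
  assumes N: "finite N" and f: "f {} = 0"
  shows "\<exists>x. x {} = 0 \<and> (\<forall>S\<subseteq>N. f S = (\<Sum>J\<in>Pow N. if J \<inter> S = {} then 0 else x J))"
proof -
  \<comment> \<open>Missing \<open>S\<close> means lying in \<open>N - S\<close>, so complementation
    reduces hitting sums to subset sums.\<close>
  obtain x where x: "\<And>S. S \<subseteq> N \<Longrightarrow> (\<Sum>J\<in>Pow S. x J) = f N - f (N - S)"
    using exists_subset_sum[OF N, of "\<lambda>S. f N - f (N - S)"] by blast
  have "f S = (\<Sum>J\<in>Pow N. if J \<inter> S = {} then 0 else x J)" if S: "S \<subseteq> N" for S
  proof -
    have "Pow N \<inter> {J. J \<inter> S = {}} = Pow (N - S)" by auto
    then have "(\<Sum>J\<in>Pow N. if J \<inter> S = {} then x J else 0) = (\<Sum>J\<in>Pow (N - S). x J)"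
      using N by (simp add: sum.If_cases)
    moreover have "(\<Sum>J\<in>Pow N. if J \<inter> S = {} then 0 else x J) = (\<Sum>J\<in>Pow N. x J) - (\<Sum>J\<in>Pow N. if J \<inter> S = {} then x J else 0)"
      unfolding sum_subtractf[symmetric] by (intro sum.cong) auto
    moreover have "N - (N - S) = S" using S by auto
    ultimately show ?thesis using x[of N] x[of "N - S"] f by simp
  qed
  moreover have "x {} = 0" using x[of "{}"] by simp
  ultimately show ?thesis by blast
qed

text \<open>The map \<open>c\<close> allows each index set to be enlarged, here by the top element
  5; the coefficients are real before rounding and integral after it.\<close>

definition hits :: "'i set set \<Rightarrow> ('i set \<Rightarrow> 'i set) \<Rightarrow> ('i set \<Rightarrow> 'a :: comm_monoid_add) \<Rightarrow> 'i set \<Rightarrow> 'a" where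
  "hits \<J> c a S = (\<Sum>J\<in>\<J>. if c J \<inter> S = {} then 0 else a J)"

lemma hits_mono:
  fixes a :: "'i set \<Rightarrow> real"
  assumes "\<And>J. J \<in> \<J> \<Longrightarrow> a J \<ge> 0" "A \<subseteq> B"
  shows "hits \<J> c a A \<le> hits \<J> c a B"
  unfolding hits_def using assms by (intro sum_mono) auto

lemma hits_submodular:
  fixes a :: "'i set \<Rightarrow> real"
  assumes "\<And>J. J \<in> \<J> \<Longrightarrow> a J \<ge> 0"
  shows "hits \<J> c a (A \<union> B) + hits \<J> c a (A \<inter> B) \<le> hits \<J> c a A + hits \<J> c a B"
  unfolding hits_def sum.distrib[symmetric] using assms by (intro sum_mono) (auto simp: Int_Un_distrib)

lemma hits_le_card:
  fixes a :: "'i set \<Rightarrow> real"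
  assumes "\<And>J. J \<in> \<J> \<Longrightarrow> a J \<ge> 0" "\<And>J. J \<in> \<J> \<Longrightarrow> a J \<le> 1"
  shows "hits \<J> c a S \<le> card \<J>"
proof -
  have "hits \<J> c a S \<le> (\<Sum>J\<in>\<J>. 1)" unfolding hits_def using assms by (intro sum_mono) auto
  then show ?thesis by simp
qed

lemma mmrv_gap_perturb:
  assumes bounds: "\<And>S. S \<subseteq> N \<Longrightarrow> b * v S \<le> u S \<and> u S \<le> b * v S + c"
    and sub: "A \<subseteq> N" "B \<subseteq> N" "C \<subseteq> N" "D \<subseteq> N" "E \<subseteq> N"
  shows "mmrv_gap u A B C D E \<le> b * mmrv_gap v A B C D E + 11 * c"
proof -
  have "b * mmrv_gap v A B C D E = mmrv_gap (\<lambda>S. b * v S) A B C D E"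
    by (simp add: mmrv_gap_def algebra_simps)
  then show ?thesis
    using bounds[OF sub(1)] bounds[OF sub(2)] bounds[OF sub(5)] bounds[of "A \<union> C"] bounds[of "B \<union> C"] bounds[of "A \<union> D"]
      bounds[of "B \<union> D"] bounds[of "A \<union> E"] bounds[of "B \<union> E"] bounds[of "A \<union> B"] bounds[of "A \<union> B \<union> C"]
      bounds[of "A \<union> B \<union> D"] bounds[of "C \<union> D"] bounds[of "A \<union> B \<union> E"] sub
    by (simp add: mmrv_gap_def)
qed

text \<open>The coefficients of \<open>m * log 2 (h S)\<close> in the hitting basis are rounded up.
  The excess is a nonnegative combination of at most 32 hitting functions with coefficients at most
  1, so it is monotone, submodular and at most 32, and shared uniform variables realize it.\<close>

lemma polymatroid_rounding:
  fixes h :: "nat set \<Rightarrow> nat" and m :: nat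
  assumes qu: "quasi_uniform {..<6} h" and top: "\<And>S. S \<subseteq> {..<6} \<Longrightarrow> 5 \<in> S \<Longrightarrow> h S = h {..<5}"
  obtains F :: "nat set \<Rightarrow> nat" where
    "F {} = 0" "\<And>A B. A \<subseteq> B \<Longrightarrow> B \<subseteq> {..<6} \<Longrightarrow> F A \<le> F B"
    "\<And>A B. A \<subseteq> {..<6} \<Longrightarrow> B \<subseteq> {..<6} \<Longrightarrow> F (A \<union> B) + F (A \<inter> B) \<le> F A + F B"
    "\<And>S. S \<subseteq> {..<6} \<Longrightarrow> 5 \<in> S \<Longrightarrow> F S = F {..<6}" "F {..<5} = F {..<6}"
    "\<And>S. S \<subseteq> {..<6} \<Longrightarrow> m * log 2 (h S) \<le> F S \<and> F S \<le> m * log 2 (h S) + 32"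
    "\<And>j. \<exists>k. quasi_uniform {..<6} k \<and> (\<forall>S\<subseteq>{..<6}. (2 ^ j) ^ F S \<le> k S \<and> real (k S) \<le> 2 ^ 32 * (2 ^ j) ^ F S)"
proof -
  define N0 where "N0 = {..<5::nat}"
  define N where "N = {..<6::nat}"
  have N: "finite N" "N = insert 5 N0" "finite N0" "5 \<notin> N0" by (auto simp: N_def N0_def)
  define f where "f = (\<lambda>S. log 2 (h S))"
  note log_h = quasi_uniform_log[OF qu, folded N_def]
  have f0: "f {} = 0" using log_h(1) by (simp add: f_def)
  obtain x where x0: "x {} = 0" and x: "\<And>S. S \<subseteq> N0 \<Longrightarrow> f S = (\<Sum>J\<in>Pow N0. if J \<inter> S = {} then 0 else x J)"
    using exists_hitting_sum[of N0 f] N f0 by blast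
  \<comment> \<open>With 5 in every index set, a set containing 5 collects all coefficients.
    \<open>N0\<close> collects the same total because the empty index set has coefficient
    zero.\<close>
  define U where "U = (\<lambda>a :: nat set \<Rightarrow> real. hits (Pow N0) (insert 5) a)"
  have top_eq: "(\<Sum>J\<in>Pow N0. if insert 5 J \<inter> S = {} then 0 else a J) = sum a (Pow N0)"
    if "5 \<in> S" for S :: "nat set" and a :: "nat set \<Rightarrow> 'b :: comm_monoid_add"
    using that by (intro sum.cong) auto
  have N0_eq: "(\<Sum>J\<in>Pow N0. if insert 5 J \<inter> N0 = {} then 0 else a J) = sum a (Pow N0)"
    if "a {} = 0" for a :: "nat set \<Rightarrow> 'b :: comm_monoid_add"
    using that N(4) by (intro sum.cong) (auto simp: Int_absorb2)
  have rep: "f S = U x S" if S: "S \<subseteq> N" for S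
  proof (cases "5 \<in> S")
    case False
    then have "insert 5 J \<inter> S = J \<inter> S" for J by auto
    moreover have "S \<subseteq> N0" using S False N by auto
    ultimately show ?thesis using x[of S] by (simp add: U_def hits_def)
  next
    case True
    have "f S = f N0" using top[of S] S True by (simp add: f_def N_def N0_def)
    also have "\<dots> = (\<Sum>J\<in>Pow N0. if insert 5 J \<inter> N0 = {} then 0 else x J)"
      using x[of N0] N by simp
    also have "\<dots> = U x S" unfolding U_def hits_def top_eq[OF True] N0_eq[of x, OF x0] ..
    finally show ?thesis .
  qed
  \<comment> \<open>Coefficients may be negative. Only the excess \<open>\<tau>\<close> has to be
    realized by noise, since the remaining part comes from independent copies.\<close>
  define k where "k = (\<lambda>J. \<lceil>m * x J\<rceil>)"
  define \<tau> where "\<tau> = (\<lambda>J. real_of_int (k J) - m * x J)"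
  have \<tau>: "\<tau> J \<ge> 0" "\<tau> J \<le> 1" for J unfolding \<tau>_def k_def by linarith+
  define Fi where "Fi = hits (Pow N0) (insert 5) k"
  define F where "F = (\<lambda>S. nat (Fi S))"
  have Fi: "real_of_int (Fi S) = m * f S + U \<tau> S" if "S \<subseteq> N" for S
  proof -
    have "real_of_int (Fi S) = (\<Sum>J\<in>Pow N0. if insert 5 J \<inter> S = {} then 0 else real_of_int (k J))"
      unfolding Fi_def hits_def of_int_sum by (intro sum.cong) auto
    also have "\<dots> = (\<Sum>J\<in>Pow N0. m * (if insert 5 J \<inter> S = {} then 0 else x J)) + U \<tau> S"
      unfolding U_def hits_def sum.distrib[symmetric] by (intro sum.cong) (auto simp: \<tau>_def)
    also have "\<dots> = m * f S + U \<tau> S" using rep[OF that] by (simp add: U_def hits_def sum_distrib_left)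
    finally show ?thesis .
  qed
  have U0: "U \<tau> S \<ge> 0" "U \<tau> S \<le> 32" for S
  proof -
    show "U \<tau> S \<ge> 0" unfolding U_def hits_def using \<tau> by (intro sum_nonneg) auto
    have "U \<tau> S \<le> card (Pow N0)" unfolding U_def using \<tau> by (intro hits_le_card) auto
    then show "U \<tau> S \<le> 32" by (simp add: card_Pow N0_def)
  qed
  have f_nonneg: "f S \<ge> 0" if "S \<subseteq> N" for S
    using log_h(3)[of "{}" S] that f0 by (simp add: f_def)
  have F: "real (F S) = m * f S + U \<tau> S" if "S \<subseteq> N" for S
  proof -
    have "real_of_int (Fi S) \<ge> 0" unfolding Fi[OF that] using f_nonneg[OF that] U0(1) by simp
    then show ?thesis using Fi[OF that] by (simp add: F_def)
  qed
  show ?thesis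
  proof (rule that[of F])
    show "F {} = 0" by (simp add: F_def Fi_def hits_def)
    show "F A \<le> F B" if "A \<subseteq> B" "B \<subseteq> {..<6}" for A B
    proof -
      have AB: "A \<subseteq> N" "B \<subseteq> N" using that by (auto simp: N_def)
      have "real (F A) \<le> real (F B)"
        unfolding F[OF AB(1)] F[OF AB(2)] U_def using log_h(3)[OF that(1) AB(2)] that(1) \<tau>
        by (intro add_mono mult_left_mono hits_mono) (auto simp: f_def)
      then show ?thesis by simp
    qed
    show "F (A \<union> B) + F (A \<inter> B) \<le> F A + F B" if "A \<subseteq> {..<6}" "B \<subseteq> {..<6}" for A B
    proof -
      have AB: "A \<subseteq> N" "B \<subseteq> N" "A \<union> B \<subseteq> N" "A \<inter> B \<subseteq> N" using that by (auto simp: N_def)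
      have "m * (f (A \<union> B) + f (A \<inter> B)) \<le> m * (f A + f B)"
        using log_h(4)[OF AB(1,2)] by (intro mult_left_mono) (auto simp: f_def)
      moreover have "U \<tau> (A \<union> B) + U \<tau> (A \<inter> B) \<le> U \<tau> A + U \<tau> B"
        unfolding U_def using \<tau> by (intro hits_submodular)
      ultimately have "real (F (A \<union> B)) + real (F (A \<inter> B)) \<le> real (F A) + real (F B)"
        unfolding F[OF AB(1)] F[OF AB(2)] F[OF AB(3)] F[OF AB(4)] by (simp add: algebra_simps)
      then show ?thesis by linarith
    qed
    have five: "5 \<in> {..<6::nat}" by simp
    show "F S = F {..<6}" if "S \<subseteq> {..<6}" "5 \<in> S" for S
      unfolding F_def Fi_def hits_def top_eq[OF that(2)] top_eq[OF five] ..
    have k0: "k {} = 0" by (simp add: k_def x0)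
    show "F {..<5} = F {..<6}"
      unfolding F_def Fi_def hits_def top_eq[OF five] using N0_eq[of k, OF k0] by (simp only: N0_def)
    show "m * log 2 (h S) \<le> F S \<and> F S \<le> m * log 2 (h S) + 32" if "S \<subseteq> {..<6}" for S
      using F[of S] U0[of S] that by (simp add: f_def N_def)
    fix j :: nat
    \<comment> \<open>The noise on \<open>J\<close> should carry \<open>j * \<tau> J\<close> bits.
      Rounding its number of values up at most doubles it, and the 32 index sets together give the
      factor \<open>2 ^ 32\<close>.\<close>
    define L where "L = (\<lambda>J. nat \<lceil>2 powr (j * \<tau> J)\<rceil>)"
    define kk where "kk = (\<lambda>S. h S ^ (m * j) * (\<Prod>J\<in>Pow N0. if insert 5 J \<inter> S = {} then 1 else L J))"
    have powr1: "(2::real) powr (j * \<tau> J) \<ge> 1" for J using \<tau>(1)[of J] by (intro ge_one_powr_ge_zero) auto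
    have L: "2 powr (j * \<tau> J) \<le> real (L J)" "real (L J) \<le> 2 * 2 powr (j * \<tau> J)" for J
      using powr1[of J] unfolding L_def by linarith+
    have L1: "L J \<ge> 1" for J using L(1)[of J] powr1[of J] by linarith
    have "quasi_uniform {..<6} kk"
      unfolding kk_def N0_def using L1 qu
      by (intro quasi_uniform_mult quasi_uniform_power quasi_uniform_prod quasi_uniform_common) auto
    moreover have "(2 ^ j) ^ F S \<le> kk S \<and> real (kk S) \<le> 2 ^ 32 * (2 ^ j) ^ F S" if "S \<subseteq> {..<6}" for S
    proof -
      have S: "S \<subseteq> N" using that by (simp add: N_def)
      define p where "p = (\<Prod>J\<in>Pow N0. if insert 5 J \<inter> S = {} then 1 else 2 powr (j * \<tau> J))"
      define p' where "p' = (\<Prod>J\<in>Pow N0. if insert 5 J \<inter> S = {} then 1 else real (L J))"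
      have p: "p = 2 powr (j * U \<tau> S)"
      proof -
        have "p = (\<Prod>J\<in>Pow N0. 2 powr (if insert 5 J \<inter> S = {} then 0 else j * \<tau> J))"
          unfolding p_def by (intro prod.cong) auto
        also have "\<dots> = 2 powr (\<Sum>J\<in>Pow N0. if insert 5 J \<inter> S = {} then 0 else j * \<tau> J)"
          using N(3) by (simp add: powr_sum)
        also have "(\<Sum>J\<in>Pow N0. if insert 5 J \<inter> S = {} then 0 else j * \<tau> J) = j * U \<tau> S"
          unfolding U_def hits_def sum_distrib_left by (intro sum.cong) auto
        finally show ?thesis .
      qed
      have pp': "p \<le> p'" unfolding p_def p'_def using L by (intro prod_mono) auto
      have p'p: "p' \<le> 2 ^ 32 * p"
      proof -
        have "p' \<le> (\<Prod>J\<in>Pow N0. 2 * (if insert 5 J \<inter> S = {} then 1 else 2 powr (j * \<tau> J)))"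
          unfolding p'_def using L by (intro prod_mono) auto
        also have "\<dots> = 2 ^ card (Pow N0) * p" by (simp add: p_def prod.distrib)
        finally show ?thesis by (simp add: card_Pow N0_def)
      qed
      have hS: "real (h S) ^ (m * j) = 2 powr (j * (m * f S))"
      proof -
        have "real (h S) = 2 powr f S" using log_h(2)[OF S] by (simp add: f_def)
        then have "real (h S) ^ (m * j) = (2 powr f S) powr (real (m * j))" by (subst powr_realpow) simp_all
        then show ?thesis by (simp add: powr_powr mult_ac)
      qed
      have q: "real ((2 ^ j) ^ F S) = real (h S) ^ (m * j) * p"
      proof -
        have "real ((2 ^ j) ^ F S) = 2 powr (j * real (F S))" by (simp add: powr_realpow power_mult[symmetric] flip: of_nat_mult)
        then show ?thesis by (simp add: F[OF S] hS p distrib_left powr_add)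
      qed
      have kk: "real (kk S) = real (h S) ^ (m * j) * p'"
        unfolding kk_def p'_def by (simp add: of_nat_prod if_distrib cong: if_cong)
      have "real ((2 ^ j) ^ F S) \<le> real (kk S)"
        unfolding q kk using pp' by (intro mult_left_mono) auto
      moreover have "real (kk S) \<le> 2 ^ 32 * real ((2 ^ j) ^ F S)"
        unfolding q kk using mult_left_mono[OF p'p, of "real (h S) ^ (m * j)"] by (simp add: mult_ac)
      ultimately show ?thesis by (metis of_nat_le_iff of_nat_numeral of_nat_power)
    qed
    ultimately show "\<exists>k. quasi_uniform {..<6} k \<and> (\<forall>S\<subseteq>{..<6}. (2 ^ j) ^ F S \<le> k S \<and> real (k S) \<le> 2 ^ 32 * (2 ^ j) ^ F S)"
      by blast
  qed
qed

text \<open>The hypothesis \<open>top\<close> makes element 5 a function and a carrier of the first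
  five, so a secret placed on it is generic in the whole matroid. \<open>h {0} \<ge> 2\<close>
  provides a participant and an element of positive rank.\<close>

lemma almost_ideal_not_self_dual:
  fixes h :: "nat set \<Rightarrow> nat"
  assumes qu: "quasi_uniform {..<6} h" and top: "\<And>S. S \<subseteq> {..<6} \<Longrightarrow> 5 \<in> S \<Longrightarrow> h S = h {..<5}"
    and h0: "h {0} \<ge> 2"
    and gap: "mmrv_gap (\<lambda>S. log 2 (h ({..<5} - S))) {0} {1} {2} {3} {4} < 0"
  shows "\<exists>(P :: nat set) \<A>. finite P \<and> access_structure P \<A> \<and>
           almost_ideal P \<A> \<and> \<not> almost_ideal P (dual_access P \<A>)"
proof -
  define N0 where "N0 = {..<5::nat}"
  define N where "N = {..<6::nat}"
  have N: "finite N" "N0 \<subseteq> N" "finite N0" "5 \<in> N" by (auto simp: N_def N0_def)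
  define \<delta> where "\<delta> = - mmrv_gap (\<lambda>S. log 2 (h (N0 - S))) {0} {1} {2} {3} {4}"
  have "\<delta> > 0" using gap by (simp add: \<delta>_def N0_def)
  \<comment> \<open>363 = 11 + 11 * 32: the slack of the dual rank bounds and the rounding error,
    each entering with total coefficient 11.\<close>
  then obtain m :: nat where m: "m * \<delta> > 363" using reals_Archimedean3 by blast
  then have "m > 0" by (cases m) auto
  obtain F :: "nat set \<Rightarrow> nat" where F0: "F {} = 0" and F_mono: "\<And>A B. A \<subseteq> B \<Longrightarrow> B \<subseteq> N \<Longrightarrow> F A \<le> F B"
    and F_sub: "\<And>A B. A \<subseteq> N \<Longrightarrow> B \<subseteq> N \<Longrightarrow> F (A \<union> B) + F (A \<inter> B) \<le> F A + F B"
    and F5: "\<And>S. S \<subseteq> N \<Longrightarrow> 5 \<in> S \<Longrightarrow> F S = F N" and F_N0: "F N0 = F N"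
    and F_approx: "\<And>S. S \<subseteq> N \<Longrightarrow> m * log 2 (h S) \<le> F S \<and> F S \<le> m * log 2 (h S) + 32"
    and F_qu: "\<And>j. \<exists>k. quasi_uniform N k \<and> (\<forall>S\<subseteq>N. (2 ^ j) ^ F S \<le> k S \<and> real (k S) \<le> 2 ^ 32 * (2 ^ j) ^ F S)"
    by (rule polymatroid_rounding[OF qu, where m = m, folded N_def N0_def], erule (1) top[folded N_def N0_def])
      (rule that; assumption)
  define \<phi> where "\<phi> = (\<lambda>e. fst (prod_decode e))"
  \<comment> \<open>An element codes its position and a running number. Positions 0 to 4 receive as
    many elements as their rank; position 5 receives only the secret.\<close>
  define group where "group = (\<lambda>i. (\<lambda>j. prod_encode (i, j)) ` {..<F {i}})"
  define P where "P = (\<Union>i\<in>N0. group i)"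
  define s where "s = prod_encode (5, 0)"
  define \<rho> where "\<rho> = expansion F N \<phi>"
  have \<phi>_group: "\<phi> e = i" if "e \<in> group i" for e i using that by (auto simp: group_def \<phi>_def)
  have finP: "finite P" using N by (simp add: P_def group_def)
  have \<phi>P: "\<phi> e \<in> N0" if "e \<in> P" for e using that \<phi>_group by (auto simp: P_def)
  have \<phi>s: "\<phi> s = 5" by (simp add: \<phi>_def s_def)
  have sP: "s \<notin> P" using \<phi>P \<phi>s by (force simp: N0_def)
  have groupP: "{e \<in> P. \<phi> e = i} = group i" if "i \<in> N0" for i
    using that \<phi>_group by (auto simp: P_def)
  have card_group: "card (group i) = F {i}" for i
    unfolding group_def by (subst card_image) (auto simp: inj_on_def)
  have size: "card {e \<in> P. \<phi> e = i} = F {i}" if "i \<in> S" "S \<subseteq> N0" for i S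
    using that groupP card_group by (auto simp: subset_iff)
  define G where "G = (\<lambda>S. {e \<in> P. \<phi> e \<in> S})"
  have G: "\<rho> (G S) = F S" "card (G S) = (\<Sum>i\<in>S. F {i})" if "S \<subseteq> N0" for S
    using expansion_groups[OF N(1) finP _ F0 F_mono F_sub size[OF _ that], of S] that N(2)
    by (auto simp: \<rho>_def G_def)
  have GP: "G N0 = P" using \<phi>P by (auto simp: G_def)
  have F_00: "F {0} \<ge> 1"
  proof -
    have "log 2 (h {0}) \<ge> 1" using h0 by simp
    then have "real m * 1 \<le> m * log 2 (h {0})" by (intro mult_left_mono) auto
    then have "real m \<le> F {0}" using F_approx[of "{0}"] by (simp add: N_def)
    then show ?thesis using \<open>m > 0\<close> by linarith
  qed
  have "prod_encode (0, 0) \<in> group 0" using F_00 by (simp add: group_def image_iff)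
  then have P_ne: "P \<noteq> {}" by (auto simp: P_def N0_def intro: exI[of _ 0])
  have F1: "F {\<phi> e} \<ge> 1" if e: "e \<in> insert s P" for e
  proof (cases "e = s")
    case True
    have "F {0} \<le> F N" by (rule F_mono) (auto simp: N_def)
    then show ?thesis using True F5[of "{5}"] F_00 N \<phi>s by simp
  next
    case False
    then obtain i where "e \<in> group i" using e by (auto simp: P_def)
    then show ?thesis using \<phi>_group[of e i] by (auto simp: group_def)
  qed
  have \<phi>E: "\<phi> ` insert s P \<subseteq> N" using \<phi>P \<phi>s N by auto
  have mrE: "matroid_rank (insert s P) \<rho>"
    unfolding \<rho>_def using finP F1 by (intro matroid_rank_expansion N(1) \<phi>E F0 F_mono F_sub) auto
  interpret matroid_rank P \<rho>
    unfolding \<rho>_def using finP F1 \<phi>E P_ne by (intro matroid_rank_expansion N(1) F0 F_mono F_sub) auto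
  have rP: "\<rho> P = F N" using G(1)[of N0] GP F_N0 by simp
  have "almost_entropic (\<lambda>T. real (\<rho> T)) (insert s P)"
  proof (rule almost_entropicI)
    show "finite (insert s P)" using finP by simp
    show "\<rho> {} = 0" using rank_le_card[of "{}"] by simp
    fix j :: nat
    obtain k where k: "quasi_uniform N k" "\<And>S. S \<subseteq> N \<Longrightarrow> (2 ^ j) ^ F S \<le> k S"
      "\<And>S. S \<subseteq> N \<Longrightarrow> real (k S) \<le> 2 ^ 32 * (2 ^ j) ^ F S" using F_qu by blast
    have finE: "finite (insert s P)" using finP by simp
    \<comment> \<open>With alphabet size \<open>2 ^ j\<close> the factor \<open>log 2 q\<close> is
      \<open>j\<close>, and no other term of the error depends on \<open>j\<close>.\<close>
    have q: "(2::nat) ^ j \<ge> 1" and K: "(2::real) ^ 32 \<ge> 1" by simp_all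
    obtain \<Omega> :: "nat set" and Y :: "nat \<Rightarrow> nat \<Rightarrow> nat" where \<Omega>: "finite \<Omega>" "\<Omega> \<noteq> {}"
      and Y: "\<And>T. T \<subseteq> insert s P \<Longrightarrow> \<bar>uniform_ent \<Omega> (\<lambda>\<omega>. restrict (\<lambda>e. Y e \<omega>) T) - \<rho> T * log 2 ((2::nat) ^ j)\<bar>
         \<le> log 2 (2 ^ 32) + card (insert s P) + card N"
    proof (rule hashed_entropy[OF k(1) N(1) finE \<phi>E q K, where F = F and \<rho> = \<rho>])
      show "real (k S) \<le> 2 ^ 32 * real (2 ^ j) ^ F S" if "S \<subseteq> N" for S using k(3)[OF that] by simp
      show "\<rho> T \<le> F S + card {e \<in> T. \<phi> e \<notin> S}" if "S \<subseteq> N" for T S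
        unfolding \<rho>_def using N(1) that by (rule expansion_le)
      show "\<exists>S\<subseteq>N. \<rho> T = F S + card {e \<in> T. \<phi> e \<notin> S}" for T
        unfolding \<rho>_def using N(1) by (rule expansion_attained)
    qed (use k(2) in auto)
    have "log 2 (real (2 ^ j)) = real j" by simp
    then show "\<exists>(\<Omega> :: nat set) Y :: nat \<Rightarrow> nat \<Rightarrow> nat. finite \<Omega> \<and> \<Omega> \<noteq> {} \<and>
      (\<forall>T\<subseteq>insert s P. \<bar>uniform_ent \<Omega> (\<lambda>\<omega>. restrict (\<lambda>e. Y e \<omega>) T) - real (\<rho> T) * real j\<bar>
        \<le> log 2 (2 ^ 32) + card (insert s P) + card N)"
      using \<Omega> Y by (intro exI[of _ \<Omega>] exI[of _ Y]) simp
  qed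
  then have ideal: "almost_ideal P spanning"
  proof (rule almost_ideal_spanning[OF sP _ mrE])
    show "\<rho> (insert s A) = min (\<rho> P) (Suc (\<rho> A))" if "A \<subseteq> P" for A
      unfolding \<rho>_def
    proof (rule expansion_insert_generic[where \<phi> = \<phi>, OF N(1) finP sP that N(4) \<phi>s])
      show "F S = F N" if "S \<subseteq> N" "5 \<in> S" for S using that by (rule F5)
      show "\<phi> ` P \<subseteq> N" using \<phi>E by simp
      show "expansion F N \<phi> P = F N" using rP by (simp add: \<rho>_def)
    qed
  qed simp
  have "\<not> almost_ideal P (dual_access P spanning)"
  proof
    assume "almost_ideal P (dual_access P spanning)"
    then obtain s' g where s': "s' \<notin> P" and g: "realizes g s' P (dual_access P spanning)"
      and ae: "almost_entropic g (insert s' P)" and c: "complexity g s' P = 1"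
      unfolding almost_ideal_def by blast
    define \<sigma> where "\<sigma> = g {s'}"
    have \<sigma>: "\<sigma> > 0" using dual_rank_bounds(1)[OF s' g c] by (simp add: \<sigma>_def)
    \<comment> \<open>The dual rank of the union of the groups in \<open>S\<close>, written in terms
      of \<open>F\<close>.\<close>
    define \<mu> where "\<mu> = (\<lambda>S. (\<Sum>i\<in>S. real (F {i})) + real (F (N0 - S)) - real (F N0))"
    have g_approx: "\<sigma> * \<mu> S \<le> g (G S) \<and> g (G S) \<le> \<sigma> * \<mu> S + \<sigma>" if S: "S \<subseteq> N0" for S
    proof -
      have "P - G S = G (N0 - S)" using \<phi>P by (auto simp: G_def)
      then have "\<rho> (P - G S) = F (N0 - S)" using G(1)[of "N0 - S"] by auto
      moreover have "G S \<subseteq> P" by (auto simp: G_def)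
      ultimately show ?thesis
        using dual_rank_bounds(2,3)[OF s' g c, of "G S"] G(2)[OF S] rP F_N0
        by (simp add: \<mu>_def \<sigma>_def distrib_left)
    qed
    have GU: "G A \<union> G B = G (A \<union> B)" for A B by (auto simp: G_def)
    have "0 \<le> mmrv_gap g (G {0}) (G {1}) (G {2}) (G {3}) (G {4})"
      by (rule almost_entropic_mmrv[OF ae]) (auto simp: G_def)
    also have "\<dots> = mmrv_gap (\<lambda>S. g (G S)) {0} {1} {2} {3} {4}"
      by (simp only: mmrv_gap_def GU)
    also have "\<dots> \<le> \<sigma> * mmrv_gap \<mu> {0} {1} {2} {3} {4} + 11 * \<sigma>"
      using g_approx by (rule mmrv_gap_perturb) (auto simp: N0_def)
    finally have "0 \<le> \<sigma> * (mmrv_gap \<mu> {0} {1} {2} {3} {4} + 11)" by (simp add: algebra_simps)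
    then have "0 \<le> mmrv_gap \<mu> {0} {1} {2} {3} {4} + 11" using \<sigma> by (simp add: zero_le_mult_iff)
    \<comment> \<open>The sum of the \<open>F {i}\<close> is modular and \<open>F N0\<close> is
      constant, so both cancel.\<close>
    also have "mmrv_gap \<mu> {0} {1} {2} {3} {4} = mmrv_gap (\<lambda>S. real (F (N0 - S))) {0} {1} {2} {3} {4}"
      by (simp add: mmrv_gap_def \<mu>_def)
    also have "\<dots> \<le> m * mmrv_gap (\<lambda>S. log 2 (h (N0 - S))) {0} {1} {2} {3} {4} + 11 * 32"
    proof (rule mmrv_gap_perturb[where N = N0])
      show "m * log 2 (h (N0 - S)) \<le> F (N0 - S) \<and> F (N0 - S) \<le> m * log 2 (h (N0 - S)) + 32" for S
        by (rule F_approx) (use N(2) in auto)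
    qed (auto simp: N0_def)
    finally show False using m by (simp add: \<delta>_def)
  qed
  then show ?thesis using finP access_structure_spanning ideal by blast
qed

section \<open>A quasi-uniform family violating the dual inequality\<close>

text \<open>A label-preserving permutation permutes each label class separately, so these
  permutations form a Young subgroup. The induction splits off one class \<open>B\<close> and
  factors the permutation as one of \<open>B\<close> composed with one of the rest.\<close>

lemma card_label_preserving:
  fixes l :: "'a \<Rightarrow> 'b"
  assumes "finite V" "finite A" "l ` A \<subseteq> V"
  shows "card {\<pi>. \<pi> permutes A \<and> (\<forall>x\<in>A. l (\<pi> x) = l x)} = (\<Prod>v\<in>V. fact (card {x \<in> A. l x = v}))"
  using assms
proof (induction V arbitrary: A)
  case empty
  then have "A = {}" by simp
  then have "{\<pi>. \<pi> permutes A \<and> (\<forall>x\<in>A. l (\<pi> x) = l x)} = {id}" by (auto simp: permutes_empty)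
  then show ?case by simp
next
  case (insert v V)
  define B where "B = {x \<in> A. l x = v}"
  define C where "C = {x \<in> A. l x \<noteq> v}"
  have A: "A = B \<union> C" "B \<inter> C = {}" "finite B" "finite C" using insert.prems by (auto simp: B_def C_def)
  have "l ` C \<subseteq> V" using insert.prems by (auto simp: C_def)
  let ?R = "\<lambda>A. {\<pi>. \<pi> permutes A \<and> (\<forall>x\<in>A. l (\<pi> x) = l x)}"
  have fixB: "\<pi> x = x" if "\<pi> permutes B" "x \<notin> B" for \<pi> x using that by (rule permutes_not_in)
  have fixC: "\<pi> x = x" if "\<pi> permutes C" "x \<notin> C" for \<pi> x using that by (rule permutes_not_in)
  have inB: "\<pi> x \<in> B \<longleftrightarrow> x \<in> B" if "\<pi> permutes B" for \<pi> x using that by (rule permutes_in_image)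
  have inC: "\<pi> x \<in> C \<longleftrightarrow> x \<in> C" if "\<pi> permutes C" for \<pi> x using that by (rule permutes_in_image)
  have inj: "inj_on (\<lambda>(p, q). p \<circ> q) ({p. p permutes B} \<times> ?R C)"
  proof (rule inj_onI, clarify)
    fix p q p' q' assume p: "p permutes B" "p' permutes B" and q: "q permutes C" "q' permutes C"
      and eq: "p \<circ> q = p' \<circ> q'"
    have "q x = q' x" for x
    proof (cases "x \<in> C")
      case True
      then have "q x \<notin> B" "q' x \<notin> B" using inC q A(2) by blast+
      then show ?thesis using fun_cong[OF eq, of x] fixB[OF p(1)] fixB[OF p(2)] by simp
    qed (use fixC[OF q(1)] fixC[OF q(2)] in simp)
    moreover have "p x = p' x" for x
    proof (cases "x \<in> B")
      case True
      then have "q x = x" "q' x = x" using fixC q A(2) by blast+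
      then show ?thesis using fun_cong[OF eq, of x] by simp
    qed (use fixB[OF p(1)] fixB[OF p(2)] in simp)
    ultimately show "p = p' \<and> q = q'" by blast
  qed
  have "?R A = (\<lambda>(p, q). p \<circ> q) ` ({p. p permutes B} \<times> ?R C)"
  proof
    show "(\<lambda>(p, q). p \<circ> q) ` ({p. p permutes B} \<times> ?R C) \<subseteq> ?R A"
    proof clarify
      fix p q assume p: "p permutes B" and q: "q permutes C" and l: "\<forall>x\<in>C. l (q x) = l x"
      have "p permutes A" "q permutes A" using p q A(1) by (auto intro: permutes_subset)
      then have "p \<circ> q permutes A" by (intro permutes_compose)
      moreover have "l ((p \<circ> q) x) = l x" if "x \<in> A" for x
      proof (cases "x \<in> C")
        case True
        then have "q x \<in> C" using inC[OF q] by simp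
        then have "p (q x) = q x" using A(2) by (intro fixB[OF p]) auto
        then show ?thesis using l True by simp
      next
        case False
        then have "x \<in> B" "q x = x" using that A(1) fixC[OF q] by auto
        then show ?thesis using inB[OF p, of x] by (auto simp: B_def)
      qed
      ultimately show "p \<circ> q permutes A \<and> (\<forall>x\<in>A. l ((p \<circ> q) x) = l x)" by blast
    qed
    show "?R A \<subseteq> (\<lambda>(p, q). p \<circ> q) ` ({p. p permutes B} \<times> ?R C)"
    proof clarify
      fix \<pi> assume \<pi>: "\<pi> permutes A" and l: "\<forall>x\<in>A. l (\<pi> x) = l x"
      define p where "p = (\<lambda>x. if x \<in> B then \<pi> x else x)"
      define q where "q = (\<lambda>x. if x \<in> C then \<pi> x else x)"
      have inA: "\<pi> x \<in> A" if "x \<in> A" for x using permutes_in_image[OF \<pi>] that by simp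
      have \<pi>B: "\<pi> x \<in> B" if "x \<in> B" for x using that l inA by (auto simp: B_def)
      have \<pi>C: "\<pi> x \<in> C" if "x \<in> C" for x using that l inA by (auto simp: C_def)
      have inj\<pi>: "inj \<pi>" using permutes_inj[OF \<pi>] .
      have "inj_on p B" using inj\<pi> by (auto simp: p_def inj_on_def)
      moreover have "p ` B \<subseteq> B" using \<pi>B by (auto simp: p_def)
      ultimately have "bij_betw p B B" using A(3) by (simp add: bij_betw_def endo_inj_surj)
      then have p: "p permutes B" by (rule bij_imp_permutes) (simp add: p_def)
      have "inj_on q C" using inj\<pi> by (auto simp: q_def inj_on_def)
      moreover have "q ` C \<subseteq> C" using \<pi>C by (auto simp: q_def)
      ultimately have "bij_betw q C C" using A(4) by (simp add: bij_betw_def endo_inj_surj)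
      then have q: "q permutes C" by (rule bij_imp_permutes) (simp add: q_def)
      have "\<pi> x = (p \<circ> q) x" for x
      proof (cases "x \<in> C")
        case True
        then show ?thesis using \<pi>C[OF True] A(2) by (auto simp: p_def q_def)
      next
        case False
        then show ?thesis using permutes_not_in[OF \<pi>, of x] A(1) by (auto simp: p_def q_def)
      qed
      then have "\<pi> = (\<lambda>(p, q). p \<circ> q) (p, q)" by auto
      moreover have "q \<in> ?R C" using q l A(1) by (auto simp: q_def)
      ultimately show "\<pi> \<in> (\<lambda>(p, q). p \<circ> q) ` ({p. p permutes B} \<times> ?R C)" using p by blast
    qed
  qed
  then have "card (?R A) = card {p. p permutes B} * card (?R C)"
    using inj by (simp only: card_image card_cartesian_product)
  also have "card {p. p permutes B} = fact (card B)" using A(3) by (intro card_permutations) auto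
  also have "card (?R C) = (\<Prod>w\<in>V. fact (card {x \<in> C. l x = w}))"
    using insert.IH[OF A(4) \<open>l ` C \<subseteq> V\<close>] .
  also have "\<dots> = (\<Prod>w\<in>V. fact (card {x \<in> A. l x = w}))"
  proof (rule prod.cong[OF refl])
    fix w assume "w \<in> V"
    then have "{x \<in> C. l x = w} = {x \<in> A. l x = w}" using insert.hyps(2) by (auto simp: C_def)
    then show "fact (card {x \<in> C. l x = w}) = fact (card {x \<in> A. l x = w})" by simp
  qed
  finally show ?case using insert.hyps by (simp add: B_def)
qed

text \<open>Equal fibres partition the space, so \<open>div\<close> is exact here.\<close>

lemma quasi_uniform_constant_fibres:
  fixes \<Omega> :: "'a set" and X :: "'i \<Rightarrow> 'a \<Rightarrow> 'b"
  assumes \<Omega>: "finite \<Omega>" "\<Omega> \<noteq> {}" and N: "finite N"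
    and d: "\<And>S \<omega>. S \<subseteq> N \<Longrightarrow> \<omega> \<in> \<Omega> \<Longrightarrow> card (agree \<Omega> X S \<omega>) = d S"
  shows "quasi_uniform N (\<lambda>S. card \<Omega> div d S)" and "\<And>S. S \<subseteq> N \<Longrightarrow> d S * (card \<Omega> div d S) = card \<Omega>"
proof -
  show dvd: "d S * (card \<Omega> div d S) = card \<Omega>" if S: "S \<subseteq> N" for S
  proof -
    obtain \<omega> where "\<omega> \<in> \<Omega>" using \<Omega> by blast
    then have pos: "d S > 0" using d[OF S] card_agree_pos[OF \<Omega>(1)] by metis
    have "real (card ((\<lambda>\<omega>. restrict (\<lambda>i. X i \<omega>) S) ` \<Omega>)) = (\<Sum>\<omega>\<in>\<Omega>. 1 / real (d S))"
      using sum_inverse_card_fibre[OF \<Omega>(1), of "\<lambda>\<omega>. restrict (\<lambda>i. X i \<omega>) S"] d[OF S]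
      by (simp add: fibre_restrict)
    then have "real (card ((\<lambda>\<omega>. restrict (\<lambda>i. X i \<omega>) S) ` \<Omega>)) * real (d S) = real (card \<Omega>)"
      using pos by simp
    then have "card ((\<lambda>\<omega>. restrict (\<lambda>i. X i \<omega>) S) ` \<Omega>) * d S = card \<Omega>"
      by (metis of_nat_eq_iff of_nat_mult)
    then show ?thesis by (metis dvd_mult_div_cancel dvd_triv_right)
  qed
  show "quasi_uniform N (\<lambda>S. card \<Omega> div d S)"
    by (rule quasi_uniformI[OF \<Omega> N, of X]) (simp add: d dvd)
qed

text \<open>Six labellings of eight cells: the bits \<open>a\<close>, \<open>b\<close> and \<open>e\<close> of the cell (labels 0, 1, 4), the
  cell itself (label 5), and two labels that vanish if \<open>e = a + b\<close>, which is the case for the first four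
  cells, and otherwise reveal the cell, label 2 for \<open>a = 0\<close> and label 3 for \<open>a = 1\<close>.\<close>

definition cell_label :: "nat \<Rightarrow> nat \<Rightarrow> nat" where
  "cell_label i c = [[0,0,1,1,0,0,1,1], [0,1,0,1,0,1,0,1], [0,0,0,0,1,2,0,0],
     [0,0,0,0,0,0,1,2], [0,1,1,0,1,0,0,1], [0,1,2,3,4,5,6,7]] ! i ! c"

text \<open>With cells of 5 and 10 points the classes that occur in the dual inequality have only
  sizes 5, 10, 15 and 20, as 2 * 5 = 10 and 4 * 5 = 2 * 5 + 10.\<close>

definition cell :: "nat \<Rightarrow> nat" where
  "cell x = (if x < 20 then x div 5 else 4 + (x - 20) div 10)"

definition labels :: "nat list \<Rightarrow> nat \<Rightarrow> nat list" where
  "labels is c = map (\<lambda>i. cell_label i c) is"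

text \<open>The order of the Young subgroup that preserves all labels in \<open>is\<close>, as a
  product over lists that can be evaluated.\<close>

definition stabilizer_card :: "nat list \<Rightarrow> nat" where
  "stabilizer_card is = (\<Prod>v\<leftarrow>remdups (map (labels is) [0..<8]).
     fact (\<Sum>c\<leftarrow>filter (\<lambda>c. labels is c = v) [0..<8]. if c < 4 then 5 else 10))"

lemma card_cell: "c < 8 \<Longrightarrow> card {x \<in> {..<60}. cell x = c} = (if c < 4 then 5 else 10)"
proof (cases "c < 4")
  case True
  then have "{x \<in> {..<60}. cell x = c} = {5 * c..<5 * c + 5}"
    by (auto simp: cell_def split: if_splits)
  then show ?thesis using True by simp
next
  case False
  assume "c < 8"
  with False have "{x \<in> {..<60}. cell x = c} = {10 * c - 20..<10 * c - 10}"
    by (auto simp: cell_def split: if_splits)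
  then show ?thesis using False by simp
qed

lemma cell_less: "x < 60 \<Longrightarrow> cell x < 8"
  by (auto simp: cell_def)

lemma card_stabilizer:
  "card {\<pi>. \<pi> permutes {..<60} \<and> (\<forall>x\<in>{..<60}. labels is (cell (\<pi> x)) = labels is (cell x))} = stabilizer_card is"
proof -
  let ?l = "\<lambda>x. labels is (cell x)" and ?V = "set (map (labels is) [0..<8])"
  have "card {\<pi>. \<pi> permutes {..<60} \<and> (\<forall>x\<in>{..<60}. ?l (\<pi> x) = ?l x)} = (\<Prod>v\<in>?V. fact (card {x \<in> {..<60}. ?l x = v}))"
    by (rule card_label_preserving) (auto simp: cell_less)
  also have "\<dots> = (\<Prod>v\<in>?V. fact (\<Sum>c\<leftarrow>filter (\<lambda>c. labels is c = v) [0..<8]. if c < 4 then 5 else 10))"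
  proof (rule prod.cong[OF refl])
    fix v
    define K where "K = filter (\<lambda>c. labels is c = v) [0..<8]"
    have "{x \<in> {..<60}. ?l x = v} = (\<Union>c\<in>set K. {x \<in> {..<60}. cell x = c})"
      by (auto simp: K_def cell_less)
    also have "card \<dots> = (\<Sum>c\<in>set K. card {x \<in> {..<60}. cell x = c})"
      by (rule card_UN_disjoint) auto
    also have "\<dots> = (\<Sum>c\<in>set K. if c < 4 then 5 else 10)"
      by (rule sum.cong[OF refl], rule card_cell) (auto simp: K_def)
    also have "\<dots> = (\<Sum>c\<leftarrow>K. if c < 4 then 5 else 10)"
      by (rule sum.distinct_set_conv_list) (simp add: K_def)
    finally show "fact (card {x \<in> {..<60}. ?l x = v}) = fact (\<Sum>c\<leftarrow>filter (\<lambda>c. labels is c = v) [0..<8]. if c < 4 then 5 else 10)"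
      by (simp add: K_def)
  qed
  also have "\<dots> = stabilizer_card is"
    unfolding stabilizer_card_def
    by (subst prod.distinct_set_conv_list[symmetric]) simp_all
  finally show ?thesis .
qed


text \<open>Variable \<open>i\<close> is the word of labels \<open>i\<close> read along a random
  ordering. Orderings that agree on \<open>S\<close> form a coset of the stabilizer of these labels,
  so all fibres have the same size.\<close>

lemma quasi_uniform_labels:
  "quasi_uniform {..<6} (\<lambda>S. fact 60 div stabilizer_card (sorted_list_of_set S))"
  "S \<subseteq> {..<6} \<Longrightarrow> stabilizer_card (sorted_list_of_set S) * (fact 60 div stabilizer_card (sorted_list_of_set S)) = fact 60"
proof -
  define \<Omega> where "\<Omega> = {\<sigma>. \<sigma> permutes {..<60::nat}}"
  define X where "X = (\<lambda>i \<sigma>. map (\<lambda>x. cell_label i (cell (\<sigma> x))) [0..<60])"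
  have \<Omega>: "finite \<Omega>" "card \<Omega> = fact 60" "id \<in> \<Omega>"
    by (simp_all add: \<Omega>_def finite_permutations card_permutations permutes_id)
  have d: "card (agree \<Omega> X S \<sigma>) = stabilizer_card (sorted_list_of_set S)" if S: "S \<subseteq> {..<6}" and \<sigma>: "\<sigma> \<in> \<Omega>" for S \<sigma>
  proof -
    let ?l = "\<lambda>x. labels (sorted_list_of_set S) (cell x)"
    let ?R = "{\<pi>. \<pi> permutes {..<60} \<and> (\<forall>x\<in>{..<60}. ?l (\<pi> x) = ?l x)}"
    have finS: "finite S" using S finite_subset by blast
    have l: "?l x = ?l y \<longleftrightarrow> (\<forall>i\<in>S. cell_label i (cell x) = cell_label i (cell y))" for x y
      using finS by (simp add: labels_def)
    have \<sigma>: "\<sigma> permutes {..<60}" using \<sigma> by (simp add: \<Omega>_def)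
    have mem: "\<sigma>' \<in> agree \<Omega> X S \<sigma> \<longleftrightarrow> \<sigma>' permutes {..<60} \<and> (\<forall>x\<in>{..<60}. ?l (\<sigma>' x) = ?l (\<sigma> x))" for \<sigma>'
      unfolding l by (auto simp: agree_def \<Omega>_def X_def)
    \<comment> \<open>The coset map: \<open>\<sigma>'\<close> agrees with \<open>\<sigma>\<close> if
      and only if \<open>\<sigma>' \<circ> inv \<sigma>\<close> preserves the labels.\<close>
    have "bij_betw (\<lambda>\<pi>. \<pi> \<circ> \<sigma>) ?R (agree \<Omega> X S \<sigma>)"
    proof (rule bij_betw_byWitness[where f' = "\<lambda>\<sigma>'. \<sigma>' \<circ> inv \<sigma>"])
      show "\<forall>\<pi>\<in>?R. (\<pi> \<circ> \<sigma>) \<circ> inv \<sigma> = \<pi>"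
        using permutes_inv_o(1)[OF \<sigma>] by (simp add: comp_assoc)
      show "\<forall>\<sigma>'\<in>agree \<Omega> X S \<sigma>. (\<sigma>' \<circ> inv \<sigma>) \<circ> \<sigma> = \<sigma>'"
        using permutes_inv_o(2)[OF \<sigma>] by (simp add: comp_assoc)
      show "(\<lambda>\<pi>. \<pi> \<circ> \<sigma>) ` ?R \<subseteq> agree \<Omega> X S \<sigma>"
        using \<sigma> permutes_in_image[OF \<sigma>] by (auto simp: mem intro!: permutes_compose)
      show "(\<lambda>\<sigma>'. \<sigma>' \<circ> inv \<sigma>) ` agree \<Omega> X S \<sigma> \<subseteq> ?R"
      proof clarify
        fix \<sigma>' assume "\<sigma>' \<in> agree \<Omega> X S \<sigma>"
        then have \<sigma>': "\<sigma>' permutes {..<60}" "\<And>x. x < 60 \<Longrightarrow> ?l (\<sigma>' x) = ?l (\<sigma> x)" by (auto simp: mem)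
        have inv: "inv \<sigma> permutes {..<60}" using \<sigma> by (rule permutes_inv)
        have "?l ((\<sigma>' \<circ> inv \<sigma>) x) = ?l x" if "x < 60" for x
        proof -
          have "inv \<sigma> x < 60" using permutes_in_image[OF inv, of x] that by simp
          then have "?l (\<sigma>' (inv \<sigma> x)) = ?l (\<sigma> (inv \<sigma> x))" by (rule \<sigma>'(2))
          then show ?thesis using permutes_inverses(1)[OF \<sigma>] by simp
        qed
        then show "\<sigma>' \<circ> inv \<sigma> permutes {..<60} \<and> (\<forall>x\<in>{..<60}. ?l ((\<sigma>' \<circ> inv \<sigma>) x) = ?l x)"
          using permutes_compose[OF inv \<sigma>'(1)] by auto
      qed
    qed
    then have "card (agree \<Omega> X S \<sigma>) = card ?R" by (simp add: bij_betw_same_card)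
    then show ?thesis by (simp only: card_stabilizer)
  qed
  have "\<Omega> \<noteq> {}" using \<Omega>(3) by blast
  note main = quasi_uniform_constant_fibres[where d = "\<lambda>S. stabilizer_card (sorted_list_of_set S)", OF \<Omega>(1) this _ d, of "{..<6}"]
  show "quasi_uniform {..<6} (\<lambda>S. fact 60 div stabilizer_card (sorted_list_of_set S))"
    using main(1) unfolding \<Omega>(2) by simp
  show "stabilizer_card (sorted_list_of_set S) * (fact 60 div stabilizer_card (sorted_list_of_set S)) = fact 60" if "S \<subseteq> {..<6}"
    using main(2) that unfolding \<Omega>(2) by simp
qed

text \<open>If the labels separate the eight cells, only permutations within the cells remain. This
  treats all families containing label 5 at once.\<close>

lemma stabilizer_card_distinct:
  assumes "distinct (map (labels is) [0..<8])"
  shows "stabilizer_card is = fact 5 ^ 4 * fact 10 ^ 4"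
proof -
  have inj: "labels is c = labels is c' \<longleftrightarrow> c = c'" if "c < 8" "c' < 8" for c c'
    using assms that by (auto simp: distinct_map inj_on_def)
  have "filter (\<lambda>c'. labels is c' = labels is c) [0..<8] = [c]" if "c < 8" for c
  proof -
    have "filter (\<lambda>c'. labels is c' = labels is c) [0..<8] = filter (\<lambda>c'. c' = c) [0..<8]"
      using inj that by (intro filter_cong) auto
    also have "\<dots> = [c]" using that by (simp add: upt_rec)
    finally show ?thesis .
  qed
  then have "stabilizer_card is = (\<Prod>c\<leftarrow>[0..<8]. fact (if c < 4 then 5 else 10))"
    unfolding stabilizer_card_def distinct_remdups_id[OF assms] map_map
    by (intro arg_cong[of _ _ prod_list] map_cong) auto
  also have "\<dots> = fact 5 ^ 4 * fact 10 ^ 4" by (simp add: upt_rec power4_eq_xxxx mult.assoc)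
  finally show ?thesis .
qed

lemma distinct_labels_cell:
  assumes "5 \<in> set is"
  shows "distinct (map (labels is) [0..<8])"
proof -
  have cell: "cell_label 5 c = c" if "c < 8" for c
  proof -
    have "c = [0..<8] ! c" using that by simp
    moreover have "[0..<8] = [0,1,2,3,4,5,6,7::nat]" by (simp add: upt_rec)
    ultimately show ?thesis by (simp add: cell_label_def numeral_nat(7))
  qed
  have "inj_on (labels is) (set [0..<8])"
  proof (rule inj_onI)
    fix c c' assume "c \<in> set [0..<8]" "c' \<in> set [0..<8]" and eq: "labels is c = labels is c'"
    moreover have "cell_label 5 c = cell_label 5 c'" using eq assms by (simp add: labels_def)
    ultimately show "c = c'" using cell[of c] cell[of c'] by simp
  qed
  then show ?thesis by (simp add: distinct_map)
qed

lemma stabilizer_cards: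
  "stabilizer_card [0] = fact 30 ^ 2"
  "stabilizer_card [0,1,2,3,4] = fact 5 ^ 4 * fact 10 ^ 4"
  "stabilizer_card [0,1,2,3] = fact 5 ^ 4 * fact 10 ^ 4"
  "stabilizer_card [0,2,3,4] = fact 5 ^ 4 * fact 10 ^ 4"
  "stabilizer_card [1,2,3,4] = fact 5 ^ 4 * fact 10 ^ 4"
  "stabilizer_card [0,1,4] = fact 5 ^ 4 * fact 10 ^ 4"
  "stabilizer_card [0,2,3] = fact 10 ^ 6"
  "stabilizer_card [1,2,3] = fact 10 ^ 6"
  "stabilizer_card [2,3,4] = fact 10 ^ 6"
  "stabilizer_card [0,2,4] = fact 5 ^ 2 * fact 10 ^ 2 * fact 15 ^ 2"
  "stabilizer_card [0,3,4] = fact 5 ^ 2 * fact 10 ^ 2 * fact 15 ^ 2"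
  "stabilizer_card [1,2,4] = fact 5 ^ 2 * fact 10 ^ 2 * fact 15 ^ 2"
  "stabilizer_card [1,3,4] = fact 5 ^ 2 * fact 10 ^ 2 * fact 15 ^ 2"
  "stabilizer_card [2,3] = fact 10 ^ 4 * fact 20"
  "stabilizer_card [2,4] = fact 10 ^ 2 * fact 20 ^ 2"
  "stabilizer_card [3,4] = fact 10 ^ 2 * fact 20 ^ 2"
  by (simp_all add: stabilizer_card_def labels_def cell_label_def upt_rec fact_numeral)

text \<open>The dual violation after \<open>fact 60\<close> has cancelled. Factorials follow
  entropies only for cells that are large enough: with 1 and 2 points in place of 5 and 10 the
  inequality would be reversed.\<close>

lemma factorial_inequality: "(fact 5 :: real) ^ 16 * fact 20 ^ 7 < fact 10 ^ 10 * fact 15 ^ 8"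
  by (simp add: fact_numeral)

theorem theorem4p1:
  shows "\<exists>(P :: nat set) \<A>. finite P \<and> access_structure P \<A> \<and>
           almost_ideal P \<A> \<and> \<not> almost_ideal P (dual_access P \<A>)"
proof -
  define D where "D = (\<lambda>S. stabilizer_card (sorted_list_of_set S))"
  define h where "h = (\<lambda>S. fact 60 div D S)"
  have D: "D (set is) = stabilizer_card is" if "sorted is" "distinct is" for "is"
    using that by (simp add: D_def sorted_list_of_set.idem_if_sorted_distinct)
  have Dh: "D S * h S = fact 60" if "S \<subseteq> {..<6}" for S
    using quasi_uniform_labels(2)[OF that] by (simp add: D_def h_def)
  have D_five: "D {..<5} = fact 5 ^ 4 * fact 10 ^ 4"
  proof -
    have "{..<5} = set [0,1,2,3,4::nat]" by auto
    then show ?thesis using D[of "[0,1,2,3,4]"] stabilizer_cards(2) by simp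
  qed
  show ?thesis
  proof (rule almost_ideal_not_self_dual[of h])
    show "quasi_uniform {..<6} h" using quasi_uniform_labels(1) by (simp add: D_def h_def)
    fix S :: "nat set" assume "S \<subseteq> {..<6}" "5 \<in> S"
    \<comment> \<open>Label 5 is the cell, and labels 0 to 4 together determine the cell as well, so
      the stabilizers coincide.\<close>
    then have "5 \<in> set (sorted_list_of_set S)" by (metis finite_lessThan finite_subset set_sorted_list_of_set)
    then show "h S = h {..<5}"
      using stabilizer_card_distinct[OF distinct_labels_cell] D_five by (simp add: h_def D_def)
  next
    have "h {0} = fact 60 div fact 30 ^ 2" using D[of "[0]"] stabilizer_cards(1) by (simp add: h_def)
    then show "2 \<le> h {0}" by (simp add: fact_numeral)
  next
    have log_h: "log 2 (h (set is)) = log 2 (fact 60) - log 2 (stabilizer_card is)"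
      if "sorted is" "distinct is" "set is \<subseteq> {..<6}" for "is"
    proof -
      have "stabilizer_card is * h (set is) = fact 60" using Dh[OF that(3)] D[OF that(1,2)] by simp
      then have eq: "real (stabilizer_card is) * real (h (set is)) = fact 60"
        by (metis of_nat_fact of_nat_mult)
      then have "real (stabilizer_card is) \<noteq> 0" "real (h (set is)) \<noteq> 0"
        by (metis fact_nonzero mult_zero_left, metis fact_nonzero mult_zero_right)
      then show ?thesis by (simp add: eq[symmetric] log_mult)
    qed
    have log_fact: "log 2 (fact n ^ k) = k * log 2 (fact n :: real)" for n k :: nat
      by (simp add: log_nat_power)
    have ineq: "16 * log 2 (fact 5) + 7 * log 2 (fact 20) < 10 * log 2 (fact 10) + 8 * log 2 (fact 15 :: real)"
    proof -
      have "log 2 ((fact 5 :: real) ^ 16 * fact 20 ^ 7) < log 2 (fact 10 ^ 10 * fact 15 ^ 8)"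
        using factorial_inequality by simp
      then show ?thesis by (simp add: log_mult log_fact)
    qed
    \<comment> \<open>Complements of the arguments of \<open>mmrv_gap\<close> within the first five
      labels, listed in increasing order to match \<open>stabilizer_cards\<close>.\<close>
    have sets: "{..<5} - ({0} \<union> {2}) = set [1,3,4::nat]" "{..<5} - ({1} \<union> {2}) = set [0,3,4::nat]"
      "{..<5} - ({0} \<union> {3}) = set [1,2,4::nat]" "{..<5} - ({1} \<union> {3}) = set [0,2,4::nat]"
      "{..<5} - ({0} \<union> {4}) = set [1,2,3::nat]" "{..<5} - ({1} \<union> {4}) = set [0,2,3::nat]"
      "{..<5} - ({0} \<union> {1}) = set [2,3,4::nat]" "{..<5} - {0} = set [1,2,3,4::nat]"
      "{..<5} - {1} = set [0,2,3,4::nat]" "{..<5} - ({0} \<union> {1} \<union> {2}) = set [3,4::nat]"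
      "{..<5} - ({0} \<union> {1} \<union> {3}) = set [2,4::nat]" "{..<5} - ({2} \<union> {3}) = set [0,1,4::nat]"
      "{..<5} - ({0} \<union> {1} \<union> {4}) = set [2,3::nat]" "{..<5} - {4} = set [0,1,2,3::nat]"
      by auto
    have logs: "log 2 (h (set [1,3,4])) = log 2 (fact 60) - (2 * log 2 (fact 5) + 2 * log 2 (fact 10) + 2 * log 2 (fact 15))"
      "log 2 (h (set [0,3,4])) = log 2 (fact 60) - (2 * log 2 (fact 5) + 2 * log 2 (fact 10) + 2 * log 2 (fact 15))"
      "log 2 (h (set [1,2,4])) = log 2 (fact 60) - (2 * log 2 (fact 5) + 2 * log 2 (fact 10) + 2 * log 2 (fact 15))"
      "log 2 (h (set [0,2,4])) = log 2 (fact 60) - (2 * log 2 (fact 5) + 2 * log 2 (fact 10) + 2 * log 2 (fact 15))"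
      "log 2 (h (set [1,2,3])) = log 2 (fact 60) - 6 * log 2 (fact 10)"
      "log 2 (h (set [0,2,3])) = log 2 (fact 60) - 6 * log 2 (fact 10)"
      "log 2 (h (set [2,3,4])) = log 2 (fact 60) - 6 * log 2 (fact 10)"
      "log 2 (h (set [1,2,3,4])) = log 2 (fact 60) - (4 * log 2 (fact 5) + 4 * log 2 (fact 10))"
      "log 2 (h (set [0,2,3,4])) = log 2 (fact 60) - (4 * log 2 (fact 5) + 4 * log 2 (fact 10))"
      "log 2 (h (set [3,4])) = log 2 (fact 60) - (2 * log 2 (fact 10) + 2 * log 2 (fact 20))"
      "log 2 (h (set [2,4])) = log 2 (fact 60) - (2 * log 2 (fact 10) + 2 * log 2 (fact 20))"
      "log 2 (h (set [0,1,4])) = log 2 (fact 60) - (4 * log 2 (fact 5) + 4 * log 2 (fact 10))"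
      "log 2 (h (set [2,3])) = log 2 (fact 60) - (4 * log 2 (fact 10) + log 2 (fact 20))"
      "log 2 (h (set [0,1,2,3])) = log 2 (fact 60) - (4 * log 2 (fact 5) + 4 * log 2 (fact 10))"
      using log_h[of "[1,3,4]"] log_h[of "[0,3,4]"] log_h[of "[1,2,4]"] log_h[of "[0,2,4]"] log_h[of "[1,2,3]"] log_h[of "[0,2,3]"] log_h[of "[2,3,4]"] log_h[of "[1,2,3,4]"] log_h[of "[0,2,3,4]"] log_h[of "[3,4]"] log_h[of "[2,4]"] log_h[of "[0,1,4]"] log_h[of "[2,3]"] log_h[of "[0,1,2,3]"]
      by (simp_all add: stabilizer_cards log_mult log_fact del: One_nat_def)
    show "mmrv_gap (\<lambda>S. log 2 (h ({..<5} - S))) {0} {1} {2} {3} {4} < 0"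
      unfolding mmrv_gap_def sets logs using ineq by simp
  qed
qed

end
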